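(* Let $(q,b,h)$ be a potential with $m$-function $m$. Then there is a function $A$ on $(0,b)$, with $A\in L^1(0,b)$ if $b<\infty$ and $A\in L^1(0,a)$ for all $a<\infty$ if $b=\infty$, such that for every $a\le b$ with $0<a<\infty$, $$m(-\kappa^2)=-\kappa-\int_0^aA(\alpha)e^{-2\alpha\kappa}\,d\alpha+\tilde O(e^{-2a\kappa})\quad\text{as }\kappa\to\infty.$$ $A(\alpha)$ depends only on $q(y)$ for $y\in[0,\alpha]$ (that is, if two potentials agree a.e. on $(0,\alpha_0)$, where $\alpha_0$ is finite and at most both right endpoints, then the corresponding functions $A$ agree a.e. on $(0,\alpha_0)$). Moreover, $A(\alpha)=q(\alpha)+E(\alpha)$, where $E$ is continuous and $$|E(\alpha)|\le\left(\int_0^\alpha|q(y)|\,dy\right)^2\exp\left(\alpha\int_0^\alpha|q(y)|\,dy\right).$$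
   Context: A potential is a triple $(q,b,h)$ with $0<b\le\infty$ and $q$ a real-valued measurable function on $(0,b)$. If $b<\infty$, assume $\int_0^b|q(x)|\,dx<\infty$ and $h\in\mathbb{R}\cup\{\infty\}$, specifying the boundary condition $u'(b)+hu(b)=0$ ($h=\infty$ means $u(b)=0$). If $b=\infty$, there is no $h$, and assume $\int_y^{y+1}|q(x)|\,dx<\infty$ for all $y\ge0$ and $\sup_{y>0}\int_y^{y+1}\max(-q(x),0)\,dx<\infty$ (so that $-\frac{d^2}{dx^2}+q$ is limit point at infinity). For $z\in\mathbb{C}\setminus[\beta,\infty)$ with $-\beta$ sufficiently large there is, up to a constant multiple, a unique nonzero solution $u(x,z)$ of $-u''+qu=zu$ on $(0,b)$ which satisfies the boundary condition at $b$ if $b<\infty$, or is $L^2$ at infinity if $b=\infty$. The $m$-function is $m(z)=u'(0,z)/u(0,z)$. Notation: if $g\to0$ as $x\to x_0$, then $f=\tilde O(g)$ as $x\to x_0$ means $\lim_{x\to x_0}|f(x)|/|g(x)|^{1-\varepsilon}=0$ for every $\varepsilon>0$. *)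

theory Defs
  imports "HOL-Analysis.Analysis"
begin

(* A potential is given by q, b and h.  The value h = Some \<infinity> is the Dirichlet condition
   u(b) = 0; h = None says that there is no h, which is the case exactly when b = \<infinity>.
   Only the values of q on (0,b) = einterval 0 b matter. *)
definition is_potential :: "(real \<Rightarrow> real) \<Rightarrow> ereal \<Rightarrow> ereal option \<Rightarrow> bool" where
  "is_potential q b h \<longleftrightarrow>
     0 < b \<and> set_borel_measurable lebesgue (einterval 0 b) q \<and>
     (b < \<infinity> \<longrightarrow>
        set_integrable lebesgue (einterval 0 b) q \<and> (\<exists>h'. h = Some h' \<and> h' \<noteq> - \<infinity>)) \<and>
     (b = \<infinity> \<longrightarrow>
        h = None \<and>
        (\<forall>y\<ge>0. set_integrable lebesgue {y<..<y+1} q) \<and>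
        bdd_above ((\<lambda>y. LINT x:{y<..<y+1}|lebesgue. max (- q x) 0) ` {0<..}))"

(* Absolute continuity in the usual epsilon-delta sense: the intervals are the members of a
   division of their own union, and \<open>Inf k\<close>, \<open>Sup k\<close> are the endpoints of such an interval. *)
definition abs_continuous_on :: "real set \<Rightarrow> (real \<Rightarrow> complex) \<Rightarrow> bool" where
  "abs_continuous_on S f \<longleftrightarrow>
     (\<forall>e>0. \<exists>d>0. \<forall>D. D division_of \<Union>D \<longrightarrow> \<Union>D \<subseteq> S \<longrightarrow> (\<Sum>k\<in>D. Sup k - Inf k) < d \<longrightarrow>
        (\<Sum>k\<in>D. norm (f (Sup k) - f (Inf k))) < e)"

(* [0,b] for finite b, and [0,\<infinity>) for b = \<infinity>.  Since q is integrable up to 0 (and up to b < \<infinity>),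
   solutions and their derivatives extend continuously to these endpoints. *)
definition closed_domain :: "ereal \<Rightarrow> real set" where
  "closed_domain b = {x. 0 \<le> x \<and> ereal x \<le> b}"

(* u solves -u'' + q u = z u and v = u'.  As q is only locally integrable, u' is locally absolutely
   continuous and the equation holds almost everywhere. *)
definition is_solution ::
  "(real \<Rightarrow> real) \<Rightarrow> ereal \<Rightarrow> complex \<Rightarrow> (real \<Rightarrow> complex) \<Rightarrow> (real \<Rightarrow> complex) \<Rightarrow> bool" where
  "is_solution q b z u v \<longleftrightarrow>
     (\<forall>x\<in>closed_domain b. (u has_vector_derivative v x) (at x within closed_domain b)) \<and>
     (\<forall>c\<in>closed_domain b. abs_continuous_on {0..c} v) \<and>
     (AE x in lebesgue. x \<in> einterval 0 b \<longrightarrow>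
        (\<exists>w. (v has_vector_derivative w) (at x) \<and> - w + of_real (q x) * u x = z * u x))"

definition end_condition ::
  "ereal \<Rightarrow> ereal option \<Rightarrow> (real \<Rightarrow> complex) \<Rightarrow> (real \<Rightarrow> complex) \<Rightarrow> bool" where
  "end_condition b h u v \<longleftrightarrow>
     (case h of
        None \<Rightarrow> set_integrable lebesgue {0<..} (\<lambda>x. (norm (u x))\<^sup>2)
      | Some h' \<Rightarrow>
          (if h' = \<infinity> then u (real_of_ereal b) = 0
           else v (real_of_ereal b) + of_real (real_of_ereal h') * u (real_of_ereal b) = 0))"

definition is_weyl_solution ::
  "(real \<Rightarrow> real) \<Rightarrow> ereal \<Rightarrow> ereal option \<Rightarrow> complex \<Rightarrow>
   (real \<Rightarrow> complex) \<Rightarrow> (real \<Rightarrow> complex) \<Rightarrow> bool" where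
  "is_weyl_solution q b h z u v \<longleftrightarrow>
     is_solution q b z u v \<and> (\<exists>x\<in>closed_domain b. u x \<noteq> 0) \<and> end_condition b h u v"

(* The description is proper for z outside [\<beta>,\<infinity>) with -\<beta> sufficiently large, where u exists and
   is unique up to a constant multiple; other values of z are irrelevant. *)
definition m_function :: "(real \<Rightarrow> real) \<Rightarrow> ereal \<Rightarrow> ereal option \<Rightarrow> complex \<Rightarrow> complex" where
  "m_function q b h z = (THE w. \<exists>u v. is_weyl_solution q b h z u v \<and> w = v 0 / u 0)"

(* f = O~(g) along the filter F; it is only defined when g tends to 0 along F. *)
definition soft_O :: "'x filter \<Rightarrow> ('x \<Rightarrow> complex) \<Rightarrow> ('x \<Rightarrow> real) \<Rightarrow> bool" where
  "soft_O F f g \<longleftrightarrow>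
     (g \<longlongrightarrow> 0) F \<and>
     (\<forall>\<epsilon>>0. ((\<lambda>x. norm (f x) / \<bar>g x\<bar> powr (1 - \<epsilon>)) \<longlongrightarrow> 0) F)"

end

(* For a potential q that vanishes beyond a, the wave equation for q with Heaviside data at x = 0
   has a solution V = V_0 - V_1 + V_2 - ..., where V_(n+1) arises from V_n by integrating against q.
   The scaled Laplace transform psi of V in time solves -psi'' + q psi = -kappa^2 psi and is a
   multiple of exp(-kappa x) beyond a, so psi'(0) is the m-function of the truncated potential; in
   the time domain -psi'(0) - kappa is the Laplace transform of q + E, and finite propagation speed
   makes E(alpha) depend only on q on (0,alpha).  The series for E gives its bound.

   For an arbitrary potential, w = u' + sigma u with a bounded sigma whose derivative compensates
   the negative part of q turns the equation into one where w u is increasing.  For kappa large this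
   gives a Weyl solution u with u/u(0) >= 0 and u'/u <= C.  The Wronskian of u and psi is constant,
   and these two inequalities force it to be of order kappa exp(-2 a kappa). *)

theory Submission
  imports Defs "HOL-Real_Asymp.Real_Asymp"
begin

text \<open>The definitions speak of absolutely continuous functions with an almost-everywhere
  equation, while the estimates need integral identities. The bridge between the two is built once,
  in both directions; afterwards all calculus happens with \<open>is_primitive\<close>. Only z =
  -\<kappa>^2 occurs in the expansion. There the equation has real coefficients, so a complex Weyl
  solution is treated through its real and imaginary parts, and sign arguments become available. For
  b = \<infinity> the positive part of q is not uniformly integrable, so no uniform lower bound on
  u'/u is to be expected. The comparison is therefore arranged to ask only for u >= 0 and an upper
  bound on u'/u at a, with a constant C that does not depend on \<kappa>. The kernels live in the
  time domain because a bound on E(\<alpha>) in terms of the mass of q on (0, \<alpha>) is hard to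
  see in a transform. Bounding differences of a kernel over time, rather than its values, is what
  produces exactly the constants of the theorem. Cutting q at a does no harm: the transform of E
  beyond a is itself O(exp(-2 a \<kappa>)), and every longer cut gives the same E below a.\<close>

section \<open>Differentiation of indefinite integrals and absolute continuity\<close>

text \<open>The intervals witnessing failure at level e form a Vitali cover of the bad set,
  and Henstock's lemma bounds the total length of a disjoint subfamily.\<close>
lemma negligible_integral_not_has_vector_derivative:
  fixes f :: "real \<Rightarrow> real"
  assumes f: "f integrable_on {a..b}"
  shows "negligible {x\<in>{a<..<b}. \<not> ((\<lambda>x. integral {a..x} f) has_vector_derivative f x) (at x)}"
proof -
  define bad where "bad e x u v \<longleftrightarrow> u < v \<and> (x = u \<or> x = v) \<and> {u..v} \<subseteq> {a..b} \<and>
      norm (measure lborel {u..v} *\<^sub>R f x - integral {u..v} f) > e * (v - u)" for e x u v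
  define B where "B e = {x\<in>{a<..<b}. \<forall>d>0. \<exists>u v. bad e x u v \<and> v - u < d}" for e
  have neg: "negligible (B e)" if e: "e > 0" for e
    unfolding negligible_outer_le
  proof (intro allI impI)
    fix \<epsilon> :: real assume \<epsilon>: "\<epsilon> > 0"
    have pos: "\<epsilon> * e > 0" using \<epsilon> e by simp
    have fab: "f integrable_on cbox a b" using f by simp
    \<comment> \<open>Tolerance \<open>\<epsilon> * e\<close>: a bad interval contributes more than
      \<open>e\<close> times its length to Henstock's sum, so dividing by \<open>e\<close> bounds
      the total length by \<epsilon>.\<close>
    obtain \<gamma> where \<gamma>: "gauge \<gamma>" and
      H: "\<And>p. \<lbrakk>p tagged_partial_division_of (cbox a b); \<gamma> fine p\<rbrakk> \<Longrightarrow>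
             sum (\<lambda>(x,k). norm(measure lborel k *\<^sub>R f x - integral k f)) p < \<epsilon> * e"
      by (rule Henstock_lemma[OF fab pos]) (rule that)
    \<comment> \<open>The cover is indexed by triples because Henstock's lemma needs the tag x
      together with each interval, and x may be either endpoint.\<close>
    define K where "K = {(x,u,v). x \<in> {a<..<b} \<and> bad e x u v \<and> {u..v} \<subseteq> \<gamma> x}"
    define A where "A = (\<lambda>(x::real,u::real,v::real). (u + v) / 2)"
    define R where "R = (\<lambda>(x::real,u::real,v::real). (v - u) / 2)"
    have cb: "cball (A (x,u,v)) (R (x,u,v)) = {u..v}" for x u v
      by (auto simp: A_def R_def cball_eq_atLeastAtMost field_simps)
    have "\<exists>C. countable C \<and> C \<subseteq> K \<and> pairwise (\<lambda>i j. disjnt (cball (A i) (R i)) (cball (A j) (R j))) C \<and>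
       negligible (B e - (\<Union>i\<in>C. cball (A i) (R i)))"
    proof (rule Vitali_covering_theorem_cballs[of K R "B e" A])
      show "0 < R i" if "i \<in> K" for i using that by (auto simp: K_def R_def bad_def)
      fix x d :: real assume x: "x \<in> B e" and d: "0 < d"
      from \<gamma> obtain r where r: "r > 0" "ball x r \<subseteq> \<gamma> x"
        unfolding gauge_def by (metis openE)
      have "\<forall>d>0. \<exists>u v. bad e x u v \<and> v - u < d" using x by (simp add: B_def)
      moreover have "min d r > 0" using d r by simp
      ultimately obtain u v where uv: "bad e x u v" "v - u < min d r" by blast
      then have "{u..v} \<subseteq> ball x r" by (auto simp: bad_def dist_real_def)
      then have "(x,u,v) \<in> K" using x r uv by (auto simp: K_def B_def)
      then show "\<exists>i. i \<in> K \<and> x \<in> cball (A i) (R i) \<and> R i < d"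
        by (intro exI[of _ "(x,u,v)"] conjI, assumption, unfold cb)
           (use uv in \<open>auto simp: bad_def R_def\<close>)
    qed blast
    then obtain C where C: "countable C" "C \<subseteq> K" 
       "pairwise (\<lambda>i j. disjnt (cball (A i) (R i)) (cball (A j) (R j))) C"
       "negligible (B e - (\<Union>i\<in>C. cball (A i) (R i)))" by blast
    have bound: "measure lebesgue (\<Union>i\<in>I. cball (A i) (R i)) \<le> \<epsilon>" if I: "I \<subseteq> C" "finite I" for I
    proof -
      define tg where "tg = (\<lambda>(x::real,u,v). (x, {u..v::real}))"
      have inj: "inj_on tg I"
      proof (rule inj_onI)
        fix i j assume ij: "i \<in> I" "j \<in> I" "tg i = tg j"
        obtain x u v where i: "i = (x,u,v)" by (cases i)
        obtain y u' v' where j: "j = (y,u',v')" by (cases j)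
        have "u < v" "u' < v'" using ij I C i j by (auto simp: K_def bad_def)
        then show "i = j" using ij by (auto simp: tg_def i j Icc_eq_Icc)
      qed
      have part: "tg ` I tagged_partial_division_of (cbox a b)"
        unfolding tagged_partial_division_of_def
      proof (intro conjI allI impI)
        show "finite (tg ` I)" using I by simp
        fix x k assume xk: "(x,k) \<in> tg ` I"
        then obtain u v where uv: "(x,u,v) \<in> I" "k = {u..v}" by (auto simp: tg_def)
        then have "bad e x u v" using I C by (auto simp: K_def)
        then show "x \<in> k" "k \<subseteq> cbox a b" "\<exists>a b. k = cbox a b" using uv 
          by (auto simp: bad_def)
      next
        fix x k y l assume xy: "(x,k) \<in> tg ` I \<and> (y,l) \<in> tg ` I \<and> (x,k) \<noteq> (y,l)"
        then obtain i where i: "i \<in> I" "tg i = (x,k)" by (metis imageE)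
        from xy obtain j where j: "j \<in> I" "tg j = (y,l)" by (metis imageE)
        have ij: "i \<in> I" "j \<in> I" "tg i = (x,k)" "tg j = (y,l)" "i \<noteq> j" using i j xy by metis+
        then have "disjnt (cball (A i) (R i)) (cball (A j) (R j))"
          using C I by (auto simp: pairwise_def)
        moreover have "cball (A i) (R i) = k" "cball (A j) (R j) = l"
          using ij by (auto simp: tg_def cb split: prod.splits)
        ultimately show "interior k \<inter> interior l = {}"
          using interior_subset unfolding disjnt_def by blast
      qed
      have fine: "\<gamma> fine (tg ` I)"
        using I C by (force simp: fine_def tg_def K_def)
      have "measure lebesgue (\<Union>i\<in>I. cball (A i) (R i)) \<le> (\<Sum>i\<in>I. measure lebesgue (cball (A i) (R i)))"
        by (rule measure_UNION_le) (use I in auto)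
      also have "\<dots> \<le> (\<Sum>i\<in>I. (1/e) * (case tg i of (x,k) \<Rightarrow> norm(measure lborel k *\<^sub>R f x - integral k f)))"
      proof (rule sum_mono)
        fix i assume i: "i \<in> I"
        obtain x u v where xuv: "i = (x,u,v)" by (cases i)
        have bd: "bad e x u v" using i I C xuv by (auto simp: K_def)
        have "measure lebesgue (cball (A i) (R i)) = v - u"
          using bd by (simp add: xuv cb bad_def)
        also have "\<dots> \<le> (1/e) * norm (measure lborel {u..v} *\<^sub>R f x - integral {u..v} f)"
        proof -
          have "s \<le> (1/e) * t" if "e * s < t" for s t using that e by (simp add: field_simps)
          then show ?thesis using bd unfolding bad_def by blast
        qed
        finally show "measure lebesgue (cball (A i) (R i)) \<le> (1/e) * (case tg i of (x,k) \<Rightarrow> norm(measure lborel k *\<^sub>R f x - integral k f))"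
          by (simp add: tg_def xuv)
      qed
      also have "\<dots> = (1/e) * (\<Sum>(x,k)\<in>tg ` I. norm(measure lborel k *\<^sub>R f x - integral k f))"
        by (simp add: sum.reindex[OF inj] sum_distrib_left)
      also have "\<dots> \<le> (1/e) * (\<epsilon> * e)"
        using H[OF part fine] e by (intro mult_left_mono) auto
      finally show ?thesis using e by simp
    qed
    define Y where "Y = (\<Union>i\<in>C. cball (A i) (R i))"
    have Y: "Y \<in> lmeasurable" "measure lebesgue Y \<le> \<epsilon>"
      unfolding Y_def using fmeasurable_UN_bound[OF C(1) _ bound] measure_UN_bound[OF C(1) _ bound] by auto
    have Z: "B e - Y \<in> lmeasurable" using C(4) unfolding Y_def by (rule negligible_imp_measurable)
    have "measure lebesgue ((B e - Y) \<union> Y) = measure lebesgue Y"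
      using C(4)[folded Y_def] by (intro measure_negligible_symdiff Y) (simp add: Un_Diff)
    then show "\<exists>T. B e \<subseteq> T \<and> T \<in> lmeasurable \<and> measure lebesgue T \<le> \<epsilon>"
      using Y fmeasurable.Un[OF Z Y(1)] by (intro exI[of _ "(B e - Y) \<union> Y"]) auto
  qed
  \<comment> \<open>If differentiability fails at x, some level e is violated by arbitrarily short
    intervals at x; the levels 1 / (n + 1) catch every such x.\<close>
  have "negligible (\<Union>n. B (1 / real (Suc n)))"
    by (rule negligible_Union_nat) (simp add: neg)
  moreover have "{x\<in>{a<..<b}. \<not> ((\<lambda>x. integral {a..x} f) has_vector_derivative f x) (at x)} \<subseteq> (\<Union>n. B (1 / real (Suc n)))"
  proof
    fix x assume "x \<in> {x\<in>{a<..<b}. \<not> ((\<lambda>x. integral {a..x} f) has_vector_derivative f x) (at x)}"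
    then have x: "x \<in> {a<..<b}" and nd: "\<not> ((\<lambda>x. integral {a..x} f) has_vector_derivative f x) (at x)" by auto
    show "x \<in> (\<Union>n. B (1 / real (Suc n)))"
    proof (rule ccontr)
      assume nB: "x \<notin> (\<Union>n. B (1 / real (Suc n)))"
      have "\<exists>d>0. \<forall>y. norm (y - x) < d \<longrightarrow>
          norm (integral {a..y} f - integral {a..x} f - (y - x) *\<^sub>R f x) \<le> e * norm (y - x)" if e0: "e > 0" for e
      proof -
        obtain n where n: "1 / real (Suc n) < e" using reals_Archimedean[OF e0] by (auto simp: inverse_eq_divide)
        have "x \<notin> B (1 / real (Suc n))" using nB by blast
        with x have "\<not> (\<forall>d>0. \<exists>u v. bad (1 / real (Suc n)) x u v \<and> v - u < d)" by (simp add: B_def)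
        then obtain d where d: "d > 0" "\<And>u v. bad (1 / real (Suc n)) x u v \<Longrightarrow> v - u \<ge> d"
          by (meson not_le)
        define d' where "d' = min d (min (x - a) (b - x))"
        have "d' > 0" using d x by (auto simp: d'_def)
        moreover have "norm (integral {a..y} f - integral {a..x} f - (y - x) *\<^sub>R f x) \<le> e * norm (y - x)"
          if y: "norm (y - x) < d'" for y
        proof (cases "y = x")
          case False
          have ab: "y \<in> {a..b}" "x \<in> {a..b}" using y x by (auto simp: d'_def abs_if split: if_splits)
          define u v where "u = min x y" and "v = max x y"
          have uv: "u < v" "x = u \<or> x = v" "{u..v} \<subseteq> {a..b}" using False ab by (auto simp: u_def v_def)
          have vu: "v - u = norm (y - x)" by (auto simp: u_def v_def)
          have "\<not> bad (1 / real (Suc n)) x u v" using d y by (force simp: vu d'_def)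
          then have 1: "norm (measure lborel {u..v} *\<^sub>R f x - integral {u..v} f) \<le> e * (v - u)"
            using uv n unfolding bad_def
            by (smt (verit) mult_right_mono)
          have "integral {a..u} f + integral {u..v} f = integral {a..v} f"
            using uv f by (intro Henstock_Kurzweil_Integration.integral_combine)
               (auto intro: integrable_on_subinterval)
          then have 2: "integral {u..v} f = integral {a..v} f - integral {a..u} f" by simp
          have "norm (integral {a..y} f - integral {a..x} f - (y - x) *\<^sub>R f x)
             = norm (measure lborel {u..v} *\<^sub>R f x - integral {u..v} f)"
            using uv unfolding 2 by (auto simp: u_def v_def min_def max_def algebra_simps abs_if)
          then show ?thesis using 1 vu by simp
        qed simp
        ultimately show ?thesis by blast
      qed
      then have "((\<lambda>x. integral {a..x} f) has_vector_derivative f x) (at x)"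
        unfolding has_vector_derivative_def has_derivative_at_alt 
        using bounded_linear_scaleR_left[of "f x"] by blast
      with nd show False by blast
    qed
  qed
  ultimately show ?thesis by (rule negligible_subset)
qed

text \<open>On the good set the gauge comes from the derivative as in the fundamental theorem; on the null set
  it is an open cover of small measure, and absolute continuity bounds the increments there.\<close>
lemma abs_continuous_on_has_integral:
  fixes F :: "real \<Rightarrow> complex"
  assumes ac: "abs_continuous_on {0..c} F" and c: "0 \<le> c" and N: "negligible N"
    and der: "\<And>x. x \<in> {0<..<c} - N \<Longrightarrow> (F has_vector_derivative g x) (at x)"
  shows "(g has_integral (F c - F 0)) {0..c}"
proof -
  \<comment> \<open>The endpoints join the null set since \<open>der\<close> speaks of the open
    interval only. Setting \<open>g'\<close> to 0 on it removes the tags there from the Riemann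
    sum.\<close>
  define N' where "N' = N \<union> {0, c}"
  define g' where "g' x = (if x \<in> N' then 0 else g x)" for x
  have N': "negligible N'" unfolding N'_def using N by (intro negligible_Un) auto
  have "(g' has_integral (F c - F 0)) {0..c}"
    unfolding has_integral_real
  proof (intro allI impI)
    fix e :: real assume e: "e > 0"
    define e1 where "e1 = e / (2 * (c + 1))"
    have e1: "e1 > 0" "e1 * c < e / 2" using e c by (auto simp: e1_def field_simps)
    have "e / 2 > 0" using e by simp
    with ac obtain \<delta> where \<delta>: "\<delta> > 0" 
      "\<And>D. \<lbrakk>D division_of \<Union>D; \<Union>D \<subseteq> {0..c}; (\<Sum>k\<in>D. Sup k - Inf k) < \<delta>\<rbrakk> \<Longrightarrow>
        (\<Sum>k\<in>D. norm (F (Sup k) - F (Inf k))) < e / 2"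
      unfolding abs_continuous_on_def by meson
    obtain U where U: "open U" "N' \<subseteq> U" "(U - N') \<in> lmeasurable" "emeasure lebesgue (U - N') < ennreal \<delta>"
      using sets_lebesgue_outer_open[OF negligible_imp_sets[OF N'] \<delta>(1)] by metis
    have UU: "U = (U - N') \<union> N'" using U(2) by blast
    have Um: "U \<in> lmeasurable" by (subst UU) (rule fmeasurable.Un[OF U(3) negligible_imp_measurable[OF N']])
    have "measure lebesgue U = measure lebesgue (U - N')"
      by (rule measure_negligible_symdiff[OF U(3)]) (use U(2) in \<open>auto intro: negligible_subset[OF N']\<close>)
    also have "\<dots> < \<delta>"
      using U(3,4) \<delta>(1) by (metis emeasure_eq_measure2 ennreal_less_iff measure_nonneg)
    finally have mU: "measure lebesgue U < \<delta>" .
    have "\<forall>x. \<exists>d>0. x \<in> {0..c} - N' \<longrightarrow>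
         (\<forall>y. norm (y - x) < d \<longrightarrow> norm (F y - F x - (y - x) *\<^sub>R g x) \<le> e1 * norm (y - x))"
    proof
      fix x show "\<exists>d>0. x \<in> {0..c} - N' \<longrightarrow>
         (\<forall>y. norm (y - x) < d \<longrightarrow> norm (F y - F x - (y - x) *\<^sub>R g x) \<le> e1 * norm (y - x))"
      proof (cases "x \<in> {0..c} - N'")
        case True
        then have "(F has_vector_derivative g x) (at x)" by (intro der) (auto simp: N'_def less_le)
        then show ?thesis using e1(1) unfolding has_vector_derivative_def has_derivative_at_alt by blast
      qed (auto intro: exI[of _ 1])
    qed
    then obtain d where d: "\<And>x. d x > 0" "\<And>x y. \<lbrakk>x \<in> {0..c} - N'; norm (y - x) < d x\<rbrakk> \<Longrightarrow>
        norm (F y - F x - (y - x) *\<^sub>R g x) \<le> e1 * norm (y - x)" by metis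
    define \<gamma> where "\<gamma> x = (if x \<in> N' then U else ball x (d x))" for x
    have gau: "gauge \<gamma>" unfolding gauge_def \<gamma>_def using U d by auto
    have key: "norm ((\<Sum>(x,k)\<in>p. measure lborel k *\<^sub>R g' x) - (F c - F 0)) < e"
      if p: "p tagged_division_of {0..c}" "\<gamma> fine p" for p
    proof -
      have fin: "finite p" using p(1) by blast
      define p1 where "p1 = {xk \<in> p. fst xk \<in> N'}"
      have p1: "p1 \<subseteq> p" by (auto simp: p1_def)
      have "p1 tagged_partial_division_of {0..c}"
        using p(1) p1 tagged_partial_division_subset unfolding tagged_division_of_def by blast
      then have p1u: "p1 tagged_division_of \<Union>(snd ` p1)" "p1 tagged_partial_division_of {0..c}"
        using tagged_partial_division_of_Union_self by blast+
      define D where "D = snd ` p1"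
      have D: "D division_of \<Union>D"
        unfolding D_def using partial_division_of_tagged_division p1u(2) by blast
      have K: "\<exists>u v. k = {u..v} \<and> u \<le> v \<and> x \<in> k \<and> 0 \<le> u \<and> v \<le> c" if "(x,k) \<in> p" for x k
      proof -
        have "x \<in> k" "k \<subseteq> {0..c}" "\<exists>a b. k = cbox a b"
          using tagged_division_ofD(2-4)[OF p(1) that] by simp_all
        then obtain u v where "k = {u..v}" by auto
        with \<open>x \<in> k\<close> \<open>k \<subseteq> {0..c}\<close> show ?thesis by (intro exI[of _ u] exI[of _ v]) auto
      qed
      have KD: "\<exists>u v. k = {u..v} \<and> u \<le> v \<and> 0 \<le> u \<and> v \<le> c" if "k \<in> D" for k
        using that K p1 unfolding D_def by fastforce
      have sub: "\<Union>D \<subseteq> {0..c}" using KD by fastforce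
      have subU: "\<Union>D \<subseteq> U"
        using p(2) unfolding D_def p1_def fine_def \<gamma>_def by force
      have "(\<Sum>k\<in>D. Sup k - Inf k) = (\<Sum>k\<in>D. measure lebesgue k)"
        by (rule sum.cong) (use KD in force)+
      also have "\<dots> = measure lebesgue (\<Union>D)" using content_division[OF D] .
      also have "\<dots> \<le> measure lebesgue U"
        using lmeasurable_division[OF D] Um subU by (intro measure_mono_fmeasurable) auto
      finally have "(\<Sum>k\<in>D. norm (F (Sup k) - F (Inf k))) < e / 2"
        using \<delta>(2)[OF D sub] mU by simp
      moreover have "(\<Sum>(x,k)\<in>p1. norm (F (Sup k) - F (Inf k))) = (\<Sum>k\<in>D. norm (F (Sup k) - F (Inf k)))"
      proof -
        \<comment> \<open>\<open>Sup\<close> and \<open>Inf\<close> of the empty set carry no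
          information, whereas the lemma on sums over tagged divisions asks for 0 on every box with
          empty interior; hence the default value.\<close>
        define h where "h k = (if k = {} then 0 else norm (F (Sup k) - F (Inf k)))" for k
        have "(\<Sum>(x,k)\<in>p1. h k) = (\<Sum>k\<in>D. h k)"
          unfolding D_def
        proof (rule sum.over_tagged_division_lemma[OF p1u(1)])
          show "h (cbox u v) = 0" if "box u v = {}" for u v
          proof (cases "u = v")
            case False
            then have "cbox u v = {}" using that by (auto simp: box_real)
            then show ?thesis by (simp add: h_def)
          qed (simp add: h_def)
        qed
        moreover have "(\<Sum>(x,k)\<in>p1. h k) = (\<Sum>(x,k)\<in>p1. norm (F (Sup k) - F (Inf k)))"
        proof (rule sum.cong, rule refl, clarify)
          fix x k assume "(x,k) \<in> p1"
          then have "k \<noteq> {}" using K[of x k] p1 by fastforce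
          then show "h k = norm (F (Sup k) - F (Inf k))" by (simp add: h_def)
        qed
        moreover have "(\<Sum>k\<in>D. h k) = (\<Sum>k\<in>D. norm (F (Sup k) - F (Inf k)))"
        proof (rule sum.cong, rule refl)
          fix k assume "k \<in> D"
          then have "k \<noteq> {}" using KD[of k] by fastforce
          then show "h k = norm (F (Sup k) - F (Inf k))" by (simp add: h_def)
        qed
        ultimately show ?thesis by simp
      qed
      ultimately have b1: "(\<Sum>(x,k)\<in>p1. norm (F (Sup k) - F (Inf k))) < e / 2" by simp
      have ba: "c - 0 = (\<Sum>(x,K)\<in>p. Sup K - Inf K)" "F c - F 0 = (\<Sum>(x,K)\<in>p. F(Sup K) - F(Inf K))"
        using additive_tagged_division_1[where f= "\<lambda>x. x", OF c] additive_tagged_division_1[where f=F, OF c]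
          p(1) by (auto simp: box_real)
      have "norm ((\<Sum>(x,k)\<in>p. measure lborel k *\<^sub>R g' x) - (F c - F 0))
          \<le> (\<Sum>(x,k)\<in>p. norm (measure lborel k *\<^sub>R g' x - (F(Sup k) - F(Inf k))))"
        unfolding ba(2) by (simp add: sum_subtractf[symmetric] split_def) (rule norm_sum)
      also have "\<dots> \<le> (\<Sum>(x,k)\<in>p. (if x \<in> N' then norm (F(Sup k) - F(Inf k)) else 0) + e1 * (Sup k - Inf k))"
      proof (rule sum_mono, clarify)
        fix x k assume xk: "(x,k) \<in> p"
        obtain u v where k: "k = {u..v}" "u \<le> v" "x \<in> k" "0 \<le> u" "v \<le> c" using K[OF xk] by blast
        show "norm (measure lborel k *\<^sub>R g' x - (F(Sup k) - F(Inf k))) \<le> 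
            (if x \<in> N' then norm (F(Sup k) - F(Inf k)) else 0) + e1 * (Sup k - Inf k)"
        proof (cases "x \<in> N'")
          case True
          then have "0 \<le> e1 * (Sup k - Inf k)" using e1 k by simp
          then show ?thesis using True by (simp add: g'_def norm_minus_commute)
        next
          case False
          have xc: "x \<in> {0..c} - N'" using k False by auto
          have "k \<subseteq> ball x (d x)" using p(2) xk False unfolding fine_def \<gamma>_def by fastforce
          moreover have "u \<in> k" "v \<in> k" using k by auto
          ultimately have uvd: "norm (u - x) < d x" "norm (v - x) < d x"
            by (auto simp: dist_real_def subset_iff)
          \<comment> \<open>The tag x lies in [u, v]. Splitting the increment at x gives the errors
            e1 |u - x| and e1 |v - x|, which add up to e1 (v - u).\<close>
          have "norm ((v - u) *\<^sub>R g x - (F v - F u)) = norm ((F u - F x - (u - x) *\<^sub>R g x) - (F v - F x - (v - x) *\<^sub>R g x))"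
            by (rule arg_cong[where f=norm]) (simp add: algebra_simps)
          also have "\<dots> \<le> norm (F u - F x - (u - x) *\<^sub>R g x) + norm (F v - F x - (v - x) *\<^sub>R g x)"
            by (rule norm_triangle_ineq4)
          also have "\<dots> \<le> e1 * norm (u - x) + e1 * norm (v - x)"
            by (intro add_mono d(2) xc uvd)
          also have "\<dots> = e1 * (v - u)" using k by (simp add: algebra_simps)
          finally show ?thesis using False k by (simp add: g'_def)
        qed
      qed
      also have "\<dots> = (\<Sum>(x,k)\<in>p. (if x \<in> N' then norm (F(Sup k) - F(Inf k)) else 0)) + e1 * (\<Sum>(x,k)\<in>p. Sup k - Inf k)"
        by (simp add: split_def sum.distrib sum_distrib_left)
      also have "(\<Sum>(x,k)\<in>p. (if x \<in> N' then norm (F(Sup k) - F(Inf k)) else 0)) = (\<Sum>(x,k)\<in>p1. norm (F (Sup k) - F (Inf k)))"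
        unfolding p1_def split_def using fin by (simp add: sum.inter_filter)
      also have "\<dots> + e1 * (\<Sum>(x,k)\<in>p. Sup k - Inf k) < e"
        using b1 e1(2) unfolding ba(1)[symmetric] by simp
      finally show ?thesis .
    qed
    show "\<exists>\<gamma>. gauge \<gamma> \<and> (\<forall>\<D>. \<D> tagged_division_of {0..c} \<and> \<gamma> fine \<D> \<longrightarrow>
        norm ((\<Sum>(x,k)\<in>\<D>. measure lborel k *\<^sub>R g' x) - (F c - F 0)) < e)"
      by (intro exI[of _ \<gamma>] conjI allI impI gau) (elim conjE, rule key)
  qed
  moreover have "g x = g' x" if "x \<in> {0..c} - N'" for x using that by (simp add: g'_def)
  ultimately show ?thesis using has_integral_spike[OF N'] by blast
qed

text \<open>By dominated convergence the part of |f| above level n + 1 has integral tending to 0.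
  This is used twice: for the absolute continuity of indefinite integrals and for the exponential
  weights in the existence proof.\<close>

lemma absolutely_integrable_truncate:
  fixes f :: "real \<Rightarrow> real"
  assumes f: "f absolutely_integrable_on S" and e: "e > 0"
  obtains M where "M > 0" "(\<lambda>x. max 0 (\<bar>f x\<bar> - M)) integrable_on S" "integral S (\<lambda>x. max 0 (\<bar>f x\<bar> - M)) < e"
proof -
  have int: "integrable lebesgue (\<lambda>x. indicator S x *\<^sub>R f x)" using f by (simp add: set_integrable_def)
  have 1: "(\<lambda>n. integral\<^sup>L lebesgue (\<lambda>x. max 0 (\<bar>indicator S x *\<^sub>R f x\<bar> - real (Suc n)))) \<longlonglongrightarrow> integral\<^sup>L lebesgue (\<lambda>x::real. 0)"
  proof (rule integral_dominated_convergence[where w="\<lambda>x. \<bar>indicator S x *\<^sub>R f x\<bar>"])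
    show "AE x in lebesgue. (\<lambda>n. max 0 (\<bar>indicator S x *\<^sub>R f x\<bar> - real (Suc n))) \<longlonglongrightarrow> 0"
    proof (rule AE_I2)
      fix x 
      obtain k where "\<bar>indicator S x *\<^sub>R f x\<bar> \<le> real k" using real_arch_simple by blast
      then have "\<forall>\<^sub>F n in sequentially. max 0 (\<bar>indicator S x *\<^sub>R f x\<bar> - real (Suc n)) = 0"
        by (intro eventually_sequentiallyI[of k]) auto
      then show "(\<lambda>n. max 0 (\<bar>indicator S x *\<^sub>R f x\<bar> - real (Suc n))) \<longlonglongrightarrow> 0"
        by (rule tendsto_eventually)
    qed
    show "integrable lebesgue (\<lambda>x. \<bar>indicator S x *\<^sub>R f x\<bar>)" using int by (rule integrable_abs)
  qed (use int in \<open>auto intro!: borel_measurable_max borel_measurable_diff borel_measurable_abs\<close>)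
  then obtain n where n: "integral\<^sup>L lebesgue (\<lambda>x. max 0 (\<bar>indicator S x *\<^sub>R f x\<bar> - real (Suc n))) < e"
    using e by (force dest!: order_tendstoD(2)[of _ _ _ e] simp: eventually_sequentially)
  define M where "M = real (Suc n)"
  have eq: "max 0 (\<bar>indicator S x *\<^sub>R f x\<bar> - M) = indicator S x *\<^sub>R max 0 (\<bar>f x\<bar> - M)" for x
    by (auto simp: indicator_def M_def)
  have int2: "integrable lebesgue (\<lambda>x. max 0 (\<bar>indicator S x *\<^sub>R f x\<bar> - M))"
    by (rule Bochner_Integration.integrable_bound[OF int]) 
       (use int in \<open>auto simp: M_def intro!: borel_measurable_max borel_measurable_diff borel_measurable_abs\<close>)
  then have ai: "(\<lambda>x. max 0 (\<bar>f x\<bar> - M)) absolutely_integrable_on S"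
    unfolding eq set_integrable_def .
  show ?thesis
  proof (rule that)
    show "M > 0" by (simp add: M_def)
    show "(\<lambda>x. max 0 (\<bar>f x\<bar> - M)) integrable_on S" using set_lebesgue_integral_eq_integral(1)[OF ai] .
    show "integral S (\<lambda>x. max 0 (\<bar>f x\<bar> - M)) < e"
      using n set_lebesgue_integral_eq_integral(2)[OF ai] 
      unfolding M_def[symmetric] eq set_lebesgue_integral_def by simp
  qed
qed

text \<open>Since |f| is at most M plus its excess over M, the increments over a division add up to
  at most M times its total length plus the integral of the excess. The latter is below e / 2 for
  every division, which leads to d = e / (2 M).\<close>

lemma abs_continuous_on_indefinite_integral:
  fixes f :: "real \<Rightarrow> real"
  assumes f: "f absolutely_integrable_on {0..c}"
    and F: "\<And>x. x \<in> {0..c} \<Longrightarrow> F x = F 0 + integral {0..x} f"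
  shows "abs_continuous_on {0..c} (\<lambda>x. complex_of_real (F x))"
  unfolding abs_continuous_on_def
proof (intro allI impI)
  fix e :: real assume e: "e > 0"
  then have "e / 2 > 0" by simp
  from absolutely_integrable_truncate[OF f this]
  obtain M where M: "M > 0" and g: "(\<lambda>x. max 0 (\<bar>f x\<bar> - M)) integrable_on {0..c}" 
    "integral {0..c} (\<lambda>x. max 0 (\<bar>f x\<bar> - M)) < e / 2" by blast
  define g where "g x = max 0 (\<bar>f x\<bar> - M)" for x
  have gi: "g integrable_on {0..c}" using g by (simp add: g_def[abs_def])
  have fi: "f integrable_on {0..c}" using f by (rule absolutely_integrable_on_def[THEN iffD1, THEN conjunct1])
  have "(\<Sum>k\<in>D. norm (complex_of_real (F (Sup k)) - complex_of_real (F (Inf k)))) < e"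
    if D: "D division_of \<Union>D" "\<Union>D \<subseteq> {0..c}" "(\<Sum>k\<in>D. Sup k - Inf k) < e / (2 * M)" for D
  proof -
    have KD: "\<exists>u v. k = {u..v} \<and> u \<le> v \<and> 0 \<le> u \<and> v \<le> c" if k: "k \<in> D" for k
    proof -
      obtain u v where "k = {u..v}" "k \<noteq> {}" using division_ofD(3,4)[OF D(1) k] by (metis box_real(2))
      moreover have "k \<subseteq> {0..c}" using k D(2) by blast
      ultimately show ?thesis by (intro exI[of _ u] exI[of _ v]) auto
    qed
    have "(\<Sum>k\<in>D. norm (complex_of_real (F (Sup k)) - complex_of_real (F (Inf k)))) \<le> (\<Sum>k\<in>D. integral k g + M * (Sup k - Inf k))"
    proof (rule sum_mono)
      fix k assume "k \<in> D"
      then obtain u v where k: "k = {u..v}" "u \<le> v" "0 \<le> u" "v \<le> c" using KD by blast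
      have fu: "f integrable_on {u..v}" using fi k by (auto intro: integrable_on_subinterval)
      have gu: "g integrable_on {u..v}" using gi k by (auto intro: integrable_on_subinterval)
      have "integral {0..u} f + integral {u..v} f = integral {0..v} f"
        using k fi by (intro Henstock_Kurzweil_Integration.integral_combine)
               (auto intro: integrable_on_subinterval)
      then have "F v - F u = integral {u..v} f" using F[of u] F[of v] k by simp
      moreover have "norm (integral {u..v} f) \<le> integral {u..v} (\<lambda>x. g x + M)"
        by (rule integral_norm_bound_integral[OF fu]) 
           (auto simp: g_def[abs_def] intro!: integrable_add gu[unfolded g_def[abs_def]])
      moreover have "integral {u..v} (\<lambda>x. g x + M) = integral {u..v} g + M * (v - u)"
        using k by (subst integral_add) (auto simp: gu)
      ultimately have "\<bar>F v - F u\<bar> \<le> integral {u..v} g + M * (v - u)" by simp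
      then show "norm (complex_of_real (F (Sup k)) - complex_of_real (F (Inf k))) \<le> integral k g + M * (Sup k - Inf k)"
        using k by (simp flip: of_real_diff)
    qed
    also have "\<dots> = (\<Sum>k\<in>D. integral k g) + M * (\<Sum>k\<in>D. Sup k - Inf k)"
      by (simp add: sum.distrib sum_distrib_left)
    also have "(\<Sum>k\<in>D. integral k g) = integral (\<Union>D) g"
      by (rule integral_combine_division_topdown[symmetric, OF _ D(1)])
         (rule integrable_on_subdivision[OF D(1) gi D(2)])
    also have "integral (\<Union>D) g \<le> integral {0..c} g"
      by (rule integral_subset_le[OF D(2) integrable_on_subdivision[OF D(1) gi D(2)] gi]) (simp add: g_def)
    also have "M * (\<Sum>k\<in>D. Sup k - Inf k) < M * (e / (2 * M))" using D(3) M by (intro mult_strict_left_mono)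
    also have "integral {0..c} g + M * (e / (2 * M)) < e" using g M unfolding g_def by simp
    finally show ?thesis by simp
  qed
  moreover have "e / (2 * M) > 0" using e M by simp
  ultimately show "\<exists>d>0. \<forall>D. D division_of \<Union> D \<longrightarrow> \<Union> D \<subseteq> {0..c} \<longrightarrow> (\<Sum>k\<in>D. Sup k - Inf k) < d \<longrightarrow>
         (\<Sum>k\<in>D. norm (complex_of_real (F (Sup k)) - complex_of_real (F (Inf k)))) < e" by blast
qed

section \<open>Indefinite integrals of absolutely integrable functions\<close>

text \<open>The working form of absolute continuity with a given derivative: an integral identity,
  insensitive to null sets and stable under limits. The value \<open>F 0\<close> is
  arbitrary.\<close>

definition is_primitive :: "real \<Rightarrow> (real \<Rightarrow> real) \<Rightarrow> (real \<Rightarrow> real) \<Rightarrow> bool" where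
  "is_primitive c F f \<longleftrightarrow> f absolutely_integrable_on {0..c} \<and> (\<forall>x\<in>{0..c}. (f has_integral (F x - F 0)) {0..x})"

lemma primitive_absolutely_integrable: "is_primitive c F f \<Longrightarrow> f absolutely_integrable_on {0..c}"
  by (simp add: is_primitive_def)

lemma primitive_integrable: "is_primitive c F f \<Longrightarrow> f integrable_on {0..c}"
  using primitive_absolutely_integrable set_lebesgue_integral_eq_integral(1) by blast

lemma primitive_eq: "is_primitive c F f \<Longrightarrow> x \<in> {0..c} \<Longrightarrow> F x = F 0 + integral {0..x} f"
  using integral_unique[of f "F x - F 0" "{0..x}"] by (simp add: is_primitive_def)

lemma primitiveI:
  assumes "f absolutely_integrable_on {0..c}" "\<And>x. x \<in> {0..c} \<Longrightarrow> F x = F 0 + integral {0..x} f"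
  shows "is_primitive c F f"
  unfolding is_primitive_def
proof (intro conjI ballI assms)
  fix x assume x: "x \<in> {0..c}"
  have "f integrable_on {0..c}" using assms(1) set_lebesgue_integral_eq_integral(1) by blast
  then have "f integrable_on {0..x}" using x by (auto intro: integrable_on_subinterval)
  then show "(f has_integral (F x - F 0)) {0..x}" using assms(2)[OF x] by (simp add: has_integral_integral)
qed

lemma primitive_has_integral:
  assumes "is_primitive c F f" "0 \<le> x" "x \<le> y" "y \<le> c"
  shows "(f has_integral (F y - F x)) {x..y}"
proof -
  have fi: "f integrable_on {0..c}" using assms primitive_integrable by blast
  have "integral {0..x} f + integral {x..y} f = integral {0..y} f"
    using assms fi by (intro Henstock_Kurzweil_Integration.integral_combine)
               (auto intro: integrable_on_subinterval)
  then have "integral {x..y} f = F y - F x" using primitive_eq[OF assms(1), of x] primitive_eq[OF assms(1), of y] assms by simp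
  moreover have "f integrable_on {x..y}" using fi assms by (auto intro: integrable_on_subinterval)
  ultimately show ?thesis by (metis integrable_integral)
qed

lemma primitive_continuous: assumes "is_primitive c F f" shows "continuous_on {0..c} F"
proof -
  have "continuous_on {0..c} (\<lambda>x. F 0 + integral {0..x} f)"
    by (intro continuous_intros indefinite_integral_continuous_1 primitive_integrable[OF assms])
  then show ?thesis
    by (rule continuous_on_eq) (simp add: primitive_eq[OF assms, symmetric])
qed

lemma primitive_spike:
  assumes "is_primitive c F f" "negligible N" "\<And>x. x \<in> {0..c} - N \<Longrightarrow> g x = f x"
  shows "is_primitive c F g"
  unfolding is_primitive_def
proof (intro conjI ballI)
  show "g absolutely_integrable_on {0..c}"
    using absolutely_integrable_spike[OF primitive_absolutely_integrable[OF assms(1)] assms(2,3)] .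
  fix x assume x: "x \<in> {0..c}"
  have "(f has_integral (F x - F 0)) {0..x}" using assms(1) x by (simp add: is_primitive_def)
  moreover have "g y = f y" if "y \<in> {0..x} - N" for y using that x assms(3) by auto
  ultimately show "(g has_integral (F x - F 0)) {0..x}" using has_integral_spike[OF assms(2)] by blast
qed

lemma primitive_cong:
  assumes "is_primitive c F f" "\<And>x. x \<in> {0..c} \<Longrightarrow> F x = G x" "\<And>x. x \<in> {0..c} \<Longrightarrow> f x = g x"
  shows "is_primitive c G g"
proof -
  have "is_primitive c F g" by (rule primitive_spike[OF assms(1), of "{}"]) (use assms(3) in auto)
  then show ?thesis using assms(2) unfolding is_primitive_def by force
qed

lemma primitive_const: "is_primitive c (\<lambda>_. k) (\<lambda>_. 0)"
  by (auto simp: is_primitive_def)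

lemma primitive_add:
  assumes "is_primitive c F f" "is_primitive c G g"
  shows "is_primitive c (\<lambda>x. F x + G x) (\<lambda>x. f x + g x)"
  using assms unfolding is_primitive_def
  by (auto intro!: set_integral_add simp: add_diff_add intro: has_integral_add)

lemma primitive_cmult:
  assumes "is_primitive c F f" shows "is_primitive c (\<lambda>x. k * F x) (\<lambda>x. k * f x)"
  using assms unfolding is_primitive_def
  by (auto simp flip: right_diff_distrib intro: has_integral_mult_right)

lemma primitive_diff:
  assumes "is_primitive c F f" "is_primitive c G g"
  shows "is_primitive c (\<lambda>x. F x - G x) (\<lambda>x. f x - g x)"
  using primitive_add[OF assms(1) primitive_cmult[OF assms(2), of "-1"]] by simp

lemma primitive_minus: "is_primitive c F f \<Longrightarrow> is_primitive c (\<lambda>x. - F x) (\<lambda>x. - f x)"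
  using primitive_cmult[of c F f "-1"] by simp

lemma primitive_deriv:
  assumes "continuous_on {0..c} f"
    and "\<And>x. x \<in> {0..c} \<Longrightarrow> (F has_vector_derivative f x) (at x within {0..c})"
  shows "is_primitive c F f"
  unfolding is_primitive_def
proof (intro conjI ballI)
  show "f absolutely_integrable_on {0..c}" using assms(1) by (rule absolutely_integrable_continuous_real)
  fix x assume x: "x \<in> {0..c}"
  show "(f has_integral (F x - F 0)) {0..x}"
  proof (rule fundamental_theorem_of_calculus)
    fix y assume "y \<in> {0..x}"
    then show "(F has_vector_derivative f y) (at y within {0..x})"
      using x by (intro has_vector_derivative_within_subset[OF assms(2)]) auto
  qed (use x in auto)
qed

lemma primitive_has_vector_derivative:
  assumes "is_primitive c F f" "continuous_on {0..c} f" "x \<in> {0..c}"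
  shows "(F has_vector_derivative f x) (at x within {0..c})"
proof -
  have "((\<lambda>x. integral {0..x} f) has_vector_derivative f x) (at x within {0..c})"
    using integral_has_vector_derivative[OF assms(2,3)] .
  then have "((\<lambda>x. F 0 + integral {0..x} f) has_vector_derivative f x) (at x within {0..c})"
    by (auto intro!: derivative_eq_intros)
  then show ?thesis
    by (rule has_vector_derivative_transform[OF assms(3), rotated]) (simp add: primitive_eq[OF assms(1), symmetric])
qed

lemma abs_continuous_on_subset: "abs_continuous_on S f \<Longrightarrow> T \<subseteq> S \<Longrightarrow> abs_continuous_on T f"
  unfolding abs_continuous_on_def by (meson subset_trans)

lemma primitive_abs_continuous_on:
  assumes "is_primitive c F f" shows "abs_continuous_on {0..c} (\<lambda>x. complex_of_real (F x))"
  by (rule abs_continuous_on_indefinite_integral[OF primitive_absolutely_integrable[OF assms]])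
     (rule primitive_eq[OF assms])

lemma primitive_ae_deriv:
  assumes "is_primitive c F f"
  obtains N where "negligible N" "\<And>x. x \<in> {0<..<c} - N \<Longrightarrow> (F has_vector_derivative f x) (at x)"
proof
  show "negligible {x\<in>{0<..<c}. \<not> ((\<lambda>x. integral {0..x} f) has_vector_derivative f x) (at x)}"
    by (rule negligible_integral_not_has_vector_derivative[OF primitive_integrable[OF assms]])
  fix x assume "x \<in> {0<..<c} - {x\<in>{0<..<c}. \<not> ((\<lambda>x. integral {0..x} f) has_vector_derivative f x) (at x)}"
  then have x: "x \<in> {0<..<c}" and d: "((\<lambda>x. integral {0..x} f) has_vector_derivative f x) (at x)" by auto
  have "((\<lambda>x. F 0 + integral {0..x} f) has_vector_derivative f x) (at x)"
    using d by (auto intro!: derivative_eq_intros)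
  then show "(F has_vector_derivative f x) (at x)"
    by (rule has_vector_derivative_transform_within_open[of _ _ _ "{0<..<c}"]) (use x in \<open>auto simp: primitive_eq[OF assms, symmetric]\<close>)
qed

lemma primitive_from_abs_continuous:
  assumes ac: "abs_continuous_on {0..c} (\<lambda>x. complex_of_real (F x))" and f: "f absolutely_integrable_on {0..c}"
    and N: "negligible N" and d: "\<And>x. x \<in> {0<..<c} - N \<Longrightarrow> (F has_vector_derivative f x) (at x)"
  shows "is_primitive c F f"
  unfolding is_primitive_def
proof (intro conjI ballI f)
  fix x assume x: "x \<in> {0..c}"
  have "((\<lambda>x. complex_of_real (f x)) has_integral (complex_of_real (F x) - complex_of_real (F 0))) {0..x}"
  proof (rule abs_continuous_on_has_integral[OF abs_continuous_on_subset[OF ac] _ N])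
    fix y assume y: "y \<in> {0<..<x} - N"
    show "((\<lambda>x. complex_of_real (F x)) has_vector_derivative complex_of_real (f y)) (at y)"
      using d[of y] x y by (intro has_vector_derivative_of_real) 
        (auto simp: has_real_derivative_iff_has_vector_derivative)
  qed (use x in auto)
  from has_integral_Re[OF this] show "(f has_integral (F x - F 0)) {0..x}" by simp
qed

lemma abs_continuous_on_mult:
  assumes f: "abs_continuous_on S f" and g: "abs_continuous_on S g"
    and M: "\<And>x. x \<in> S \<Longrightarrow> norm (f x) \<le> M" "\<And>x. x \<in> S \<Longrightarrow> norm (g x) \<le> M"
  shows "abs_continuous_on S (\<lambda>x. f x * g x)"
  unfolding abs_continuous_on_def
proof (intro allI impI)
  fix e :: real assume e: "e > 0"
  define e' where "e' = e / (2 * (\<bar>M\<bar> + 1))"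
  have e': "e' > 0" using e by (simp add: e'_def)
  obtain d1 where d1: "d1 > 0" "\<And>D. \<lbrakk>D division_of \<Union>D; \<Union>D \<subseteq> S; (\<Sum>k\<in>D. Sup k - Inf k) < d1\<rbrakk> \<Longrightarrow>
        (\<Sum>k\<in>D. norm (f (Sup k) - f (Inf k))) < e'"
    using f e' unfolding abs_continuous_on_def by meson
  obtain d2 where d2: "d2 > 0" "\<And>D. \<lbrakk>D division_of \<Union>D; \<Union>D \<subseteq> S; (\<Sum>k\<in>D. Sup k - Inf k) < d2\<rbrakk> \<Longrightarrow>
        (\<Sum>k\<in>D. norm (g (Sup k) - g (Inf k))) < e'"
    using g e' unfolding abs_continuous_on_def by meson
  have "(\<Sum>k\<in>D. norm (f (Sup k) * g (Sup k) - f (Inf k) * g (Inf k))) < e"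
    if D: "D division_of \<Union>D" "\<Union>D \<subseteq> S" "(\<Sum>k\<in>D. Sup k - Inf k) < min d1 d2" for D
  proof -
    have "norm (f (Sup k) * g (Sup k) - f (Inf k) * g (Inf k)) \<le>
        \<bar>M\<bar> * norm (f (Sup k) - f (Inf k)) + \<bar>M\<bar> * norm (g (Sup k) - g (Inf k))" if k: "k \<in> D" for k
    proof -
      obtain u v where uv: "k = {u..v}" "k \<noteq> {}" using division_ofD(3,4)[OF D(1) k] by (metis box_real(2))
      have "k \<subseteq> S" using k D(2) by blast
      then have "u \<in> S" "v \<in> S" using uv by auto
      then have b: "norm (f u) \<le> \<bar>M\<bar>" "norm (g v) \<le> \<bar>M\<bar>" using M by force+
      have "f v * g v - f u * g u = (f v - f u) * g v + f u * (g v - g u)" by (simp add: algebra_simps)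
      then have "norm (f v * g v - f u * g u) \<le> norm (f v - f u) * norm (g v) + norm (f u) * norm (g v - g u)"
        by (metis norm_mult norm_triangle_ineq)
      also have "\<dots> \<le> norm (f v - f u) * \<bar>M\<bar> + \<bar>M\<bar> * norm (g v - g u)"
        using b by (intro add_mono mult_left_mono mult_right_mono) auto
      finally show ?thesis using uv by (simp add: mult.commute)
    qed
    then have "(\<Sum>k\<in>D. norm (f (Sup k) * g (Sup k) - f (Inf k) * g (Inf k))) \<le>
       (\<Sum>k\<in>D. \<bar>M\<bar> * norm (f (Sup k) - f (Inf k)) + \<bar>M\<bar> * norm (g (Sup k) - g (Inf k)))"
      by (rule sum_mono)
    also have "\<dots> = \<bar>M\<bar> * (\<Sum>k\<in>D. norm (f (Sup k) - f (Inf k))) + \<bar>M\<bar> * (\<Sum>k\<in>D. norm (g (Sup k) - g (Inf k)))"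
      by (simp add: sum.distrib sum_distrib_left)
    also have "\<dots> \<le> \<bar>M\<bar> * e' + \<bar>M\<bar> * e'"
      using d1(2)[OF D(1,2)] d2(2)[OF D(1,2)] D(3) by (intro add_mono mult_left_mono) auto
    also have "\<dots> < e"
    proof -
      have "2 * (\<bar>M\<bar> + 1) * e' = e" by (simp add: e'_def)
      then have "2 * (\<bar>M\<bar> * e') + 2 * e' = e" by (simp add: algebra_simps)
      then show ?thesis using e' by linarith
    qed
    finally show ?thesis .
  qed
  moreover have "min d1 d2 > 0" using d1 d2 by simp
  ultimately show "\<exists>d>0. \<forall>D. D division_of \<Union> D \<longrightarrow> \<Union> D \<subseteq> S \<longrightarrow> (\<Sum>k\<in>D. Sup k - Inf k) < d \<longrightarrow>
         (\<Sum>k\<in>D. norm (f (Sup k) * g (Sup k) - f (Inf k) * g (Inf k))) < e" by blast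
qed

lemma absolutely_integrable_mult_continuous:
  fixes f g :: "real \<Rightarrow> real"
  assumes f: "f absolutely_integrable_on {a..b}" and g: "continuous_on {a..b} g"
  shows "(\<lambda>x. f x * g x) absolutely_integrable_on {a..b}"
proof -
  have "(\<lambda>x. g x * f x) absolutely_integrable_on {a..b}"
    by (rule absolutely_integrable_bounded_measurable_product_real)
       (use assms in \<open>auto intro: continuous_imp_measurable_on_sets_lebesgue compact_imp_bounded compact_continuous_image\<close>)
  then show ?thesis by (simp add: mult.commute)
qed

text \<open>F and G are differentiable only almost everywhere, so the product rule goes through
  absolute continuity: the product is absolutely continuous, has the expected derivative off a null
  set, and is therefore the integral of it.\<close>

lemma primitive_mult:
  assumes F: "is_primitive c F f" and G: "is_primitive c G g"
  shows "is_primitive c (\<lambda>x. F x * G x) (\<lambda>x. f x * G x + F x * g x)"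
proof -
  have cF: "continuous_on {0..c} F" and cG: "continuous_on {0..c} G"
    using F G primitive_continuous by auto
  have "bounded (F ` {0..c})" "bounded (G ` {0..c})"
    using cF cG by (auto intro: compact_imp_bounded compact_continuous_image)
  then obtain M1 M2 where M: "\<And>x. x \<in> {0..c} \<Longrightarrow> \<bar>F x\<bar> \<le> M1" "\<And>x. x \<in> {0..c} \<Longrightarrow> \<bar>G x\<bar> \<le> M2"
    unfolding bounded_real by blast
  have "abs_continuous_on {0..c} (\<lambda>x. complex_of_real (F x) * complex_of_real (G x))"
    by (rule abs_continuous_on_mult[OF primitive_abs_continuous_on[OF F] primitive_abs_continuous_on[OF G], of "max M1 M2"])
       (use M in \<open>auto simp: le_max_iff_disj\<close>)
  then have ac: "abs_continuous_on {0..c} (\<lambda>x. complex_of_real (F x * G x))" by simp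
  obtain N1 where N1: "negligible N1" "\<And>x. x \<in> {0<..<c} - N1 \<Longrightarrow> (F has_vector_derivative f x) (at x)"
    using primitive_ae_deriv[OF F] by blast
  obtain N2 where N2: "negligible N2" "\<And>x. x \<in> {0<..<c} - N2 \<Longrightarrow> (G has_vector_derivative g x) (at x)"
    using primitive_ae_deriv[OF G] by blast
  have "(\<lambda>x. f x * G x) absolutely_integrable_on {0..c}" "(\<lambda>x. g x * F x) absolutely_integrable_on {0..c}"
    using absolutely_integrable_mult_continuous[OF primitive_absolutely_integrable] F G cF cG by auto
  then have ai: "(\<lambda>x. f x * G x + F x * g x) absolutely_integrable_on {0..c}"
    using set_integral_add(1) by (fastforce simp: mult.commute)
  show ?thesis
  proof (rule primitive_from_abs_continuous[OF ac ai negligible_Un[OF N1(1) N2(1)]])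
    fix x assume "x \<in> {0<..<c} - (N1 \<union> N2)"
    then have "(F has_vector_derivative f x) (at x)" "(G has_vector_derivative g x) (at x)" using N1 N2 by auto
    from has_vector_derivative_mult[OF this]
    show "((\<lambda>x. F x * G x) has_vector_derivative f x * G x + F x * g x) (at x)" by (simp add: add.commute)
  qed
qed

lemma primitive_nondecreasing:
  assumes F: "is_primitive c F f" and N: "negligible N" and nn: "\<And>x. x \<in> {0..c} - N \<Longrightarrow> f x \<ge> 0"
    and xy: "0 \<le> x" "x \<le> y" "y \<le> c"
  shows "F x \<le> F y"
proof -
  have "is_primitive c F (\<lambda>x. max 0 (f x))" by (rule primitive_spike[OF F N]) (use nn in fastforce)
  from primitive_has_integral[OF this xy] have "0 \<le> F y - F x" by (rule has_integral_nonneg) simp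
  then show ?thesis by simp
qed

section \<open>Existence of solutions\<close>

definition is_real_sol :: "real \<Rightarrow> (real \<Rightarrow> real) \<Rightarrow> (real \<Rightarrow> real) \<Rightarrow> (real \<Rightarrow> real) \<Rightarrow> bool" where
  "is_real_sol c Q u v \<longleftrightarrow> is_primitive c u v \<and> is_primitive c v (\<lambda>x. Q x * u x)"

text \<open>A Bielecki weight: in the norm weighted by exp(- l x), integration against |Q| has norm
  at most 1/4 on an interval of any length. The excess of |Q| over M contributes 1/8, and the
  bounded part M / l <= 1/8.\<close>

lemma exp_weighted_integral_small:
  fixes Q :: "real \<Rightarrow> real"
  assumes Q: "Q absolutely_integrable_on {0..c}"
  obtains l where "l \<ge> 1" 
    "\<And>x. x \<in> {0..c} \<Longrightarrow> integral {0..x} (\<lambda>y. \<bar>Q y\<bar> * exp (l * y)) \<le> exp (l * x) / 4"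
proof -
  from absolutely_integrable_truncate[OF Q, of "1/8"]
  obtain M where M: "M > 0" and g: "(\<lambda>x. max 0 (\<bar>Q x\<bar> - M)) integrable_on {0..c}" 
    "integral {0..c} (\<lambda>x. max 0 (\<bar>Q x\<bar> - M)) < 1/8" by auto
  define l where "l = max 1 (8 * M)"
  have l: "l \<ge> 1" "8 * M \<le> l" by (auto simp: l_def)
  have Qa: "(\<lambda>x. \<bar>Q x\<bar>) absolutely_integrable_on {0..c}"
    using absolutely_integrable_abs[OF Q] by simp
  show ?thesis
  proof (rule that[OF l(1)])
    fix x assume x: "x \<in> {0..c}"
    have ce: "continuous_on {0..c} (\<lambda>y. exp (l * y))" by (intro continuous_intros)
    have "(\<lambda>y. \<bar>Q y\<bar> * exp (l * y)) integrable_on {0..c}"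
      using set_lebesgue_integral_eq_integral(1)[OF absolutely_integrable_mult_continuous[OF Qa ce]] .
    then have i1: "(\<lambda>y. \<bar>Q y\<bar> * exp (l * y)) integrable_on {0..x}"
      using x by (auto intro: integrable_on_subinterval)
    have gx: "(\<lambda>x. max 0 (\<bar>Q x\<bar> - M)) integrable_on {0..x}"
      using g x by (auto intro: integrable_on_subinterval)
    have d: "((\<lambda>y. M * exp (l * y)) has_integral (M * exp (l * x) / l - M * exp (l * 0) / l)) {0..x}"
      using l x by (intro fundamental_theorem_of_calculus)
        (auto intro!: derivative_eq_intros simp flip: has_real_derivative_iff_has_vector_derivative)
    have "integral {0..x} (\<lambda>y. \<bar>Q y\<bar> * exp (l * y)) \<le> 
        integral {0..x} (\<lambda>y. exp (l * x) * max 0 (\<bar>Q y\<bar> - M) + M * exp (l * y))"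
    proof (rule integral_le[OF i1])
      show "(\<lambda>y. exp (l * x) * max 0 (\<bar>Q y\<bar> - M) + M * exp (l * y)) integrable_on {0..x}"
        by (rule integrable_add[OF integrable_on_mult_right[OF gx] has_integral_integrable[OF d]])
      fix y assume y: "y \<in> {0..x}"
      have "\<bar>Q y\<bar> * exp (l * y) \<le> (max 0 (\<bar>Q y\<bar> - M) + M) * exp (l * y)"
        by (intro mult_right_mono) auto
      also have "\<dots> = max 0 (\<bar>Q y\<bar> - M) * exp (l * y) + M * exp (l * y)" by (simp add: algebra_simps)
      also have "\<dots> \<le> max 0 (\<bar>Q y\<bar> - M) * exp (l * x) + M * exp (l * y)"
        using y l by (intro add_right_mono mult_left_mono) auto
      finally show "\<bar>Q y\<bar> * exp (l * y) \<le> exp (l * x) * max 0 (\<bar>Q y\<bar> - M) + M * exp (l * y)" by (simp add: mult.commute)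
    qed
    also have "\<dots> = exp (l * x) * integral {0..x} (\<lambda>y. max 0 (\<bar>Q y\<bar> - M)) + integral {0..x} (\<lambda>y. M * exp (l * y))"
      using integral_add[OF integrable_on_mult_right[OF gx] has_integral_integrable[OF d]] by simp
    also have "\<dots> \<le> exp (l * x) * (1 / 8) + exp (l * x) / 8"
    proof (intro add_mono mult_left_mono)
      have "integral {0..x} (\<lambda>y. max 0 (\<bar>Q y\<bar> - M)) \<le> integral {0..c} (\<lambda>y. max 0 (\<bar>Q y\<bar> - M))"
        using x by (intro integral_subset_le gx g(1)) auto
      then show "integral {0..x} (\<lambda>y. max 0 (\<bar>Q y\<bar> - M)) \<le> 1 / 8" using g(2) by simp
      have "integral {0..x} (\<lambda>y. M * exp (l * y)) = M * exp (l * x) / l - M / l"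
        using integral_unique[OF d] by simp
      also have "\<dots> \<le> (M / l) * exp (l * x)" using M l by simp
      also have "\<dots> \<le> (1/8) * exp (l * x)" using M l by (intro mult_right_mono) (auto simp: field_simps)
      finally show "integral {0..x} (\<lambda>y. M * exp (l * y)) \<le> exp (l * x) / 8" by simp
    qed simp
    finally show "integral {0..x} (\<lambda>y. \<bar>Q y\<bar> * exp (l * y)) \<le> exp (l * x) / 4" by simp
  qed
qed

text \<open>These are the terms, not the partial sums, of the Picard series for u'' = Q u with u(0)
  = \<alpha> and u'(0) = \<beta>; the second component is the derivative of the first.\<close>

primrec picard :: "(real \<Rightarrow> real) \<Rightarrow> real \<Rightarrow> real \<Rightarrow> nat \<Rightarrow> (real \<Rightarrow> real) \<times> (real \<Rightarrow> real)" where
  "picard Q \<alpha> \<beta> 0 = (\<lambda>x. \<alpha> + \<beta> * x, \<lambda>x. \<beta>)"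
| "picard Q \<alpha> \<beta> (Suc n) = 
    (\<lambda>x. integral {0..x} (\<lambda>y. integral {0..y} (\<lambda>s. Q s * fst (picard Q \<alpha> \<beta> n) s)),
     \<lambda>x. integral {0..x} (\<lambda>s. Q s * fst (picard Q \<alpha> \<beta> n) s))"

text \<open>On each [0, c] the Picard series converges geometrically in a weighted norm. The weight
  depends on c but the series does not, so a single pair (u, v) works for all c in \<open>I\<close>
  at once, as an unbounded domain requires.\<close>

lemma real_sol_exists:
  assumes Q: "\<And>c. c \<in> I \<Longrightarrow> Q absolutely_integrable_on {0..c}"
  shows "\<exists>u v. u 0 = \<alpha> \<and> v 0 = \<beta> \<and> (\<forall>c\<in>I. is_real_sol c Q u v)"
proof -
  define U where "U n = fst (picard Q \<alpha> \<beta> n)" for n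
  define V where "V n = snd (picard Q \<alpha> \<beta> n)" for n
  have U0: "U 0 x = \<alpha> + \<beta> * x" and V0: "V 0 x = \<beta>" for x by (simp_all add: U_def V_def)
  have US: "U (Suc n) x = integral {0..x} (V (Suc n))" and VS: "V (Suc n) x = integral {0..x} (\<lambda>s. Q s * U n s)" for n x 
    by (simp_all add: U_def V_def)
  define u where "u x = (\<Sum>n. U n x)" for x
  define v where "v x = (\<Sum>n. V n x)" for x
  have "is_real_sol c Q u v" if c: "c \<in> I" for c
  proof -
    note Qc = Q[OF c]
    have *: "is_primitive c (U n) (V n) \<and> is_primitive c (V (Suc n)) (\<lambda>s. Q s * U n s)" for n
    proof (induction n)
      case 0
      have 1: "is_primitive c (U 0) (V 0)"
        by (rule primitive_deriv) (auto simp: U0[abs_def] V0[abs_def] intro!: derivative_eq_intros)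
      have "is_primitive c (V (Suc 0)) (\<lambda>s. Q s * U 0 s)"
        by (rule primitiveI[OF absolutely_integrable_mult_continuous[OF Qc primitive_continuous[OF 1]]]) (simp add: VS)
      with 1 show ?case by simp
    next
      case (Suc n)
      then have vc: "continuous_on {0..c} (V (Suc n))" using primitive_continuous by blast
      have 1: "is_primitive c (U (Suc n)) (V (Suc n))"
        by (rule primitiveI) (auto simp: US intro: absolutely_integrable_continuous_real[OF vc])
      have "is_primitive c (V (Suc (Suc n))) (\<lambda>s. Q s * U (Suc n) s)"
        by (rule primitiveI[OF absolutely_integrable_mult_continuous[OF Qc primitive_continuous[OF 1]]]) (simp add: VS)
      with 1 show ?case by simp
    qed
    then have pU: "is_primitive c (U n) (V n)" and pV: "is_primitive c (V (Suc n)) (\<lambda>s. Q s * U n s)" for n by auto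
    obtain l where l: "l \<ge> 1" 
      "\<And>x. x \<in> {0..c} \<Longrightarrow> integral {0..x} (\<lambda>y. \<bar>Q y\<bar> * exp (l * y)) \<le> exp (l * x) / 4"
      using exp_weighted_integral_small[OF Qc] by blast
    define M where "M = \<bar>\<alpha>\<bar> + \<bar>\<beta>\<bar> * \<bar>c\<bar> + \<bar>\<beta>\<bar>"
    have M: "M \<ge> 0" by (simp add: M_def)
    have bnd: "\<bar>U n x\<bar> \<le> M * (1/2) ^ n * exp (l * x)" "\<bar>V n x\<bar> \<le> M * (1/2) ^ n * exp (l * x)"
      if "x \<in> {0..c}" for n x
    proof -
      have "(\<forall>x\<in>{0..c}. \<bar>U n x\<bar> \<le> M * (1/2) ^ n * exp (l * x)) \<and> (\<forall>x\<in>{0..c}. \<bar>V n x\<bar> \<le> M * (1/2) ^ n * exp (l * x))"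
      proof (induction n)
        case 0
        have "\<bar>U 0 x\<bar> \<le> M * exp (l * x) \<and> \<bar>V 0 x\<bar> \<le> M * exp (l * x)" if x: "x \<in> {0..c}" for x
        proof -
          have "\<bar>\<beta> * x\<bar> \<le> \<bar>\<beta>\<bar> * \<bar>c\<bar>" using x by (auto simp: abs_mult intro!: mult_mono)
          then have "\<bar>U 0 x\<bar> \<le> M" "\<bar>V 0 x\<bar> \<le> M" by (auto simp: U0 V0 M_def)
          moreover have "M * 1 \<le> M * exp (l * x)" using M l x by (intro mult_left_mono) auto
          ultimately show ?thesis by simp
        qed
        then show ?case by simp
      next
        case (Suc n)
        let ?B = "M * (1/2) ^ n"
        have B: "?B \<ge> 0" using M by simp
        have v: "\<bar>V (Suc n) x\<bar> \<le> ?B * (exp (l * x) / 4)" if x: "x \<in> {0..c}" for x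
        proof -
          have ce: "continuous_on {0..c} (\<lambda>y. exp (l * y))" by (intro continuous_intros)
          have "(\<lambda>y. \<bar>Q y\<bar> * exp (l * y)) integrable_on {0..c}"
            using set_lebesgue_integral_eq_integral(1)[OF absolutely_integrable_mult_continuous[OF 
                absolutely_integrable_abs[OF Qc] ce]] by simp
          then have i1: "(\<lambda>y. \<bar>Q y\<bar> * exp (l * y)) integrable_on {0..x}"
            using x by (auto intro: integrable_on_subinterval)
          have i2: "(\<lambda>s. Q s * U n s) integrable_on {0..x}"
            by (rule integrable_on_subinterval[OF primitive_integrable[OF pV]]) (use x in auto)
          have "norm (V (Suc n) x) \<le> integral {0..x} (\<lambda>y. ?B * (\<bar>Q y\<bar> * exp (l * y)))"
            unfolding VS
          proof (rule integral_norm_bound_integral[OF i2 integrable_on_mult_right[OF i1]])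
            fix y assume y: "y \<in> {0..x}"
            then have "\<bar>U n y\<bar> \<le> ?B * exp (l * y)" using Suc x by auto
            then have "\<bar>Q y\<bar> * \<bar>U n y\<bar> \<le> \<bar>Q y\<bar> * (?B * exp (l * y))" by (intro mult_left_mono) auto
            then show "norm (Q y * U n y) \<le> ?B * (\<bar>Q y\<bar> * exp (l * y))" by (simp add: abs_mult mult_ac)
          qed
          also have "\<dots> = ?B * integral {0..x} (\<lambda>y. \<bar>Q y\<bar> * exp (l * y))" by simp
          also have "\<dots> \<le> ?B * (exp (l * x) / 4)" using l(2)[OF x] B by (intro mult_left_mono)
          finally show ?thesis by simp
        qed
        have u: "\<bar>U (Suc n) x\<bar> \<le> ?B * (exp (l * x) / 4)" if x: "x \<in> {0..c}" for x
        proof -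
          have i2: "V (Suc n) integrable_on {0..x}"
            by (rule integrable_on_subinterval[OF primitive_integrable[OF pU]]) (use x in auto)
          have d: "((\<lambda>y. ?B * (exp (l * y) / 4)) has_integral (?B * (exp (l * x) / (4 * l)) - ?B * (exp (l * 0) / (4 * l)))) {0..x}"
            using l x by (intro fundamental_theorem_of_calculus)
              (auto intro!: derivative_eq_intros simp flip: has_real_derivative_iff_has_vector_derivative)
          have "norm (U (Suc n) x) \<le> integral {0..x} (\<lambda>y. ?B * (exp (l * y) / 4))"
            unfolding US
            by (rule integral_norm_bound_integral[OF i2 has_integral_integrable[OF d]]) (use v x in auto)
          also have "\<dots> = ?B * (exp (l * x) / (4 * l)) - ?B * (1 / (4 * l))"
            using integral_unique[OF d] by simp
          also have "\<dots> \<le> ?B * (exp (l * x) / (4 * l))" using B l by simp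
          also have "\<dots> \<le> ?B * (exp (l * x) / 4)" using B l by (intro mult_left_mono divide_left_mono) auto
          finally show ?thesis by simp
        qed
        have "?B * (exp (l * x) / 4) \<le> M * (1/2) ^ Suc n * exp (l * x)" for x
          using B by (simp add: field_simps)
        then show ?case using u v order_trans by fast
      qed
      then show "\<bar>U n x\<bar> \<le> M * (1/2) ^ n * exp (l * x)" "\<bar>V n x\<bar> \<le> M * (1/2) ^ n * exp (l * x)"
        using that by auto
    qed
    define K where "K = M * exp (l * \<bar>c\<bar>)"
    have K: "\<bar>U n x\<bar> \<le> K * (1/2) ^ n" "\<bar>V n x\<bar> \<le> K * (1/2) ^ n" if x: "x \<in> {0..c}" for n x
    proof -
      have "M * (1/2) ^ n * exp (l * x) \<le> M * (1/2) ^ n * exp (l * \<bar>c\<bar>)"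
        using x l M by (intro mult_left_mono) (auto intro: mult_left_mono)
      then show "\<bar>U n x\<bar> \<le> K * (1/2) ^ n" "\<bar>V n x\<bar> \<le> K * (1/2) ^ n"
        using bnd[OF x, of n] by (auto simp: K_def mult_ac)
    qed
    have sK: "summable (\<lambda>n. K * (1/2) ^ n :: real)" by (intro summable_mult summable_geometric) simp
    have geo: "\<bar>\<Sum>i<n. f i\<bar> \<le> 2 * K" if "\<And>i. \<bar>f i\<bar> \<le> K * (1/2) ^ i" for f :: "nat \<Rightarrow> real" and n
    proof -
      have "\<bar>\<Sum>i<n. f i\<bar> \<le> (\<Sum>i<n. K * (1/2) ^ i)"
        by (rule order_trans[OF sum_abs sum_mono]) (rule that)
      also have "\<dots> \<le> (\<Sum>i. K * (1/2) ^ i)" by (rule sum_le_suminf[OF sK]) (auto simp: K_def M)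
      also have "\<dots> = 2 * K" by (subst suminf_mult) (auto simp: suminf_geometric)
      finally show ?thesis .
    qed
    have ulU: "uniform_limit {0..c} (\<lambda>n x. \<Sum>i<n. U i x) u sequentially"
      unfolding u_def[abs_def] by (rule Weierstrass_m_test[OF _ sK]) (use K in auto)
    have ulV: "uniform_limit {0..c} (\<lambda>n x. \<Sum>i<n. V i x) v sequentially"
      unfolding v_def[abs_def] by (rule Weierstrass_m_test[OF _ sK]) (use K in auto)
    have cU: "continuous_on {0..c} (U n)" for n by (rule primitive_continuous[OF pU])
    have cV: "continuous_on {0..c} (V n)" for n
      by (cases n) (auto simp: V0[abs_def] intro: primitive_continuous[OF pV])
    have cu: "continuous_on {0..c} u"
      by (rule uniform_limit_theorem[OF _ ulU]) (auto intro!: always_eventually continuous_on_sum cU)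
    have cv: "continuous_on {0..c} v"
      by (rule uniform_limit_theorem[OF _ ulV]) (auto intro!: always_eventually continuous_on_sum cV)
    have tU: "(\<lambda>n. \<Sum>i<n. U i x) \<longlonglongrightarrow> u x" and tV: "(\<lambda>n. \<Sum>i<n. V i x) \<longlonglongrightarrow> v x" if "x \<in> {0..c}" for x
      using tendsto_uniform_limitI[OF ulU that] tendsto_uniform_limitI[OF ulV that] by auto
    have pSU: "is_primitive c (\<lambda>x. \<Sum>i<n. U i x) (\<lambda>x. \<Sum>i<n. V i x)" for n
      by (induction n) (auto intro: primitive_add pU primitive_const)
    \<comment> \<open>The sums are offset by one: V_0 is constant, and V_(n+1) has derivative Q
      U_n.\<close>
    have pSV: "is_primitive c (\<lambda>x. \<Sum>i<Suc n. V i x) (\<lambda>x. Q x * (\<Sum>i<n. U i x))" for n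
    proof (induction n)
      case 0
      then show ?case using primitive_const[of c \<beta>] by (simp add: V0[abs_def])
    next
      case (Suc n)
      from primitive_add[OF Suc pV[of n]] show ?case by (simp add: distrib_left)
    qed
    have u: "is_primitive c u v"
    proof (rule primitiveI)
      show "v absolutely_integrable_on {0..c}" by (rule absolutely_integrable_continuous_real[OF cv])
      fix x assume x: "x \<in> {0..c}"
      then have 0: "0 \<in> {0..c}" by auto
      have "(\<lambda>n. integral {0..x} (\<lambda>x. \<Sum>i<n. V i x)) \<longlonglongrightarrow> integral {0..x} v"
      proof (rule dominated_convergence(2)[where h="\<lambda>x. 2 * K"])
        show "(\<lambda>x. \<Sum>i<n. V i x) integrable_on {0..x}" for n
          by (rule integrable_on_subinterval[OF primitive_integrable[OF pSU]]) (use x in auto)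
        fix y assume "y \<in> {0..x}"
        then have yc: "y \<in> {0..c}" using x by auto
        show "(\<lambda>n. \<Sum>i<n. V i y) \<longlonglongrightarrow> v y" by (rule tV[OF yc])
        show "norm (\<Sum>i<n. V i y) \<le> 2 * K" for n
          unfolding real_norm_def by (rule geo) (use K yc in auto)
      qed auto
      then have "(\<lambda>n. (\<Sum>i<n. U i 0) + integral {0..x} (\<lambda>x. \<Sum>i<n. V i x)) \<longlonglongrightarrow> u 0 + integral {0..x} v"
        using tU[OF 0] by (intro tendsto_add)
      then have "(\<lambda>n. \<Sum>i<n. U i x) \<longlonglongrightarrow> u 0 + integral {0..x} v"
        by (simp add: primitive_eq[OF pSU x, symmetric])
      then show "u x = u 0 + integral {0..x} v" using tU[OF x] LIMSEQ_unique by blast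
    qed
    have v: "is_primitive c v (\<lambda>x. Q x * u x)"
    proof (rule primitiveI)
      show "(\<lambda>x. Q x * u x) absolutely_integrable_on {0..c}" 
        by (rule absolutely_integrable_mult_continuous[OF Qc cu])
      fix x assume x: "x \<in> {0..c}"
      then have 0: "0 \<in> {0..c}" by auto
      have "(\<lambda>n. integral {0..x} (\<lambda>x. Q x * (\<Sum>i<n. U i x))) \<longlonglongrightarrow> integral {0..x} (\<lambda>x. Q x * u x)"
      proof (rule dominated_convergence(2)[where h="\<lambda>x. \<bar>Q x\<bar> * (2 * K)"])
        show "(\<lambda>x. Q x * (\<Sum>i<n. U i x)) integrable_on {0..x}" for n
          by (rule integrable_on_subinterval[OF primitive_integrable[OF pSV]]) (use x in auto)
        have "(\<lambda>x. \<bar>Q x\<bar>) integrable_on {0..c}" 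
          using set_lebesgue_integral_eq_integral(1)[OF absolutely_integrable_abs[OF Qc]] by simp
        then show "(\<lambda>x. \<bar>Q x\<bar> * (2 * K)) integrable_on {0..x}"
          using x by (auto intro: integrable_on_subinterval intro!: integrable_on_mult_left)
        fix y assume y: "y \<in> {0..x}"
        then have yc: "y \<in> {0..c}" using x by auto
        show "(\<lambda>n. Q y * (\<Sum>i<n. U i y)) \<longlonglongrightarrow> Q y * u y" by (intro tendsto_intros tU yc)
        fix n
        have "\<bar>\<Sum>i<n. U i y\<bar> \<le> 2 * K" by (rule geo) (use K yc in auto)
        then show "norm (Q y * (\<Sum>i<n. U i y)) \<le> \<bar>Q y\<bar> * (2 * K)" by (simp add: abs_mult mult_left_mono)
      qed
      moreover have "(\<lambda>n. \<Sum>i<Suc n. V i 0) \<longlonglongrightarrow> v 0" by (rule LIMSEQ_Suc[OF tV[OF 0]])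
      ultimately have "(\<lambda>n. (\<Sum>i<Suc n. V i 0) + integral {0..x} (\<lambda>x. Q x * (\<Sum>i<n. U i x))) \<longlonglongrightarrow> v 0 + integral {0..x} (\<lambda>x. Q x * u x)"
        by (intro tendsto_add)
      then have "(\<lambda>n. \<Sum>i<Suc n. V i x) \<longlonglongrightarrow> v 0 + integral {0..x} (\<lambda>x. Q x * u x)"
        by (simp only: primitive_eq[OF pSV x, symmetric])
      then show "v x = v 0 + integral {0..x} (\<lambda>x. Q x * u x)" 
        using LIMSEQ_Suc[OF tV[OF x]] LIMSEQ_unique by blast
    qed
    show ?thesis unfolding is_real_sol_def using u v by blast
  qed
  moreover have "U (Suc n) 0 = 0" "V (Suc n) 0 = 0" for n by (simp_all add: US VS)
  then have U0': "U n 0 = (if n = 0 then \<alpha> else 0)" and V0': "V n 0 = (if n = 0 then \<beta> else 0)" for n 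
    by (cases n; simp add: U0 V0)+
  have "u 0 = \<alpha>" "v 0 = \<beta>" unfolding u_def v_def U0' V0' 
    using suminf_finite[of "{0}" "\<lambda>n. if n = 0 then \<alpha> else 0"] suminf_finite[of "{0}" "\<lambda>n. if n = 0 then \<beta> else 0"] by auto
  ultimately show ?thesis by blast
qed

section \<open>Sign of Weyl solutions\<close>

lemma real_sol_primitive: "is_real_sol c Q u v \<Longrightarrow> is_primitive c u v" "is_real_sol c Q u v \<Longrightarrow> is_primitive c v (\<lambda>x. Q x * u x)"
  by (auto simp: is_real_sol_def)

lemma real_sol_continuous: "is_real_sol c Q u v \<Longrightarrow> continuous_on {0..c} u" "is_real_sol c Q u v \<Longrightarrow> continuous_on {0..c} v"
  by (auto simp: is_real_sol_def intro: primitive_continuous)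

lemma real_sol_linear:
  assumes "is_real_sol c Q u v" "is_real_sol c Q u' v'"
  shows "is_real_sol c Q (\<lambda>x. a * u x + b * u' x) (\<lambda>x. a * v x + b * v' x)"
proof -
  have "is_primitive c (\<lambda>x. a * v x + b * v' x) (\<lambda>x. a * (Q x * u x) + b * (Q x * u' x))"
    using assms by (intro primitive_add primitive_cmult real_sol_primitive)
  then show ?thesis
    using assms unfolding is_real_sol_def by (auto intro!: primitive_add primitive_cmult simp: algebra_simps)
qed

lemma real_sol_zero_imp_deriv_zero:
  assumes "is_real_sol c Q u v" "c > 0" "\<And>x. x \<in> {0..c} \<Longrightarrow> u x = 0"
  shows "v 0 = 0"
proof -
  have "(u has_vector_derivative v 0) (at 0 within {0..c})"
    using primitive_has_vector_derivative[OF real_sol_primitive(1)[OF assms(1)] real_sol_continuous(2)[OF assms(1)]] assms(2) by simp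
  moreover have "(u has_vector_derivative 0) (at 0 within {0..c})"
    by (rule has_vector_derivative_transform[of _ _ _ "\<lambda>_. 0"]) (use assms in auto)
  ultimately show ?thesis
    by (rule vector_derivative_unique_within[rotated]) (use assms(2) in \<open>simp add: trivial_limit_within islimpt_Icc\<close>)
qed

text \<open>In the non-integrable case the integral has the default value 0.\<close>

lemma integral_nonneg_total:
  fixes f :: "'a::euclidean_space \<Rightarrow> real"
  shows "(\<And>x. x \<in> S \<Longrightarrow> 0 \<le> f x) \<Longrightarrow> 0 \<le> integral S f"
  by (cases "f integrable_on S") (auto intro: integral_nonneg simp: not_integrable_integral)

text \<open>With the quasi-derivative w = v + \<sigma> u the equations u' = v, v' = Q u give
  (w u)' = w^2 + (Q + s - \<sigma>^2) u^2, so w u is increasing.\<close>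
locale quasi_derivative =
  fixes D :: "real set" and Q \<sigma> s :: "real \<Rightarrow> real" and N :: "real set" and C :: real
  assumes D0: "\<And>c. c \<in> D \<Longrightarrow> 0 \<le> c" and Ddown: "\<And>c x. c \<in> D \<Longrightarrow> 0 \<le> x \<Longrightarrow> x \<le> c \<Longrightarrow> x \<in> D"
    and Dpos: "\<exists>c\<in>D. c > 0"
    and \<sigma>: "\<And>c. c \<in> D \<Longrightarrow> is_primitive c \<sigma> s" and \<sigma>C: "\<And>x. x \<in> D \<Longrightarrow> \<bar>\<sigma> x\<bar> \<le> C"
    and N: "negligible N" and G: "\<And>x. x \<in> D - N \<Longrightarrow> Q x + s x - (\<sigma> x)\<^sup>2 \<ge> 1"
begin

lemma zero_mem: "0 \<in> D" using Dpos Ddown by (metis less_imp_le order_refl)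

text \<open>The product w u. Both kinds of end condition become one inequality for it: Weyl
  solutions have energy at most 0 on all of \<open>D\<close>, and for b = \<infinity> the converse
  holds as well.\<close>

definition energy :: "(real \<Rightarrow> real) \<Rightarrow> (real \<Rightarrow> real) \<Rightarrow> real \<Rightarrow> real" where
  "energy u v x = (v x + \<sigma> x * u x) * u x"

lemma primitive_energy:
  assumes "is_real_sol c Q u v" "c \<in> D"
  shows "is_primitive c (energy u v) (\<lambda>x. (v x + \<sigma> x * u x)\<^sup>2 + (Q x + s x - (\<sigma> x)\<^sup>2) * (u x)\<^sup>2)"
proof -
  note pu = real_sol_primitive[OF assms(1)]
  have "is_primitive c (\<lambda>x. (v x + \<sigma> x * u x) * u x) 
    (\<lambda>x. (Q x * u x + (s x * u x + \<sigma> x * v x)) * u x + (v x + \<sigma> x * u x) * v x)"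
    by (intro primitive_mult primitive_add pu \<sigma> assms)
  then show ?thesis
    by (rule primitive_cong) (auto simp: energy_def power2_eq_square algebra_simps)
qed

text \<open>By \<open>G\<close> the coefficient of u^2 in the derivative of the energy is at least 1
  off \<open>N\<close>. The quantitative form makes the growth strict for nonzero solutions and
  later yields square integrability.\<close>

lemma energy_growth:
  assumes u: "is_real_sol c Q u v" and c: "c \<in> D" and xy: "0 \<le> x" "x \<le> y" "y \<le> c"
  shows "integral {x..y} (\<lambda>t. (v t + \<sigma> t * u t)\<^sup>2 + (u t)\<^sup>2) \<le> energy u v y - energy u v x"
proof -
  let ?j = "\<lambda>t. (v t + \<sigma> t * u t)\<^sup>2 + (u t)\<^sup>2"
  have cj: "continuous_on {0..c} ?j"
    using real_sol_continuous[OF u] primitive_continuous[OF \<sigma>[OF c]] by (intro continuous_intros)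
  define J where "J x = integral {0..x} ?j" for x
  have J: "is_primitive c J ?j" unfolding J_def
    by (rule primitiveI) (auto intro: absolutely_integrable_continuous_real[OF cj])
  have "J y - J x = integral {x..y} ?j" 
    using integral_unique[OF primitive_has_integral[OF J xy]] by simp
  moreover have "energy u v x - J x \<le> energy u v y - J y"
  proof (rule primitive_nondecreasing[OF primitive_diff[OF primitive_energy[OF u c] J] N _ xy])
    fix t assume "t \<in> {0..c} - N"
    then have "Q t + s t - (\<sigma> t)\<^sup>2 \<ge> 1" using G Ddown[OF c] by auto
    then have "1 * (u t)\<^sup>2 \<le> (Q t + s t - (\<sigma> t)\<^sup>2) * (u t)\<^sup>2" by (intro mult_right_mono) auto
    then show "0 \<le> (v t + \<sigma> t * u t)\<^sup>2 + (Q t + s t - (\<sigma> t)\<^sup>2) * (u t)\<^sup>2 - ?j t" by simp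
  qed
  ultimately show ?thesis by simp
qed

lemma energy_mono:
  assumes u: "is_real_sol c Q u v" and c: "c \<in> D" and xy: "0 \<le> x" "x \<le> y" "y \<le> c"
  shows "energy u v x \<le> energy u v y"
proof -
  have "0 \<le> integral {x..y} (\<lambda>t. (v t + \<sigma> t * u t)\<^sup>2 + (u t)\<^sup>2)"
    by (rule integral_nonneg_total) simp
  then show ?thesis using energy_growth[OF assms] by simp
qed

lemma energy_const_imp_zero:
  assumes u: "is_real_sol c Q u v" and c: "c \<in> D" and xy: "0 \<le> x" "x < y" "y \<le> c" and eq: "energy u v y \<le> energy u v x"
    and t: "t \<in> {x..y}"
  shows "u t = 0"
proof -
  let ?j = "\<lambda>t. (v t + \<sigma> t * u t)\<^sup>2 + (u t)\<^sup>2"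
  have "continuous_on {0..c} ?j"
    using real_sol_continuous[OF u] primitive_continuous[OF \<sigma>[OF c]] by (intro continuous_intros)
  then have cj: "continuous_on {x..y} ?j" by (rule continuous_on_subset) (use xy in auto)
  have "integral {x..y} ?j \<le> 0" using energy_growth[OF u c, of x y] xy eq by simp
  moreover have "0 \<le> integral {x..y} ?j" 
    by (rule integral_nonneg_total) simp
  ultimately have "(?j has_integral 0) (cbox x y)"
    using integrable_integral[OF integrable_continuous_real[OF cj]] by simp
  then have "?j t = 0"
    by (rule has_integral_0_cbox_imp_0[rotated 2]) (use cj xy t in \<open>simp_all add: box_real\<close>)
  then show "u t = 0" by (simp add: sum_power2_eq_zero_iff)
qed

text \<open>A zero of u is a zero of the energy, which is nondecreasing and at most 0. From there on
  the energy would be constant and u would vanish, so u cannot change its sign. Where u / u(0) > 0,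
  the inequality w u <= 0 can be divided by u and bounds v by - \<sigma> u.\<close>

lemma sign_alternative:
  assumes u: "\<And>c. c \<in> D \<Longrightarrow> is_real_sol c Q u v" and le: "\<And>x. x \<in> D \<Longrightarrow> energy u v x \<le> 0"
  shows "(\<forall>x\<in>D. u x = 0) \<or> (u 0 \<noteq> 0 \<and> (\<forall>x\<in>D. u x / u 0 \<ge> 0 \<and> v x / u 0 \<le> C * (u x / u 0)))"
proof (cases "energy u v 0 = 0")
  case True
  have "u x = 0" if x: "x \<in> D" for x
  proof -
    \<comment> \<open>The maximum with \<open>c0\<close> keeps the interval nondegenerate when x =
      0.\<close>
    obtain c0 where "c0 \<in> D" "c0 > 0" using Dpos by blast
    then have c: "max x c0 \<in> D" "max x c0 > 0" "x \<le> max x c0" using x by (auto simp: max_def)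
    define c where "c = max x c0"
    note c = c[folded c_def]
    show ?thesis
      by (rule energy_const_imp_zero[OF u c(1), of 0 c]) (use c D0[OF x] True le[of c] in auto)
  qed
  then show ?thesis by blast
next
  case False
  then have u0: "u 0 \<noteq> 0" by (auto simp: energy_def)
  have nn: "u x / u 0 \<ge> 0" if x: "x \<in> D" for x
  proof (rule ccontr)
    assume neg: "\<not> u x / u 0 \<ge> 0"
    have cu: "continuous_on {0..x} (\<lambda>t. u t / u 0)"
      using real_sol_continuous[OF u[OF x]] u0 by (intro continuous_intros) auto
    have "\<exists>y\<ge>0. y \<le> x \<and> u y / u 0 = 0"
      by (rule IVT2'[OF _ _ _ cu]) (use neg D0[OF x] u0 in auto)
    then obtain y where y: "0 \<le> y" "y \<le> x" "u y = 0" using u0 by auto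
    with neg have "y < x" by (cases "y = x") auto
    have "u x = 0"
      by (rule energy_const_imp_zero[OF u[OF x] x y(1) \<open>y < x\<close>]) (use le[OF x] y in \<open>auto simp: energy_def\<close>)
    with neg show False by simp
  qed
  have "v x / u 0 \<le> C * (u x / u 0)" if x: "x \<in> D" for x
  proof (cases "u x = 0")
    case False
    define U V where "U = u x / u 0" and "V = v x / u 0"
    have U: "U > 0" using nn[OF x] False u0 by (simp add: U_def less_le)
    have "(V + \<sigma> x * U) * U = energy u v x / (u 0)\<^sup>2"
      using u0 by (simp add: U_def V_def energy_def field_simps power2_eq_square)
    also have "\<dots> \<le> 0" using le[OF x] by (simp add: divide_nonpos_pos u0)
    finally have "V + \<sigma> x * U \<le> 0" using U by (simp add: mult_le_0_iff)
    moreover have "- \<sigma> x * U \<le> C * U" using \<sigma>C[OF x] U by (intro mult_right_mono) auto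
    ultimately show ?thesis by (simp add: U_def V_def)
  next
    \<comment> \<open>At a zero of u no division is possible. Instead, u / u(0) is nonnegative to
      the left of x and 0 at x, so its derivative there cannot be positive.\<close>
    case True
    have x0: "0 < x" using D0[OF x] True u0 by (cases "x = 0") auto
    have "(u has_vector_derivative v x) (at x within {0..x})"
      using primitive_has_vector_derivative[OF real_sol_primitive(1)[OF u[OF x]] real_sol_continuous(2)[OF u[OF x]]] x0 by simp
    then have "(u has_real_derivative v x) (at x within {0..x})"
      by (simp add: has_real_derivative_iff_has_vector_derivative)
    then have d: "((\<lambda>t. u t / u 0) has_real_derivative v x / u 0) (at x within {0..x})"
      by (rule DERIV_cdivide)
    have "\<not> v x / u 0 > 0"
    proof
      assume "v x / u 0 > 0"
      from has_real_derivative_pos_inc_left[OF d this]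
      obtain e where e: "e > 0" "\<And>h. h > 0 \<Longrightarrow> x - h \<in> {0..x} \<Longrightarrow> h < e \<Longrightarrow> u (x - h) / u 0 < u x / u 0" by blast
      define h where "h = min x (e / 2)"
      have "h > 0" "x - h \<in> {0..x}" "h < e" using x0 e(1) by (auto simp: h_def)
      from e(2)[OF this] True have "u (x - h) / u 0 < 0" by simp
      moreover have "x - h \<in> D" using Ddown[OF x] \<open>x - h \<in> {0..x}\<close> by auto
      ultimately show False using nn by fastforce
    qed
    then show ?thesis using True by simp
  qed
  then show ?thesis using nn u0 by blast
qed

text \<open>The energy stays positive from x on, so neither of its factors can vanish and both keep
  their sign.\<close>

lemma forward_cone:
  assumes u: "is_real_sol c Q u v" and c: "c \<in> D" and xy: "0 \<le> x" "x \<le> c" and pos: "u x > 0" "v x + \<sigma> x * u x > 0"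
  shows "u c > 0 \<and> v c + \<sigma> c * u c > 0"
proof -
  have wp: "energy u v y > 0" if "y \<in> {x..c}" for y
  proof -
    have "0 < energy u v x" using pos by (simp add: energy_def)
    also have "\<dots> \<le> energy u v y" by (rule energy_mono[OF u c]) (use that xy in auto)
    finally show ?thesis .
  qed
  have "u c > 0"
  proof (rule ccontr)
    assume "\<not> u c > 0"
    have cu: "continuous_on {x..c} u" by (rule continuous_on_subset[OF real_sol_continuous(1)[OF u]]) (use xy in auto)
    have "\<exists>y\<ge>x. y \<le> c \<and> u y = 0"
      by (rule IVT2'[OF _ _ _ cu]) (use \<open>\<not> u c > 0\<close> pos xy in auto)
    then show False using wp by (force simp: energy_def)
  qed
  moreover have "energy u v c > 0" using wp[of c] xy by simp
  ultimately show ?thesis by (simp add: energy_def zero_less_mult_iff)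
qed

text \<open>A shooting argument: the slopes l for which the solution enters the positive or the negative cone
  form two disjoint nonempty open sets, so some l belongs to neither.\<close>
lemma exists_decaying:
  assumes Q: "\<And>c. c \<in> D \<Longrightarrow> Q absolutely_integrable_on {0..c}"
  obtains u v where "\<And>c. c \<in> D \<Longrightarrow> is_real_sol c Q u v" "\<And>x. x \<in> D \<Longrightarrow> energy u v x \<le> 0" "\<not> (\<forall>x\<in>D. u x = 0)"
proof -
  \<comment> \<open>With these initial data \<open>U l\<close> has the value l and the
    quasi-derivative l - 1 at 0, so l = 2 lies in \<open>S\<close> and l = -1 in
    \<open>S'\<close>.\<close>
  obtain \<phi> \<phi>' where \<phi>: "\<phi> 0 = 1" "\<phi>' 0 = 1 - \<sigma> 0" "\<And>c. c \<in> D \<Longrightarrow> is_real_sol c Q \<phi> \<phi>'"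
    using real_sol_exists[OF Q, of D 1 "1 - \<sigma> 0"] by blast
  obtain \<theta> \<theta>' where \<theta>: "\<theta> 0 = 0" "\<theta>' 0 = 1" "\<And>c. c \<in> D \<Longrightarrow> is_real_sol c Q \<theta> \<theta>'"
    using real_sol_exists[OF Q, of D 0 1] by blast
  define U where "U l x = l * \<phi> x + (-1) * \<theta> x" for l x
  define V where "V l x = l * \<phi>' x + (-1) * \<theta>' x" for l x
  have sl: "is_real_sol c Q (U l) (V l)" if "c \<in> D" for c l
    unfolding U_def V_def using real_sol_linear[OF \<phi>(3) \<theta>(3)] that by blast
  define S where "S = (\<Union>x\<in>D. {l. 0 < U l x} \<inter> {l. 0 < V l x + \<sigma> x * U l x})"
  define S' where "S' = (\<Union>x\<in>D. {l. U l x < 0} \<inter> {l. V l x + \<sigma> x * U l x < 0})"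
  have op: "open S" "open S'" unfolding S_def S'_def U_def V_def
    by (intro open_UN ballI open_Int open_Collect_less continuous_intros)+
  have "2 \<in> S" "-1 \<in> S'" unfolding S_def S'_def using zero_mem \<phi> \<theta> by (auto simp: U_def V_def intro!: bexI[of _ 0])
  moreover have "S \<inter> S' = {}"
  proof (rule ccontr)
    assume "S \<inter> S' \<noteq> {}"
    then obtain l x y where l: "x \<in> D" "y \<in> D" "0 < U l x" "0 < V l x + \<sigma> x * U l x"
      "U l y < 0" "V l y + \<sigma> y * U l y < 0" unfolding S_def S'_def by blast
    have sm: "is_real_sol c Q (\<lambda>x. - U l x) (\<lambda>x. - V l x)" if "c \<in> D" for c
      using real_sol_linear[OF sl[OF that] sl[OF that], of "-1" l 0 l] by simp
    show False
    proof (cases "x \<le> y")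
      case True
      from forward_cone[OF sl[OF l(2)] l(2) D0[OF l(1)] True l(3,4)] l(5) show False by simp
    next
      case False
      then have "y \<le> x" by simp
      from forward_cone[OF sm[OF l(1)] l(1) D0[OF l(2)] this] l show False by simp
    qed
  qed
  ultimately have "S \<union> S' \<noteq> UNIV"
    using connected_UNIV[where 'a=real] op unfolding connected_def by blast
  then obtain l where l: "l \<notin> S" "l \<notin> S'" by blast
  show ?thesis
  proof (rule that[of "U l" "V l"])
    show "energy (U l) (V l) x \<le> 0" if "x \<in> D" for x
    proof (rule ccontr)
      assume "\<not> energy (U l) (V l) x \<le> 0"
      then have "(0 < U l x \<and> 0 < V l x + \<sigma> x * U l x) \<or> (U l x < 0 \<and> V l x + \<sigma> x * U l x < 0)"
        by (auto simp: energy_def zero_less_mult_iff not_le)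
      then show False using l that unfolding S_def S'_def by blast
    qed
    show "\<not> (\<forall>x\<in>D. U l x = 0)"
    proof
      assume z: "\<forall>x\<in>D. U l x = 0"
      obtain c where c: "c \<in> D" "c > 0" using Dpos by blast
      have "V l 0 = 0" by (rule real_sol_zero_imp_deriv_zero[OF sl[OF c(1)] c(2)]) (use z Ddown[OF c(1)] in auto)
      moreover have "U l 0 = 0" using z zero_mem by blast
      ultimately show False using \<phi> \<theta> by (simp add: U_def V_def)
    qed
  qed (rule sl)
qed

end

section \<open>Weyl solutions of a potential\<close>

lemma closed_domain_simps: "closed_domain \<infinity> = {0..}" "closed_domain (ereal r) = {0..r}"
  by (auto simp: closed_domain_def)

lemma einterval_simps: "einterval 0 \<infinity> = {0<..}" "einterval 0 (ereal r) = {0<..<r}"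
  by (auto simp: einterval_def)

lemma potential_pos: "is_potential q b h \<Longrightarrow> 0 < b"
  by (simp add: is_potential_def)

lemma potential_cases:
  assumes "is_potential q b h"
  obtains "b = \<infinity>" "h = None" | r h' where "b = ereal r" "r > 0" "h = Some h'" "h' \<noteq> - \<infinity>"
  using assms by (cases b) (auto simp: is_potential_def)

lemma potential_absolutely_integrable:
  assumes pot: "is_potential q b h" and c: "c \<in> closed_domain b"
  shows "q absolutely_integrable_on {0..c}"
proof (cases rule: potential_cases[OF pot])
  case (2 r h')
  have "q absolutely_integrable_on {0<..<r}"
    using pot 2 by (simp add: is_potential_def einterval_simps)
  then have "q absolutely_integrable_on {0..r}" by (simp add: absolutely_integrable_on_Icc_iff_Ioo)
  then show ?thesis
    by (rule absolutely_integrable_on_subinterval) (use c 2 in \<open>auto simp: closed_domain_simps\<close>)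
next
  case 1
  have unit: "q absolutely_integrable_on {y..y+1}" if "y \<ge> 0" for y
    using pot 1 that by (simp add: is_potential_def absolutely_integrable_on_Icc_iff_Ioo)
  have n: "q absolutely_integrable_on {0..real n}" for n
  proof (induction n)
    case (Suc n)
    show ?case
      by (rule absolutely_integrable_on_combine[OF Suc, of "real (Suc n)"]) (use unit[of "real n"] in \<open>auto simp: add.commute\<close>)
  next
    case 0
    show ?case using absolutely_integrable_on_null[of 0 0 q] by simp
  qed
  obtain n where "c \<le> real n" using real_arch_simple by blast
  then show ?thesis
    by (intro absolutely_integrable_on_subinterval[OF n[of n]]) auto
qed

lemma closed_domain_nonneg: "c \<in> closed_domain b \<Longrightarrow> 0 \<le> c"
  by (simp add: closed_domain_def)

lemma closed_domain_down: "c \<in> closed_domain b \<Longrightarrow> 0 \<le> x \<Longrightarrow> x \<le> c \<Longrightarrow> x \<in> closed_domain b"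
  using order_trans[of "ereal x" "ereal c" b] by (simp add: closed_domain_def)

lemma closed_domain_pos: "0 < b \<Longrightarrow> \<exists>c\<in>closed_domain b. c > 0"
  by (cases b) (auto simp: closed_domain_simps intro: bexI[of _ 1])

text \<open>For b = \<infinity>, \<sigma> is the difference between the primitive F of the negative part of q and its
  average over [x, x + 1]; it is bounded because the negative part is uniformly locally integrable.
  The choice of \<sigma>(b) for b < \<infinity> makes w u vanish at b.\<close>
lemma potential_quasi_derivative:
  assumes pot: "is_potential q b h"
  obtains C \<sigma> s where "C \<ge> 0" 
    "\<And>\<kappa>. \<kappa> \<ge> C + 1 \<Longrightarrow> quasi_derivative (closed_domain b) (\<lambda>x. q x + \<kappa>\<^sup>2) \<sigma> s {} C"
    "b = \<infinity> \<Longrightarrow> \<forall>x\<ge>0. \<sigma> x \<le> 0" "\<And>r. b \<noteq> \<infinity> \<Longrightarrow> h = Some (ereal r) \<Longrightarrow> \<sigma> (real_of_ereal b) = r"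
proof (cases rule: potential_cases[OF pot])
  case (2 r h')
  note ai = potential_absolutely_integrable[OF pot]
  have air: "q absolutely_integrable_on {0..r}" using ai[of r] 2 by (simp add: closed_domain_simps)
  have qi: "q integrable_on {0..r}" using air set_lebesgue_integral_eq_integral(1) by blast
  have aqi: "(\<lambda>x. \<bar>q x\<bar>) integrable_on {0..r}" 
    using set_lebesgue_integral_eq_integral(1)[OF absolutely_integrable_abs[OF air]] by simp
  \<comment> \<open>The Dirichlet condition makes w u vanish at b whatever \<sigma>(b) is; 0 is one
    possible choice.\<close>
  define h0 where "h0 = (if h' = \<infinity> then 0 else real_of_ereal h')"
  \<comment> \<open>Here \<sigma>' = - q, so that Q + s - \<sigma>^2 = \<kappa>^2 - \<sigma>^2. With
    |\<sigma>| <= C this is at least 1 as soon as \<kappa> >= C + 1.\<close>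
  define \<sigma> where "\<sigma> x = h0 + (integral {0..r} q - integral {0..x} q)" for x
  define C where "C = \<bar>h0\<bar> + integral {0..r} (\<lambda>x. \<bar>q x\<bar>)"
  have C0: "C \<ge> 0" unfolding C_def using integral_nonneg[OF aqi] by simp
  show ?thesis
  proof (rule that[of C \<sigma> "\<lambda>x. - q x", OF C0])
    fix \<kappa> assume \<kappa>: "\<kappa> \<ge> C + 1"
    have \<sigma>C: "\<bar>\<sigma> x\<bar> \<le> C" if x: "x \<in> {0..r}" for x
    proof -
      have "integral {0..x} q + integral {x..r} q = integral {0..r} q"
        using x by (intro Henstock_Kurzweil_Integration.integral_combine qi) auto
      then have eq: "integral {0..r} q - integral {0..x} q = integral {x..r} q" by simp
      have "norm (integral {x..r} q) \<le> integral {x..r} (\<lambda>x. \<bar>q x\<bar>)"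
        by (rule integral_norm_bound_integral)
          (use x in \<open>auto intro: integrable_on_subinterval[OF qi] integrable_on_subinterval[OF aqi]\<close>)
      also have "\<dots> \<le> integral {0..r} (\<lambda>x. \<bar>q x\<bar>)"
        by (rule integral_subset_le) (use x in \<open>auto intro: integrable_on_subinterval[OF aqi] aqi\<close>)
      finally show ?thesis unfolding \<sigma>_def C_def eq by simp
    qed
    show "quasi_derivative (closed_domain b) (\<lambda>x. q x + \<kappa>\<^sup>2) \<sigma> (\<lambda>x. - q x) {} C"
    proof
      fix c assume c: "c \<in> closed_domain b"
      have "is_primitive c (\<lambda>x. h0 + integral {0..r} q - integral {0..x} q) (\<lambda>x. 0 - q x)"
        by (intro primitive_diff primitive_const primitiveI ai c) auto
      then show "is_primitive c \<sigma> (\<lambda>x. - q x)" by (simp add: \<sigma>_def[abs_def] algebra_simps)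
    next
      fix x assume "x \<in> closed_domain b - {}"
      then have "\<bar>\<sigma> x\<bar> \<le> C" using \<sigma>C 2 by (simp add: closed_domain_simps)
      then have "(\<sigma> x)\<^sup>2 \<le> C\<^sup>2" by (metis abs_ge_zero power2_abs power_mono)
      moreover have "(C + 1)\<^sup>2 \<le> \<kappa>\<^sup>2" using \<kappa> C0 by (intro power_mono) auto
      ultimately show "1 \<le> q x + \<kappa>\<^sup>2 + - q x - (\<sigma> x)\<^sup>2" using C0 by (simp add: power2_eq_square algebra_simps)
    next
      show "\<exists>c\<in>closed_domain b. c > 0" using closed_domain_pos[OF potential_pos[OF pot]] .
      show "\<bar>\<sigma> x\<bar> \<le> C" if "x \<in> closed_domain b" for x using that \<sigma>C 2 by (simp add: closed_domain_simps)
    qed (fact closed_domain_nonneg closed_domain_down negligible_empty)+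
  qed (use 2 in \<open>auto simp: \<sigma>_def h0_def\<close>)
next
  case 1
  note ai = potential_absolutely_integrable[OF pot]
  define p where "p x = max (- q x) 0" for x
  have pai: "p absolutely_integrable_on {0..c}" if "c \<ge> 0" for c
  proof -
    have "(\<lambda>x. - q x) absolutely_integrable_on {0..c}"
      using absolutely_integrable_mult_continuous[OF ai[of c], of "\<lambda>_. - 1"] that 1 by (simp add: closed_domain_simps)
    then show ?thesis unfolding p_def[abs_def] by (intro absolutely_integrable_max_1) auto
  qed
  have pI: "p integrable_on {x..y}" if "0 \<le> x" "0 \<le> y" for x y
    using set_lebesgue_integral_eq_integral(1)[OF pai[OF that(2)]] by (rule integrable_on_subinterval) (use that in auto)
  define F where "F x = integral {0..x} p" for x
  have pF: "is_primitive c F p" if "c \<ge> 0" for c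
    unfolding F_def by (rule primitiveI[OF pai[OF that]]) auto
  have Fd: "F y - F x = integral {x..y} p" if "0 \<le> x" "x \<le> y" for x y
    using integral_unique[OF primitive_has_integral[OF pF[of y], of x y]] that by simp
  obtain K0 where K0: "\<And>y. y > 0 \<Longrightarrow> (LINT x:{y<..<y+1}|lebesgue. max (- q x) 0) \<le> K0"
    using pot 1 unfolding is_potential_def bdd_above_def by auto
  \<comment> \<open>The hypothesis bounds the unit integrals for y > 0 only; the integral over
    [0, 1] is added to cover x = 0.\<close>
  define K where "K = max K0 (integral {0..1} p)"
  have step: "F (x + 1) - F x \<le> K" if x: "x \<ge> 0" for x
  proof (cases "x = 0")
    case False
    have "p absolutely_integrable_on {x<..<x+1}"
      by (rule set_integrable_subset[OF pai[of "x+1"]]) (use x in auto)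
    then have "(LINT x:{x<..<x+1}|lebesgue. p x) = integral {x..x+1} p"
      by (simp add: set_lebesgue_integral_eq_integral(2) integral_open_interval_real)
    then show ?thesis using Fd[of x "x+1"] K0[of x] x False unfolding p_def[symmetric] K_def by simp
  qed (simp add: F_def K_def)
  have Fmono: "F x \<le> F y" if "0 \<le> x" "x \<le> y" for x y
    using Fd[OF that] integral_nonneg[OF pI[of x y]] that by (auto simp: p_def)
  have K: "K \<ge> 0" using step[of 0] Fmono[of 0 1] by simp
  have cF: "continuous_on {0..c} F" for c
    by (cases "c \<ge> 0") (auto intro: primitive_continuous[OF pF])
  have iF: "F integrable_on {x..y}" if "0 \<le> x" for x y
    by (rule integrable_continuous_real[OF continuous_on_subset[OF cF[of y]]]) (use that in auto)
  define g where "g x = F (x + 1) - F x" for x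
  define Fb where "Fb x = integral {x..x+1} F" for x
  have Fbb: "F x \<le> Fb x" "Fb x \<le> F x + K" if x: "x \<ge> 0" for x
  proof -
    have "integral {x..x+1} (\<lambda>_. F x) \<le> Fb x" unfolding Fb_def
      by (rule integral_le) (use x iF Fmono in auto)
    then show "F x \<le> Fb x" by simp
    have "Fb x \<le> integral {x..x+1} (\<lambda>_. F x + K)" unfolding Fb_def
    proof (rule integral_le)
      fix y assume y: "y \<in> {x..x+1}"
      then have "F y \<le> F (x + 1)" using x by (intro Fmono) auto
      then show "F y \<le> F x + K" using step[OF x] by simp
    qed (use x iF in auto)
    then show "Fb x \<le> F x + K" by simp
  qed
  have pFb: "is_primitive c Fb g" if c: "c \<ge> 0" for c
  proof (rule primitive_deriv)
    have "continuous_on {0..c} (\<lambda>x. F (x + 1))"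
      by (rule continuous_on_compose2[OF cF[of "c+1"]]) (auto intro!: continuous_intros)
    then show "continuous_on {0..c} g" unfolding g_def[abs_def] by (intro continuous_on_diff cF)
    fix x assume x: "x \<in> {0..c}"
    define H where "H y = integral {0..y} F" for y
    have H: "(H has_vector_derivative F y) (at y within {0..c+1})" if "y \<in> {0..c+1}" for y
      unfolding H_def by (rule integral_has_vector_derivative[OF cF that])
    have H1: "(H has_vector_derivative F x) (at x within {0..c})"
      by (rule has_vector_derivative_within_subset[OF H]) (use x in auto)
    have "((\<lambda>y. y + 1) has_vector_derivative 1) (at x within {0..c})"
      by (auto intro!: derivative_eq_intros)
    moreover have "(H has_vector_derivative F (x + 1)) (at (x + 1) within (\<lambda>y. y + 1) ` {0..c})"
      by (rule has_vector_derivative_within_subset[OF H]) (use x in auto)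
    ultimately have H2: "((H \<circ> (\<lambda>y. y + 1)) has_vector_derivative (1 *\<^sub>R F (x + 1))) (at x within {0..c})"
      by (rule vector_diff_chain_within)
    have "((\<lambda>y. H (y + 1) - H y) has_vector_derivative g x) (at x within {0..c})"
      using has_vector_derivative_diff[OF H2 H1] by (simp add: g_def o_def)
    then show "(Fb has_vector_derivative g x) (at x within {0..c})"
    proof (rule has_vector_derivative_transform[OF x, rotated])
      fix y assume y: "y \<in> {0..c}"
      have "H y + Fb y = H (y + 1)" unfolding H_def Fb_def
        by (rule Henstock_Kurzweil_Integration.integral_combine) (use y iF in auto)
      then show "Fb y = H (y + 1) - H y" by simp
    qed
  qed
  \<comment> \<open>In \<sigma>' = p - g the term p cancels the negative part of q, and g is at most
    K. As F is nondecreasing and rises by at most K per unit length, \<sigma> lies between - K and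
    0.\<close>
  define \<sigma> where "\<sigma> x = F x - Fb x" for x
  have \<sigma>b: "\<sigma> x \<le> 0" "\<bar>\<sigma> x\<bar> \<le> K" if "x \<ge> 0" for x using Fbb[OF that] K by (auto simp: \<sigma>_def)
  show ?thesis
  proof (rule that[of K \<sigma> "\<lambda>x. p x - g x", OF K])
    fix \<kappa> assume \<kappa>: "\<kappa> \<ge> K + 1"
    show "quasi_derivative (closed_domain b) (\<lambda>x. q x + \<kappa>\<^sup>2) \<sigma> (\<lambda>x. p x - g x) {} K"
    proof
      fix c assume c: "c \<in> closed_domain b"
      then show "is_primitive c \<sigma> (\<lambda>x. p x - g x)"
        unfolding \<sigma>_def[abs_def] using 1 by (intro primitive_diff pF pFb) (auto simp: closed_domain_simps)
    next
      fix x assume "x \<in> closed_domain b - {}"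
      then have x: "x \<ge> 0" using 1 by (simp add: closed_domain_simps)
      have "(\<sigma> x)\<^sup>2 \<le> K\<^sup>2" using \<sigma>b(2)[OF x] by (metis abs_ge_zero power2_abs power_mono)
      moreover have "(K + 1)\<^sup>2 \<le> \<kappa>\<^sup>2" using \<kappa> K by (intro power_mono) auto
      moreover have "q x + p x \<ge> 0" "g x \<le> K" using step[OF x] by (auto simp: p_def g_def)
      ultimately show "1 \<le> q x + \<kappa>\<^sup>2 + (p x - g x) - (\<sigma> x)\<^sup>2" using K by (simp add: power2_eq_square algebra_simps)
    next
      show "\<exists>c\<in>closed_domain b. c > 0" using closed_domain_pos[OF potential_pos[OF pot]] .
      show "\<bar>\<sigma> x\<bar> \<le> K" if "x \<in> closed_domain b" for x using that \<sigma>b 1 by (simp add: closed_domain_simps)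
    qed (fact closed_domain_nonneg closed_domain_down negligible_empty)+
  qed (use 1 \<sigma>b in auto)
qed

section \<open>Real Weyl solutions: existence and sign\<close>

definition real_end :: "ereal \<Rightarrow> ereal option \<Rightarrow> (real \<Rightarrow> real) \<Rightarrow> (real \<Rightarrow> real) \<Rightarrow> bool" where
  "real_end b h u v \<longleftrightarrow>
     (case h of
        None \<Rightarrow> set_integrable lebesgue {0<..} (\<lambda>x. (u x)\<^sup>2)
      | Some h' \<Rightarrow>
          (if h' = \<infinity> then u (real_of_ereal b) = 0
           else v (real_of_ereal b) + real_of_ereal h' * u (real_of_ereal b) = 0))"

text \<open>If the energy is \<delta> > 0 at some point, it stays at least \<delta> from there on.
  Because \<sigma> <= 0, this forces u v >= \<delta>, that is (u^2)' >= 2 \<delta>, so u^2 is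
  bounded below by a positive constant far out and is not integrable.\<close>

lemma (in quasi_derivative) square_integrable_imp_energy_nonpos:
  assumes D: "D = {0..}" and \<sigma>0: "\<And>x. x \<ge> 0 \<Longrightarrow> \<sigma> x \<le> 0" and u: "\<And>c. c \<in> D \<Longrightarrow> is_real_sol c Q u v"
    and L2: "set_integrable lebesgue {0<..} (\<lambda>x. (u x)\<^sup>2)" and x0: "x0 \<in> D"
  shows "energy u v x0 \<le> 0"
proof (rule ccontr)
  assume "\<not> energy u v x0 \<le> 0"
  define \<delta> where "\<delta> = energy u v x0"
  have \<delta>: "\<delta> > 0" using \<open>\<not> energy u v x0 \<le> 0\<close> by (simp add: \<delta>_def)
  have x00: "x0 \<ge> 0" using D0[OF x0] .
  have low: "2 * \<delta> \<le> (u y)\<^sup>2" if y: "y \<ge> x0 + 1" for y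
  proof -
    have yD: "y \<in> D" using D x00 y by auto
    note p = primitive_mult[OF real_sol_primitive(1)[OF u[OF yD]] real_sol_primitive(1)[OF u[OF yD]]]
    have I1: "((\<lambda>x. v x * u x + u x * v x) has_integral u y * u y - u x0 * u x0) {x0..y}"
      by (rule primitive_has_integral[OF p]) (use x00 y in auto)
    have I2: "((\<lambda>x. 2 * \<delta>) has_integral (2 * \<delta>) * (y - x0)) {x0..y}"
      using has_integral_const_real[of "2 * \<delta>" x0 y] y by (simp add: mult.commute)
    have I3: "2 * \<delta> \<le> v x * u x + u x * v x" if x: "x \<in> {x0..y}" for x
    proof -
      have "\<delta> \<le> energy u v x" unfolding \<delta>_def by (rule energy_mono[OF u[OF yD] yD]) (use x x00 in auto)
      moreover have "\<sigma> x * (u x)\<^sup>2 \<le> 0" using \<sigma>0[of x] x x00 by (simp add: mult_nonpos_nonneg)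
      ultimately show ?thesis by (simp add: energy_def power2_eq_square algebra_simps)
    qed
    have "(2 * \<delta>) * (y - x0) \<le> u y * u y - u x0 * u x0" by (rule has_integral_le[OF I2 I1 I3])
    moreover have "(2 * \<delta>) * 1 \<le> (2 * \<delta>) * (y - x0)" using y \<delta> by (intro mult_left_mono) auto
    moreover have "0 \<le> u x0 * u x0" by simp
    ultimately show ?thesis unfolding power2_eq_square by linarith
  qed
  have i: "(\<lambda>x. (u x)\<^sup>2) integrable_on {0<..}" using set_lebesgue_integral_eq_integral(1)[OF L2] .
  define T where "T = integral {0<..} (\<lambda>x. (u x)\<^sup>2)"
  have "2 * \<delta> * real n \<le> T" for n
  proof -
    have "continuous_on {x0+1..x0+1+real n} u"
      by (rule continuous_on_subset[OF real_sol_continuous(1)[OF u[of "x0+1+real n"]]]) (use x00 D in auto)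
    then have i2: "(\<lambda>x. (u x)\<^sup>2) integrable_on {x0+1..x0+1+real n}"
      by (intro integrable_continuous_real continuous_intros)
    have "2 * \<delta> * real n = integral {x0+1..x0+1+real n} (\<lambda>_. 2 * \<delta>)" by simp
    also have "\<dots> \<le> integral {x0+1..x0+1+real n} (\<lambda>x. (u x)\<^sup>2)"
      by (rule integral_le[OF _ i2]) (use low in auto)
    also have "\<dots> \<le> T" unfolding T_def
      by (rule integral_subset_le[OF _ i2 i]) (use x00 in auto)
    finally show ?thesis .
  qed
  moreover obtain n where "T / (2 * \<delta>) < real n" using reals_Archimedean2 by blast
  then have "T < 2 * \<delta> * real n" using \<delta> by (simp add: field_simps)
  ultimately show False by (meson not_le)
qed

text \<open>As the energy at n is at most 0, \<open>energy_growth\<close> bounds the integral of u^2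
  over [0, n] by minus the energy at 0, uniformly in n.\<close>

lemma (in quasi_derivative) energy_nonpos_imp_square_integrable:
  assumes D: "D = {0..}" and u: "\<And>c. c \<in> D \<Longrightarrow> is_real_sol c Q u v" and le: "\<And>x. x \<in> D \<Longrightarrow> energy u v x \<le> 0"
  shows "set_integrable lebesgue {0<..} (\<lambda>x. (u x)\<^sup>2)"
proof -
  have cu: "continuous_on {0..c} (\<lambda>x. (u x)\<^sup>2)" for c
    by (cases "c \<ge> 0") (auto intro!: continuous_intros real_sol_continuous(1)[OF u] simp: D)
  define f where "f n x = (if x \<in> {0..real n} then (u x)\<^sup>2 else 0)" for n :: nat and x
  have fi: "(f n has_integral integral {0..real n} (\<lambda>x. (u x)\<^sup>2)) {0..}" for n
    unfolding f_def by (subst has_integral_restrict) (auto intro!: integrable_integral integrable_continuous_real cu)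
  have "(\<lambda>x. (u x)\<^sup>2) integrable_on {0..}"
  proof (rule conjunct1[OF monotone_convergence_increasing[of f]])
    show "f n integrable_on {0..}" for n using fi by blast
    show "f k x \<le> f (Suc k) x" for k x by (auto simp: f_def)
    show "(\<lambda>k. f k x) \<longlonglongrightarrow> (u x)\<^sup>2" if "x \<in> {0..}" for x
    proof -
      obtain k where "x \<le> real k" using real_arch_simple by blast
      then have "\<forall>\<^sub>F n in sequentially. f n x = (u x)\<^sup>2"
        using that by (intro eventually_sequentiallyI[of k]) (auto simp: f_def)
      then show ?thesis by (rule tendsto_eventually)
    qed
    have "\<bar>integral {0..} (f n)\<bar> \<le> - energy u v 0" for n
    proof -
      have nD: "real n \<in> D" by (simp add: D)
      have "continuous_on {0..real n} (\<lambda>t. (v t + \<sigma> t * u t)\<^sup>2 + (u t)\<^sup>2)"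
        using real_sol_continuous[OF u[OF nD]] primitive_continuous[OF \<sigma>[OF nD]] by (intro continuous_intros)
      then have "integral {0..real n} (\<lambda>x. (u x)\<^sup>2) \<le> integral {0..real n} (\<lambda>t. (v t + \<sigma> t * u t)\<^sup>2 + (u t)\<^sup>2)"
        by (intro integral_le integrable_continuous_real cu) auto
      also have "\<dots> \<le> energy u v (real n) - energy u v 0" by (rule energy_growth[OF u[OF nD] nD]) auto
      also have "\<dots> \<le> - energy u v 0" using le[OF nD] by simp
      finally have "integral {0..real n} (\<lambda>x. (u x)\<^sup>2) \<le> - energy u v 0" .
      moreover have "0 \<le> integral {0..real n} (\<lambda>x. (u x)\<^sup>2)" by (rule integral_nonneg_total) simp
      moreover have "integral {0..} (f n) = integral {0..real n} (\<lambda>x. (u x)\<^sup>2)" using fi by (rule integral_unique)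
      ultimately show ?thesis by simp
    qed
    then show "bounded (range (\<lambda>k. integral {0..} (f k)))" by (auto simp: bounded_real)
  qed
  then have "(\<lambda>x. (u x)\<^sup>2) absolutely_integrable_on {0..}"
    by (rule nonnegative_absolutely_integrable_1) simp
  then show ?thesis by (rule set_integrable_subset) auto
qed

text \<open>The same \<sigma> serves all large \<kappa>, so \<open>C\<close> does not depend on
  \<kappa>. This uniformity is what permits \<kappa> to tend to infinity later.\<close>

lemma real_weyl:
  assumes pot: "is_potential q b h"
  obtains C where "C \<ge> 0" 
    "\<And>\<kappa> u v. \<lbrakk>\<kappa> \<ge> C + 1; \<And>c. c \<in> closed_domain b \<Longrightarrow> is_real_sol c (\<lambda>x. q x + \<kappa>\<^sup>2) u v; real_end b h u v\<rbrakk> \<Longrightarrow>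
       (\<forall>x\<in>closed_domain b. u x = 0) \<or> 
       (u 0 \<noteq> 0 \<and> (\<forall>x\<in>closed_domain b. u x / u 0 \<ge> 0 \<and> v x / u 0 \<le> C * (u x / u 0)))"
    "\<And>\<kappa>. \<kappa> \<ge> C + 1 \<Longrightarrow> \<exists>u v. (\<forall>c \<in> closed_domain b. is_real_sol c (\<lambda>x. q x + \<kappa>\<^sup>2) u v) \<and> real_end b h u v \<and>
        \<not> (\<forall>x\<in>closed_domain b. u x = 0)"
proof -
  note ai = potential_absolutely_integrable[OF pot]
  have aiQ: "(\<lambda>x. q x + \<kappa>\<^sup>2) absolutely_integrable_on {0..c}" if "c \<in> closed_domain b" for c \<kappa>
    by (intro set_integral_add ai that) auto
  from potential_quasi_derivative[OF pot] obtain C \<sigma> s where C: "C \<ge> 0" 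
    and qu: "\<And>\<kappa>. \<kappa> \<ge> C + 1 \<Longrightarrow> quasi_derivative (closed_domain b) (\<lambda>x. q x + \<kappa>\<^sup>2) \<sigma> s {} C"
    and \<sigma>inf: "b = \<infinity> \<Longrightarrow> \<forall>x\<ge>0. \<sigma> x \<le> 0" 
    and \<sigma>fin: "\<And>r. b \<noteq> \<infinity> \<Longrightarrow> h = Some (ereal r) \<Longrightarrow> \<sigma> (real_of_ereal b) = r" by blast
  show ?thesis
  proof (rule that[OF C])
    fix \<kappa> u v assume \<kappa>: "\<kappa> \<ge> C + 1" and u: "\<And>c. c \<in> closed_domain b \<Longrightarrow> is_real_sol c (\<lambda>x. q x + \<kappa>\<^sup>2) u v"
      and e: "real_end b h u v"
    interpret quasi_derivative "closed_domain b" "\<lambda>x. q x + \<kappa>\<^sup>2" \<sigma> s "{}" C by (rule qu[OF \<kappa>])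
    show "(\<forall>x\<in>closed_domain b. u x = 0) \<or> 
       (u 0 \<noteq> 0 \<and> (\<forall>x\<in>closed_domain b. u x / u 0 \<ge> 0 \<and> v x / u 0 \<le> C * (u x / u 0)))"
    proof (rule sign_alternative[OF u])
      fix x assume x: "x \<in> closed_domain b"
      show "energy u v x \<le> 0"
      proof (cases rule: potential_cases[OF pot])
        case 1
        show ?thesis
          by (rule square_integrable_imp_energy_nonpos[OF _ _ u _ x]) (use 1 \<sigma>inf e in \<open>auto simp: closed_domain_simps real_end_def\<close>)
      next
        case (2 r h')
        have r: "r \<in> closed_domain b" using 2 by (simp add: closed_domain_simps)
        \<comment> \<open>Since \<sigma>(b) is the boundary parameter, the end condition says that
          u(b) = 0 or w(b) = 0.\<close>
        have "energy u v r = 0"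
        proof (cases h')
          case (real k)
          then show ?thesis using e 2 \<sigma>fin[of k] by (simp add: real_end_def energy_def)
        qed (use 2 e in \<open>auto simp: real_end_def energy_def\<close>)
        moreover have "energy u v x \<le> energy u v r"
          by (rule energy_mono[OF u[OF r] r]) (use x 2 in \<open>auto simp: closed_domain_simps\<close>)
        ultimately show ?thesis by simp
      qed
    qed
  next
    fix \<kappa> assume \<kappa>: "\<kappa> \<ge> C + 1"
    interpret quasi_derivative "closed_domain b" "\<lambda>x. q x + \<kappa>\<^sup>2" \<sigma> s "{}" C by (rule qu[OF \<kappa>])
    show "\<exists>u v. (\<forall>c \<in> closed_domain b. is_real_sol c (\<lambda>x. q x + \<kappa>\<^sup>2) u v) \<and> real_end b h u v \<and>
        \<not> (\<forall>x\<in>closed_domain b. u x = 0)"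
    proof (cases rule: potential_cases[OF pot])
      case 1
      obtain u v where u: "\<And>c. c \<in> closed_domain b \<Longrightarrow> is_real_sol c (\<lambda>x. q x + \<kappa>\<^sup>2) u v" 
        "\<And>x. x \<in> closed_domain b \<Longrightarrow> energy u v x \<le> 0" "\<not> (\<forall>x\<in>closed_domain b. u x = 0)"
        using exists_decaying[OF aiQ] by blast
      have "real_end b h u v"
        using energy_nonpos_imp_square_integrable[OF _ u(1,2)] 1 by (simp add: closed_domain_simps real_end_def)
      with u show ?thesis by blast
    next
      case (2 r h')
      obtain \<phi> \<phi>' where \<phi>: "\<phi> 0 = 1" "\<phi>' 0 = 0" "\<And>c. c \<in> closed_domain b \<Longrightarrow> is_real_sol c (\<lambda>x. q x + \<kappa>\<^sup>2) \<phi> \<phi>'"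
        using real_sol_exists[OF aiQ, of "closed_domain b" 1 0] by blast
      obtain \<theta> \<theta>' where \<theta>: "\<theta> 0 = 0" "\<theta>' 0 = 1" "\<And>c. c \<in> closed_domain b \<Longrightarrow> is_real_sol c (\<lambda>x. q x + \<kappa>\<^sup>2) \<theta> \<theta>'"
        using real_sol_exists[OF aiQ, of "closed_domain b" 0 1] by blast
      \<comment> \<open>The end condition is one linear equation on the two-dimensional solution
        space and so has a nonzero solution.\<close>
      define L where "L u v = (if h' = \<infinity> then u r else v r + real_of_ereal h' * u r)" for u v :: "real \<Rightarrow> real"
      have ex: "\<exists>\<alpha> \<beta>. \<alpha> * L \<phi> \<phi>' + \<beta> * L \<theta> \<theta>' = 0 \<and> (\<alpha> \<noteq> 0 \<or> \<beta> \<noteq> 0)"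
      proof (cases "L \<phi> \<phi>' = 0")
        case True then show ?thesis by (intro exI[of _ 1] exI[of _ 0]) auto
      next
        case False then show ?thesis by (intro exI[of _ "L \<theta> \<theta>'"] exI[of _ "- L \<phi> \<phi>'"]) auto
      qed
      then obtain \<alpha> \<beta> where ab: "\<alpha> * L \<phi> \<phi>' + \<beta> * L \<theta> \<theta>' = 0" "\<alpha> \<noteq> 0 \<or> \<beta> \<noteq> 0" by blast
      define u v where "u x = \<alpha> * \<phi> x + \<beta> * \<theta> x" and "v x = \<alpha> * \<phi>' x + \<beta> * \<theta>' x" for x
      have s: "is_real_sol c (\<lambda>x. q x + \<kappa>\<^sup>2) u v" if "c \<in> closed_domain b" for c
        unfolding u_def[abs_def] v_def[abs_def] by (rule real_sol_linear[OF \<phi>(3) \<theta>(3)]) (use that in auto)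
      have "L u v = 0" using ab(1) by (auto simp: L_def u_def v_def algebra_simps split: if_splits)
      then have "real_end b h u v" using 2 by (auto simp: real_end_def L_def split: if_splits)
      moreover have "\<not> (\<forall>x\<in>closed_domain b. u x = 0)"
      proof
        assume z: "\<forall>x\<in>closed_domain b. u x = 0"
        have r: "r \<in> closed_domain b" "0 < r" using 2 by (auto simp: closed_domain_simps)
        have "v 0 = 0" by (rule real_sol_zero_imp_deriv_zero[OF s[OF r(1)] r(2)]) (use z Ddown[OF r(1)] in auto)
        moreover have "u 0 = 0" using z zero_mem by blast
        ultimately show False using ab(2) \<phi> \<theta> by (simp add: u_def v_def)
      qed
      ultimately show ?thesis using s by blast
    qed
  qed
qed

section \<open>From complex Weyl solutions to real ones and back\<close>

lemma weyl_solution_parts: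
  assumes pot: "is_potential q b h" and W: "is_weyl_solution q b h (- (complex_of_real \<kappa>)\<^sup>2) u v"
  shows "c \<in> closed_domain b \<Longrightarrow> is_real_sol c (\<lambda>x. q x + \<kappa>\<^sup>2) (\<lambda>x. Re (u x)) (\<lambda>x. Re (v x))"
    "c \<in> closed_domain b \<Longrightarrow> is_real_sol c (\<lambda>x. q x + \<kappa>\<^sup>2) (\<lambda>x. Im (u x)) (\<lambda>x. Im (v x))"
    "real_end b h (\<lambda>x. Re (u x)) (\<lambda>x. Re (v x))" "real_end b h (\<lambda>x. Im (u x)) (\<lambda>x. Im (v x))"
proof -
  let ?Q = "\<lambda>x. q x + \<kappa>\<^sup>2"
  have S: "is_solution q b (- (complex_of_real \<kappa>)\<^sup>2) u v" and E: "end_condition b h u v" 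
    using W by (auto simp: is_weyl_solution_def)
  have du: "\<And>x. x \<in> closed_domain b \<Longrightarrow> (u has_vector_derivative v x) (at x within closed_domain b)"
    and acv: "\<And>c. c \<in> closed_domain b \<Longrightarrow> abs_continuous_on {0..c} v"
    and ae: "AE x in lebesgue. x \<in> einterval 0 b \<longrightarrow>
        (\<exists>w. (v has_vector_derivative w) (at x) \<and> - w + of_real (q x) * u x = - (complex_of_real \<kappa>)\<^sup>2 * u x)"
    using S unfolding is_solution_def by blast+
  from ae obtain N where N: "negligible N" 
    "{x. \<not> (x \<in> einterval 0 b \<longrightarrow>
        (\<exists>w. (v has_vector_derivative w) (at x) \<and> - w + of_real (q x) * u x = - (complex_of_real \<kappa>)\<^sup>2 * u x))} \<subseteq> N"
    unfolding eventually_ae_filter_negligible by blast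
  have dv: "(v has_vector_derivative (complex_of_real (?Q x) * u x)) (at x)" if "x \<in> einterval 0 b - N" for x
  proof -
    from N(2) that obtain w where w: "(v has_vector_derivative w) (at x)" "- w + of_real (q x) * u x = - (complex_of_real \<kappa>)\<^sup>2 * u x"
      by blast
    then have "w = complex_of_real (?Q x) * u x" by (simp add: algebra_simps)
    with w show ?thesis by simp
  qed
  have "is_real_sol c ?Q (\<lambda>x. Re (u x)) (\<lambda>x. Re (v x)) \<and> is_real_sol c ?Q (\<lambda>x. Im (u x)) (\<lambda>x. Im (v x))" if c: "c \<in> closed_domain b" for c
  proof -
    have sub: "{0..c} \<subseteq> closed_domain b" using closed_domain_down[OF c] by auto
    have sub2: "{0<..<c} \<subseteq> einterval 0 b"
      using c less_le_trans[of _ "ereal c" b] by (auto simp: einterval_def closed_domain_def)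
    have du': "(u has_vector_derivative v x) (at x within {0..c})" if "x \<in> {0..c}" for x
      by (rule has_vector_derivative_within_subset[OF du sub]) (use sub that in auto)
    have cu: "continuous_on {0..c} u" 
      using du' has_vector_derivative_continuous unfolding continuous_on_eq_continuous_within by blast
    have Qai: "?Q absolutely_integrable_on {0..c}"
      by (intro set_integral_add potential_absolutely_integrable[OF pot c]) auto
    \<comment> \<open>Absolute continuity of v is what turns the almost-everywhere equation into an
      integral identity.\<close>
    have hi: "((\<lambda>x. complex_of_real (?Q x) * u x) has_integral (v x - v 0)) {0..x}" if x: "x \<in> {0..c}" for x
      by (rule abs_continuous_on_has_integral[OF abs_continuous_on_subset[OF acv[OF c]] _ N(1) dv]) 
        (use x sub2 in auto)
    have cRI: "continuous_on {0..c} (\<lambda>x. Re (u x))" "continuous_on {0..c} (\<lambda>x. Im (u x))"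
      using cu by (auto intro: continuous_intros)
    have pv: "is_primitive c (\<lambda>x. Re (v x)) (\<lambda>x. ?Q x * Re (u x))" "is_primitive c (\<lambda>x. Im (v x)) (\<lambda>x. ?Q x * Im (u x))"
      unfolding is_primitive_def using absolutely_integrable_mult_continuous[OF Qai] cRI
        has_integral_Re[OF hi] has_integral_Im[OF hi] by auto
    have "is_primitive c (\<lambda>x. Re (u x)) (\<lambda>x. Re (v x))"
      by (rule primitive_deriv[OF primitive_continuous[OF pv(1)]]) 
        (rule bounded_linear.has_vector_derivative[OF bounded_linear_Re du'])
    moreover have "is_primitive c (\<lambda>x. Im (u x)) (\<lambda>x. Im (v x))"
      by (rule primitive_deriv[OF primitive_continuous[OF pv(2)]]) 
        (rule bounded_linear.has_vector_derivative[OF bounded_linear_Im du'])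
    ultimately show ?thesis using pv by (simp add: is_real_sol_def)
  qed
  note parts = this
  then show "c \<in> closed_domain b \<Longrightarrow> is_real_sol c (\<lambda>x. q x + \<kappa>\<^sup>2) (\<lambda>x. Re (u x)) (\<lambda>x. Re (v x))"
    "c \<in> closed_domain b \<Longrightarrow> is_real_sol c (\<lambda>x. q x + \<kappa>\<^sup>2) (\<lambda>x. Im (u x)) (\<lambda>x. Im (v x))" by auto
  show "real_end b h (\<lambda>x. Re (u x)) (\<lambda>x. Re (v x))" "real_end b h (\<lambda>x. Im (u x)) (\<lambda>x. Im (v x))"
  proof -
    have "real_end b h (\<lambda>x. Re (u x)) (\<lambda>x. Re (v x)) \<and> real_end b h (\<lambda>x. Im (u x)) (\<lambda>x. Im (v x))"
    proof (cases h)
      case (Some h')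
      have eq: "v r + complex_of_real k * u r = 0 \<longleftrightarrow> Re (v r) + k * Re (u r) = 0 \<and> Im (v r) + k * Im (u r) = 0" for k r
        by (simp add: complex_eq_iff)
      show ?thesis using E Some by (auto simp: end_condition_def real_end_def eq split: if_splits)
    next
      case None
      then have b: "b = \<infinity>" using pot by (auto simp: is_potential_def)
      have "set_integrable lebesgue {0<..} (\<lambda>x. (norm (u x))\<^sup>2)"
        using E None by (simp add: end_condition_def)
      then have i: "(\<lambda>x. (norm (u x))\<^sup>2) integrable_on {0<..}" by (rule set_lebesgue_integral_eq_integral(1))
      have cu: "continuous_on {0<..} u"
        unfolding continuous_on_eq_continuous_within
      proof
        fix x :: real assume "x \<in> {0<..}"
        then have "continuous (at x within {0..}) u"
          using has_vector_derivative_continuous[OF du[of x]] b by (simp add: closed_domain_simps)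
        then show "continuous (at x within {0<..}) u" by (rule continuous_within_subset) auto
      qed
      have sq: "(Re z)\<^sup>2 \<le> (norm z)\<^sup>2" "(Im z)\<^sup>2 \<le> (norm z)\<^sup>2" for z :: complex
        by (simp_all add: cmod_power2)
      have "set_integrable lebesgue {0<..} (\<lambda>x. (f (u x))\<^sup>2)" if f: "f = Re \<or> f = Im" for f :: "complex \<Rightarrow> real"
      proof (rule measurable_bounded_by_integrable_imp_absolutely_integrable[OF _ _ i])
        have "continuous_on {0<..} (\<lambda>x. (f (u x))\<^sup>2)" using f cu by (auto intro!: continuous_intros)
        then show "(\<lambda>x. (f (u x))\<^sup>2) \<in> borel_measurable (lebesgue_on {0<..})"
          by (rule continuous_imp_measurable_on_sets_lebesgue) auto
      qed (use f sq in auto)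
      then show ?thesis using None by (auto simp: real_end_def)
    qed
    then show "real_end b h (\<lambda>x. Re (u x)) (\<lambda>x. Re (v x))" "real_end b h (\<lambda>x. Im (u x)) (\<lambda>x. Im (v x))" by auto
  qed
qed

text \<open>For b = \<infinity> square integrability survives by (k u + l u')^2 <= 2 k^2 u^2 + 2 l^2
  u'^2.\<close>

lemma real_end_linear:
  assumes pot: "is_potential q b h"
    and u: "real_end b h u v" "\<And>c. c \<in> closed_domain b \<Longrightarrow> is_real_sol c Q u v"
    and u': "real_end b h u' v'" "\<And>c. c \<in> closed_domain b \<Longrightarrow> is_real_sol c Q u' v'"
  shows "real_end b h (\<lambda>x. k * u x + l * u' x) (\<lambda>x. k * v x + l * v' x)"
proof (cases h)
  case (Some h')
  have "k * v r + l * v' r + H * (k * u r + l * u' r) = k * (v r + H * u r) + l * (v' r + H * u' r)" for H r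
    by (simp add: algebra_simps)
  then show ?thesis using u(1) u'(1) Some by (simp add: real_end_def split: if_splits)
next
  case None
  then have b: "b = \<infinity>" using pot by (auto simp: is_potential_def)
  have cont: "continuous_on {0<..} f" if "\<And>c. c \<in> closed_domain b \<Longrightarrow> continuous_on {0..c} f" for f :: "real \<Rightarrow> real"
    unfolding continuous_on_eq_continuous_at[OF open_greaterThan]
  proof
    fix x :: real assume x: "x \<in> {0<..}"
    have "continuous_on {0<..<x+1} f"
      by (rule continuous_on_subset[OF that[of "x+1"]]) (use x b in \<open>auto simp: closed_domain_simps\<close>)
    then show "continuous (at x) f"
      using x by (simp add: continuous_on_eq_continuous_at)
  qed
  have cu: "continuous_on {0<..} u" "continuous_on {0<..} u'"
    by (auto intro!: cont real_sol_continuous(1) u u')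
  have "(\<lambda>x. (u x)\<^sup>2) integrable_on {0<..}" "(\<lambda>x. (u' x)\<^sup>2) integrable_on {0<..}"
    using u(1) u'(1) None set_lebesgue_integral_eq_integral(1) unfolding real_end_def by fastforce+
  then have i: "(\<lambda>x. 2 * k\<^sup>2 * (u x)\<^sup>2 + 2 * l\<^sup>2 * (u' x)\<^sup>2) integrable_on {0<..}"
    by (intro integrable_add integrable_on_mult_right)
  have "(\<lambda>x. (k * u x + l * u' x)\<^sup>2) absolutely_integrable_on {0<..}"
  proof (rule measurable_bounded_by_integrable_imp_absolutely_integrable[OF _ _ i])
    have "continuous_on {0<..} (\<lambda>x. (k * u x + l * u' x)\<^sup>2)" using cu by (intro continuous_intros)
    then show "(\<lambda>x. (k * u x + l * u' x)\<^sup>2) \<in> borel_measurable (lebesgue_on {0<..})"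
      by (rule continuous_imp_measurable_on_sets_lebesgue) auto
    fix x
    have "0 \<le> (k * u x - l * u' x)\<^sup>2" by simp
    then have "(k * u x + l * u' x)\<^sup>2 \<le> 2 * k\<^sup>2 * (u x)\<^sup>2 + 2 * l\<^sup>2 * (u' x)\<^sup>2"
      by (simp add: power2_eq_square algebra_simps)
    then show "norm ((k * u x + l * u' x)\<^sup>2) \<le> 2 * k\<^sup>2 * (u x)\<^sup>2 + 2 * l\<^sup>2 * (u' x)\<^sup>2" by simp
  qed auto
  then show ?thesis using None by (simp add: real_end_def)
qed

lemma real_sol_is_weyl_solution:
  assumes pot: "is_potential q b h"
    and u: "\<And>c. c \<in> closed_domain b \<Longrightarrow> is_real_sol c (\<lambda>x. q x + \<kappa>\<^sup>2) u v" and e: "real_end b h u v"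
    and nz: "\<not> (\<forall>x\<in>closed_domain b. u x = 0)"
  shows "is_weyl_solution q b h (- (complex_of_real \<kappa>)\<^sup>2) (\<lambda>x. complex_of_real (u x)) (\<lambda>x. complex_of_real (v x))"
  unfolding is_weyl_solution_def is_solution_def
proof (intro conjI ballI)
  let ?Q = "\<lambda>x. q x + \<kappa>\<^sup>2"
  fix x assume x: "x \<in> closed_domain b"
  have "(u has_vector_derivative v x) (at x within closed_domain b)"
  proof (cases rule: potential_cases[OF pot])
    case (2 r h')
    then have r: "r \<in> closed_domain b" by (simp add: closed_domain_simps)
    show ?thesis
      using primitive_has_vector_derivative[OF real_sol_primitive(1)[OF u[OF r]] real_sol_continuous(2)[OF u[OF r]]] x 2
      by (simp add: closed_domain_simps)
  next
    case 1
    then have x0: "x \<ge> 0" and x1: "x + 1 \<in> closed_domain b" using x by (auto simp: closed_domain_simps)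
    have "(u has_vector_derivative v x) (at x within {0..x+1})"
      using primitive_has_vector_derivative[OF real_sol_primitive(1)[OF u[OF x1]] real_sol_continuous(2)[OF u[OF x1]]] x0 by simp
    moreover have "at x within {0..x+1} = at x within {0..}"
      by (rule at_within_nhd[of x "{..<x+1}"]) auto
    ultimately show ?thesis using 1 by (simp add: closed_domain_simps)
  qed
  then show "((\<lambda>x. complex_of_real (u x)) has_vector_derivative complex_of_real (v x)) (at x within closed_domain b)"
    by (intro has_vector_derivative_of_real) (simp add: has_real_derivative_iff_has_vector_derivative)
next
  fix c assume c: "c \<in> closed_domain b"
  show "abs_continuous_on {0..c} (\<lambda>x. complex_of_real (v x))"
    by (rule primitive_abs_continuous_on[OF real_sol_primitive(2)[OF u[OF c]]])
next
  let ?Q = "\<lambda>x. q x + \<kappa>\<^sup>2"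
  \<comment> \<open>Differentiability almost everywhere is known on bounded intervals; for b =
    \<infinity> the exceptional sets of the intervals (0, n) are united.\<close>
  have "\<exists>N. negligible N \<and> (\<forall>x. ereal x < b \<and> x < real n \<and> 0 < x \<and> x \<notin> N \<longrightarrow> (v has_vector_derivative (?Q x * u x)) (at x))" for n
  proof (cases rule: potential_cases[OF pot])
    case (2 r h')
    then have "r \<in> closed_domain b" by (simp add: closed_domain_simps)
    from primitive_ae_deriv[OF real_sol_primitive(2)[OF u[OF this]]]
    obtain N where "negligible N" "\<And>x. x \<in> {0<..<r} - N \<Longrightarrow> (v has_vector_derivative (?Q x * u x)) (at x)" by blast
    then show ?thesis using 2 by (intro exI[of _ N]) auto
  next
    case 1
    then have "real n \<in> closed_domain b" by (simp add: closed_domain_simps)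
    from primitive_ae_deriv[OF real_sol_primitive(2)[OF u[OF this]]]
    obtain N where "negligible N" "\<And>x. x \<in> {0<..<real n} - N \<Longrightarrow> (v has_vector_derivative (?Q x * u x)) (at x)" by blast
    then show ?thesis by (intro exI[of _ N]) auto
  qed
  then obtain N where N: "\<And>n. negligible (N n)" 
    "\<And>n x. ereal x < b \<Longrightarrow> x < real n \<Longrightarrow> 0 < x \<Longrightarrow> x \<notin> N n \<Longrightarrow> (v has_vector_derivative (?Q x * u x)) (at x)"
    by metis
  have "negligible (\<Union>n. N n)" using N(1) by (rule negligible_Union_nat)
  moreover have "{x. \<not> (x \<in> einterval 0 b \<longrightarrow>
        (\<exists>w. ((\<lambda>x. complex_of_real (v x)) has_vector_derivative w) (at x) \<and> 
          - w + of_real (q x) * complex_of_real (u x) = - (complex_of_real \<kappa>)\<^sup>2 * complex_of_real (u x)))} \<subseteq> (\<Union>n. N n)"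
  proof (rule subsetI, rule ccontr)
    fix x assume a: "x \<in> {x. \<not> (x \<in> einterval 0 b \<longrightarrow>
        (\<exists>w. ((\<lambda>x. complex_of_real (v x)) has_vector_derivative w) (at x) \<and> 
          - w + of_real (q x) * complex_of_real (u x) = - (complex_of_real \<kappa>)\<^sup>2 * complex_of_real (u x)))}"
      and b: "x \<notin> (\<Union>n. N n)"
    obtain n where n: "x < real n" using reals_Archimedean2 by blast
    from a have x: "ereal x < b" "0 < x" by (auto simp: einterval_def)
    have "(v has_vector_derivative (?Q x * u x)) (at x)" using N(2)[OF x(1) n x(2)] b by blast
    then have "((\<lambda>x. complex_of_real (v x)) has_vector_derivative complex_of_real (?Q x * u x)) (at x)"
      by (intro has_vector_derivative_of_real) (simp add: has_real_derivative_iff_has_vector_derivative)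
    moreover have "- complex_of_real (?Q x * u x) + of_real (q x) * complex_of_real (u x) = - (complex_of_real \<kappa>)\<^sup>2 * complex_of_real (u x)"
      by (simp add: algebra_simps)
    ultimately show False using a by blast
  qed
  ultimately show "AE x in lebesgue. x \<in> einterval 0 b \<longrightarrow>
        (\<exists>w. ((\<lambda>x. complex_of_real (v x)) has_vector_derivative w) (at x) \<and> 
          - w + of_real (q x) * complex_of_real (u x) = - (complex_of_real \<kappa>)\<^sup>2 * complex_of_real (u x))"
    unfolding eventually_ae_filter_negligible by blast
next
  show "\<exists>x\<in>closed_domain b. complex_of_real (u x) \<noteq> 0" using nz by auto
next
  show "end_condition b h (\<lambda>x. complex_of_real (u x)) (\<lambda>x. complex_of_real (v x))"
    using e unfolding end_condition_def real_end_def
    by (auto split: option.splits if_splits simp flip: of_real_mult of_real_add)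
qed

text \<open>The definite description is proper because the sign alternative gives uniqueness: if f
  solves the equation with the end condition, then f - f(0) u vanishes at 0 and hence identically.
  So f is a multiple of u, and f(0) = 0 only for f = 0.\<close>

lemma m_function_real:
  assumes pot: "is_potential q b h"
  obtains C where "C \<ge> 0" 
    "\<And>\<kappa>. \<kappa> \<ge> C + 1 \<Longrightarrow> \<exists>u v. u 0 = 1 \<and> (\<forall>c \<in> closed_domain b. is_real_sol c (\<lambda>x. q x + \<kappa>\<^sup>2) u v) \<and>
        (\<forall>x\<in>closed_domain b. 0 \<le> u x \<and> v x \<le> C * u x) \<and> 
        m_function q b h (- (complex_of_real \<kappa>)\<^sup>2) = complex_of_real (v 0)"
proof -
  from real_weyl[OF pot] obtain C where C: "C \<ge> 0" 
    and alt: "\<And>\<kappa> u v. \<lbrakk>\<kappa> \<ge> C + 1; \<And>c. c \<in> closed_domain b \<Longrightarrow> is_real_sol c (\<lambda>x. q x + \<kappa>\<^sup>2) u v; real_end b h u v\<rbrakk> \<Longrightarrow>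
       (\<forall>x\<in>closed_domain b. u x = 0) \<or> 
       (u 0 \<noteq> 0 \<and> (\<forall>x\<in>closed_domain b. u x / u 0 \<ge> 0 \<and> v x / u 0 \<le> C * (u x / u 0)))"
    and ex: "\<And>\<kappa>. \<kappa> \<ge> C + 1 \<Longrightarrow> \<exists>u v. (\<forall>c \<in> closed_domain b. is_real_sol c (\<lambda>x. q x + \<kappa>\<^sup>2) u v) \<and> real_end b h u v \<and>
        \<not> (\<forall>x\<in>closed_domain b. u x = 0)" by blast
  obtain c0 where c0: "c0 \<in> closed_domain b" "c0 > 0" using closed_domain_pos[OF potential_pos[OF pot]] by blast
  show ?thesis
  proof (rule that[OF C])
    fix \<kappa> assume \<kappa>: "\<kappa> \<ge> C + 1"
    let ?Q = "\<lambda>x. q x + \<kappa>\<^sup>2" and ?z = "- (complex_of_real \<kappa>)\<^sup>2"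
    obtain f g where fg: "\<And>c. c \<in> closed_domain b \<Longrightarrow> is_real_sol c ?Q f g" "real_end b h f g" 
      "\<not> (\<forall>x\<in>closed_domain b. f x = 0)" using ex[OF \<kappa>] by blast
    have f0: "f 0 \<noteq> 0" and fpos: "\<And>x. x \<in> closed_domain b \<Longrightarrow> f x / f 0 \<ge> 0 \<and> g x / f 0 \<le> C * (f x / f 0)"
      using alt[OF \<kappa> fg(1,2)] fg(3) by auto
    \<comment> \<open>The trivial second summands match the shape of the linearity lemmas.\<close>
    define u v where "u x = (1 / f 0) * f x + 0 * f x" and "v x = (1 / f 0) * g x + 0 * g x" for x
    have su: "is_real_sol c ?Q u v" if "c \<in> closed_domain b" for c
      unfolding u_def[abs_def] v_def[abs_def] by (rule real_sol_linear[OF fg(1) fg(1)]) (use that in auto)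
    have eu: "real_end b h u v"
      unfolding u_def[abs_def] v_def[abs_def] by (rule real_end_linear[OF pot fg(2,1) fg(2,1)])
    have u0: "u 0 = 1" using f0 by (simp add: u_def)
    have z0: "0 \<in> closed_domain b" using closed_domain_down[OF c0(1)] c0 by simp
    have one_dim: "g' 0 = f' 0 * v 0 \<and> (f' 0 = 0 \<longrightarrow> (\<forall>x\<in>closed_domain b. f' x = 0))" 
      if s: "\<And>c. c \<in> closed_domain b \<Longrightarrow> is_real_sol c ?Q f' g'" and e: "real_end b h f' g'" for f' g'
    proof -
      define F G where "F x = 1 * f' x + (- f' 0) * u x" and "G x = 1 * g' x + (- f' 0) * v x" for x
      have sF: "is_real_sol c ?Q F G" if "c \<in> closed_domain b" for c
        unfolding F_def[abs_def] G_def[abs_def] by (rule real_sol_linear[OF s[OF that] su[OF that]])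
      have eF: "real_end b h F G"
        unfolding F_def[abs_def] G_def[abs_def] by (rule real_end_linear[OF pot e s eu su])
      have "F 0 = 0" using u0 by (simp add: F_def)
      then have F0: "\<forall>x\<in>closed_domain b. F x = 0" using alt[OF \<kappa> sF eF] by blast
      have "G 0 = 0"
        by (rule real_sol_zero_imp_deriv_zero[OF sF[OF c0(1)] c0(2)]) (use F0 closed_domain_down[OF c0(1)] in simp)
      moreover have "f' 0 = 0 \<longrightarrow> (\<forall>x\<in>closed_domain b. f' x = 0)" using alt[OF \<kappa> s e] by blast
      ultimately show ?thesis by (simp add: G_def)
    qed
    have nz: "\<not> (\<forall>x\<in>closed_domain b. u x = 0)" using z0 u0 by force
    have "m_function q b h ?z = complex_of_real (v 0)"
      unfolding m_function_def
    proof (rule the_equality)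
      show "\<exists>u' v'. is_weyl_solution q b h ?z u' v' \<and> complex_of_real (v 0) = v' 0 / u' 0"
        using real_sol_is_weyl_solution[OF pot su eu nz] u0
        by (intro exI[of _ "\<lambda>x. complex_of_real (u x)"] exI[of _ "\<lambda>x. complex_of_real (v x)"]) simp
      fix w assume "\<exists>u' v'. is_weyl_solution q b h ?z u' v' \<and> w = v' 0 / u' 0"
      then obtain u' v' where W: "is_weyl_solution q b h ?z u' v'" and w: "w = v' 0 / u' 0" by blast
      note P = weyl_solution_parts[OF pot W]
      note R = one_dim[OF P(1,3)] and I = one_dim[OF P(2,4)]
      have "v' 0 = u' 0 * complex_of_real (v 0)" using R I by (simp add: complex_eq_iff)
      moreover have "u' 0 \<noteq> 0"
      proof
        assume "u' 0 = 0"
        then have "\<forall>x\<in>closed_domain b. u' x = 0" using R I by (simp add: complex_eq_iff)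
        then show False using W by (auto simp: is_weyl_solution_def)
      qed
      ultimately show "w = complex_of_real (v 0)" using w by simp
    qed
    moreover have "0 \<le> u x \<and> v x \<le> C * u x" if "x \<in> closed_domain b" for x
      using fpos[OF that] by (simp add: u_def v_def)
    ultimately show "\<exists>u v. u 0 = 1 \<and> (\<forall>c \<in> closed_domain b. is_real_sol c (\<lambda>x. q x + \<kappa>\<^sup>2) u v) \<and>
        (\<forall>x\<in>closed_domain b. 0 \<le> u x \<and> v x \<le> C * u x) \<and> 
        m_function q b h (- (complex_of_real \<kappa>)\<^sup>2) = complex_of_real (v 0)"
      using su u0 by blast
  qed
qed

section \<open>Comparison of m-functions\<close>

text \<open>With K the constant Wronskian, (u / \<psi>)' = K / \<psi>^2, whence u(a) = \<psi>(a) (1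
  + K I) with I the integral of 1 / \<psi>^2, of the order of exp(2 a \<kappa>) / \<kappa>. Then
  u(a) >= 0 says K >= - 1 / I. For the upper bound, \<psi>'(a) = - \<kappa> \<psi>(a) gives K =
  (v(a) + \<kappa> u(a)) \<psi>(a), which v(a) <= C u(a) bounds by a multiple of 1 + K I.\<close>

lemma exp_shape_comparison:
  assumes \<psi>: "is_real_sol a Q \<psi> \<psi>'" "\<psi> 0 = 1" "\<psi>' a = - \<kappa> * \<psi> a"
    and shape: "\<And>x. x \<in> {0..a} \<Longrightarrow> 9/10 * exp (- \<kappa> * x) \<le> \<psi> x \<and> \<psi> x \<le> 11/10 * exp (- \<kappa> * x)"
    and u: "is_real_sol a Q u v" "u 0 = 1" "u a \<ge> 0" "v a \<le> C * u a"
    and a: "a > 0" and C: "C \<ge> 0" and \<kappa>: "\<kappa> \<ge> 10 * C" "\<kappa> > 0" "exp (2 * a * \<kappa>) \<ge> 2"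
  shows "\<bar>v 0 - \<psi>' 0\<bar> \<le> 10 * \<kappa> * exp (- 2 * a * \<kappa>)"
proof -
  define K where "K = v 0 - \<psi>' 0"
  have pos: "\<psi> x > 0" if "x \<in> {0..a}" for x
    using shape[OF that] by (meson exp_gt_zero less_le_trans mult_pos_pos zero_less_divide_iff zero_less_numeral)
  have "is_primitive a (\<lambda>x. v x * \<psi> x - u x * \<psi>' x) (\<lambda>x. (Q x * u x * \<psi> x + v x * \<psi>' x) - (v x * \<psi>' x + u x * (Q x * \<psi> x)))"
    by (intro primitive_diff primitive_mult real_sol_primitive[OF \<psi>(1)] real_sol_primitive[OF u(1)])
  then have pW: "is_primitive a (\<lambda>x. v x * \<psi> x - u x * \<psi>' x) (\<lambda>x. 0)"
    by (rule primitive_cong) (auto simp: algebra_simps)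
  have W: "v x * \<psi> x - u x * \<psi>' x = K" if "x \<in> {0..a}" for x
    using primitive_eq[OF pW that] u(2) \<psi>(2) by (simp add: K_def)
  have dr: "((\<lambda>x. u x / \<psi> x) has_vector_derivative K * (1 / (\<psi> x)\<^sup>2)) (at x within {0..a})" if x: "x \<in> {0..a}" for x
  proof -
    have "(u has_real_derivative v x) (at x within {0..a})" "(\<psi> has_real_derivative \<psi>' x) (at x within {0..a})"
      using primitive_has_vector_derivative[OF real_sol_primitive(1)[OF u(1)] real_sol_continuous(2)[OF u(1)] x]
        primitive_has_vector_derivative[OF real_sol_primitive(1)[OF \<psi>(1)] real_sol_continuous(2)[OF \<psi>(1)] x]
      by (auto simp: has_real_derivative_iff_has_vector_derivative)
    then have "((\<lambda>x. u x / \<psi> x) has_real_derivative ((v x * \<psi> x - u x * \<psi>' x) / (\<psi> x * \<psi> x))) (at x within {0..a})"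
      using pos[OF x] by (intro DERIV_divide) auto
    then show ?thesis using W[OF x] by (simp add: has_real_derivative_iff_has_vector_derivative power2_eq_square)
  qed
  define I where "I = integral {0..a} (\<lambda>x. 1 / (\<psi> x)\<^sup>2)"
  have ci: "continuous_on {0..a} (\<lambda>x. 1 / (\<psi> x)\<^sup>2)"
    using pos real_sol_continuous(1)[OF \<psi>(1)] by (intro continuous_intros) force+
  have hI: "((\<lambda>x. 1 / (\<psi> x)\<^sup>2) has_integral I) {0..a}"
    unfolding I_def by (intro integrable_integral integrable_continuous_real ci)
  have "((\<lambda>x. K * (1 / (\<psi> x)\<^sup>2)) has_integral (u a / \<psi> a - u 0 / \<psi> 0)) {0..a}"
    using a by (intro fundamental_theorem_of_calculus dr) auto
  moreover have "((\<lambda>x. K * (1 / (\<psi> x)\<^sup>2)) has_integral (K * I)) {0..a}" by (rule has_integral_mult_right[OF hI])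
  ultimately have "u a / \<psi> a - u 0 / \<psi> 0 = K * I" by (rule has_integral_unique)
  then have ua: "u a = \<psi> a * (1 + K * I)" using u(2) \<psi>(2) pos[of a] a by (simp add: field_simps)
  have ei: "((\<lambda>x. exp (2 * \<kappa> * x)) has_integral (exp (2 * \<kappa> * a) / (2 * \<kappa>) - exp (2 * \<kappa> * 0) / (2 * \<kappa>))) {0..a}"
    using a \<kappa> by (intro fundamental_theorem_of_calculus)
      (auto intro!: derivative_eq_intros simp flip: has_real_derivative_iff_has_vector_derivative)
  define X where "X = exp (2 * a * \<kappa>)"
  have X: "X \<ge> 2" using \<kappa>(3) by (simp add: X_def)
  have Xi: "exp (- 2 * a * \<kappa>) = 1 / X" by (simp add: X_def exp_minus field_simps)
  have ei': "((\<lambda>x. exp (2 * \<kappa> * x)) has_integral ((X - 1) / (2 * \<kappa>))) {0..a}"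
    using ei by (simp add: X_def diff_divide_distrib mult_ac)
  have sq: "81/100 * exp (- 2 * \<kappa> * x) \<le> (\<psi> x)\<^sup>2" "(\<psi> x)\<^sup>2 \<le> 121/100 * exp (- 2 * \<kappa> * x)" if x: "x \<in> {0..a}" for x
  proof -
    have e2: "exp (- 2 * \<kappa> * x) = (exp (- \<kappa> * x))\<^sup>2" by (simp add: power2_eq_square flip: exp_add)
    have "(9/10 * exp (- \<kappa> * x))\<^sup>2 \<le> (\<psi> x)\<^sup>2" "(\<psi> x)\<^sup>2 \<le> (11/10 * exp (- \<kappa> * x))\<^sup>2"
      using shape[OF x] pos[OF x] by (auto intro!: power_mono)
    then show "81/100 * exp (- 2 * \<kappa> * x) \<le> (\<psi> x)\<^sup>2" "(\<psi> x)\<^sup>2 \<le> 121/100 * exp (- 2 * \<kappa> * x)"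
      unfolding e2 by (simp_all add: power_mult_distrib power_divide)
  qed
  have inv: "100/121 * exp (2 * \<kappa> * x) \<le> 1 / (\<psi> x)\<^sup>2" "1 / (\<psi> x)\<^sup>2 \<le> 100/81 * exp (2 * \<kappa> * x)" if x: "x \<in> {0..a}" for x
    using sq[OF x] pos[OF x] by (simp_all add: field_simps exp_minus)
  have Ilo: "100/121 * ((X - 1) / (2 * \<kappa>)) \<le> I"
    by (rule has_integral_le[OF has_integral_mult_right[OF ei'] hI inv(1)])
  have Ihi: "I \<le> 100/81 * ((X - 1) / (2 * \<kappa>))"
    by (rule has_integral_le[OF hI has_integral_mult_right[OF ei'] inv(2)])
  have Ipos: "I > 0" using Ilo X \<kappa> by (smt (verit) divide_pos_pos mult_pos_pos)
  have "0 \<le> 1 + K * I" using u(3) ua pos[of a] a by (simp add: zero_le_mult_iff)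
  have low: "- K \<le> 10 * \<kappa> * (1 / X)"
  proof (cases "K \<ge> 0")
    case True
    moreover have "0 \<le> 10 * \<kappa> * (1 / X)" using X \<kappa> by simp
    ultimately show ?thesis by linarith
  next
    case False
    have "(- K) * (100/121 * ((X - 1) / (2 * \<kappa>))) \<le> (- K) * I" using False Ilo by (intro mult_left_mono) auto
    also have "\<dots> \<le> 1" using \<open>0 \<le> 1 + K * I\<close> by simp
    finally have 1: "(- K) * (100 * (X - 1)) \<le> 242 * \<kappa>" using \<kappa> by (simp add: field_simps)
    have "(- K) * (100 * (X / 2)) \<le> (- K) * (100 * (X - 1))" using False X by (intro mult_left_mono) auto
    with 1 have "(- K) * (50 * X) \<le> 242 * \<kappa>" by simp
    then show ?thesis using X \<kappa> by (simp add: field_simps)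
  qed
  have high: "K \<le> 10 * \<kappa> * (1 / X)"
  proof (cases "K \<le> 0")
    case True
    moreover have "0 \<le> 10 * \<kappa> * (1 / X)" using X \<kappa> by simp
    ultimately show ?thesis by linarith
  next
    case False
    define P where "P = (\<psi> a)\<^sup>2"
    have P: "P \<le> 121/100 * (1 / X)" "P > 0" 
      using sq(2)[of a] a pos[of a] Xi by (auto simp: P_def mult_ac)
    have "K = (v a + \<kappa> * u a) * \<psi> a" using W[of a] a \<psi>(3) by (simp add: algebra_simps)
    also have "\<dots> \<le> ((C + \<kappa>) * u a) * \<psi> a" using u(4) pos[of a] a by (intro mult_right_mono) (auto simp: algebra_simps)
    also have "\<dots> = (C + \<kappa>) * P * (1 + K * I)" by (simp add: ua P_def power2_eq_square)
    also have "\<dots> \<le> (11/10 * \<kappa>) * (121/100 * (1 / X)) * (1 + K * (100/81 * (X / (2 * \<kappa>))))"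
    proof (intro mult_mono)
      show "C + \<kappa> \<le> 11/10 * \<kappa>" using \<kappa> by simp
      have "(X - 1) / (2 * \<kappa>) \<le> X / (2 * \<kappa>)" using \<kappa>(2) by (intro divide_right_mono) auto
      then have "I \<le> 100/81 * (X / (2 * \<kappa>))" using Ihi by linarith
      then have "K * I \<le> K * (100/81 * (X / (2 * \<kappa>)))" using False by (intro mult_left_mono) auto
      then show "1 + K * I \<le> 1 + K * (100/81 * (X / (2 * \<kappa>)))" by simp
    qed (use P C \<kappa> X False Ipos in auto)
    \<comment> \<open>The ten percent in \<open>shape\<close> and in \<kappa> >= 10 C are made for
      this line: the coefficient 1331/1620 of K is below 1, so that this term can be moved to the
      left. With no perturbation at all the coefficient would be 1/2.\<close>
    also have "\<dots> = (1331/1000) * \<kappa> / X + (1331/1620) * K" using X \<kappa> by (simp add: field_simps)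
    finally have "K \<le> (1331/1000) * (\<kappa> / X) + (1331/1620) * K" by simp
    moreover have "\<kappa> / X \<ge> 0" using X \<kappa> by simp
    ultimately have "K \<le> 10 * (\<kappa> / X)" by linarith
    then show ?thesis by simp
  qed
  show ?thesis using low high unfolding Xi K_def by simp
qed

section \<open>The wave kernel of a potential on the half-line\<close>

text \<open>The time derivative of the next kernel. Differentiating half the integral of V(y, .)
  from t - x - y to t - |x - y| leaves the two endpoint values: the direct wave, and the wave
  reflected with opposite sign at the Dirichlet end 0.\<close>

definition wave_step :: "(real \<Rightarrow> real) \<Rightarrow> (real \<Rightarrow> real \<Rightarrow> real) \<Rightarrow> real \<Rightarrow> real \<Rightarrow> real" where
  "wave_step q V x t = (LINT y|lborel. q y * (V y (t - \<bar>x - y\<bar>) - V y (t - x - y))) / 2"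

text \<open>The kernel V_n has Laplace transform (G q)^n e^{-\<kappa> x} / \<kappa>, where G is the Green's function of
  - d^2/dx^2 + \<kappa>^2 with a Dirichlet condition at 0. Since
  2 G(x, y) = \<integral> e^{-\<kappa> l} dl over |x - y| < l < x + y, applying G q amounts in the time domain to
  integrating V_n(y, .) over the interval from t - x - y to t - |x - y|.\<close>
primrec wave_kernel :: "(real \<Rightarrow> real) \<Rightarrow> nat \<Rightarrow> real \<Rightarrow> real \<Rightarrow> real" where
  "wave_kernel q 0 = (\<lambda>y s. if y \<le> s then 1 else 0)"
| "wave_kernel q (Suc n) = (\<lambda>x s. LINT t|lborel. indicator {0..s} t * wave_step q (wave_kernel q n) x t)"

text \<open>For a function vanishing on the left half-line this is the integral of |q| over (0, r),
  the quantity in the bound for E.\<close>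

definition mass :: "(real \<Rightarrow> real) \<Rightarrow> real \<Rightarrow> real" where
  "mass q r = (LINT y|lborel. indicator {..r} y * \<bar>q y\<bar>)"

text \<open>If f is not integrable, its integral is the default 0, which the nonnegative g bounds as
  well.\<close>

lemma lebesgue_integral_abs_bound:
  fixes f g :: "'a \<Rightarrow> real"
  assumes g: "integrable M g" and fg: "\<And>x. \<bar>f x\<bar> \<le> g x"
  shows "\<bar>integral\<^sup>L M f\<bar> \<le> integral\<^sup>L M g"
proof (cases "integrable M f")
  case True
  have "\<bar>integral\<^sup>L M f\<bar> \<le> (LINT x|M. \<bar>f x\<bar>)" by (rule integral_abs_bound)
  also have "\<dots> \<le> integral\<^sup>L M g" by (rule integral_mono[OF integrable_abs[OF True] g fg])
  finally show ?thesis .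
next
  case False
  moreover have "0 \<le> integral\<^sup>L M g"
    by (rule Bochner_Integration.integral_nonneg) (meson fg abs_ge_zero order_trans)
  ultimately show ?thesis by (simp add: not_integrable_integral_eq)
qed

lemma integrable_abs_bound:
  fixes f g :: "'a \<Rightarrow> real"
  assumes "integrable M g" "f \<in> borel_measurable M" "\<And>x. \<bar>f x\<bar> \<le> g x"
  shows "integrable M f"
  using assms(1,2)
  by (rule Bochner_Integration.integrable_bound) (auto intro!: AE_I2 order_trans[OF assms(3) abs_ge_self])

text \<open>A truncated potential, extended by 0 to the left so that all integrals in y can run over
  the whole line.\<close>

locale half_line =
  fixes q :: "real \<Rightarrow> real"
  assumes q_borel [measurable]: "q \<in> borel_measurable borel"
    and q_int: "integrable lborel q" and q_zero: "\<And>y. y \<le> 0 \<Longrightarrow> q y = 0"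
begin

lemma q_abs_mult_integrable: "integrable lborel (\<lambda>y. \<bar>q y\<bar> * B)"
  by (intro integrable_mult_left integrable_abs q_int)

lemma q_mult_bound:
  assumes "\<And>x. 0 < x \<Longrightarrow> \<bar>f x\<bar> \<le> B"
  shows "\<bar>q x * f x\<bar> \<le> \<bar>q x\<bar> * B"
proof (cases "x \<le> 0")
  case False
  then show ?thesis unfolding abs_mult using assms[of x] by (intro mult_left_mono) auto
qed (simp add: q_zero)

lemma q_mult_integrable:
  assumes [measurable]: "f \<in> borel_measurable borel" and "\<And>x. 0 < x \<Longrightarrow> \<bar>f x\<bar> \<le> B"
  shows "integrable lborel (\<lambda>x. q x * f x)"
  by (rule integrable_abs_bound[OF q_abs_mult_integrable _ q_mult_bound[OF assms(2)]]) measurable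

abbreviation "V \<equiv> wave_kernel q"
abbreviation "k n \<equiv> wave_step q (wave_kernel q n)"

lemma borel_measurable_compose_pair:
  assumes W: "(\<lambda>p. W (fst p) (snd p)) \<in> borel_measurable (borel :: (real \<times> real) measure)"
    and [measurable]: "f \<in> borel_measurable M" "g \<in> borel_measurable M"
  shows "(\<lambda>z. (W (f z) (g z) :: real)) \<in> borel_measurable M"
proof -
  have "(\<lambda>z. (f z, g z)) \<in> borel_measurable M" by measurable
  from measurable_compose[OF this W] show ?thesis by simp
qed

lemma measurable_wave_step:
  assumes W: "(\<lambda>p. W (fst p) (snd p)) \<in> borel_measurable (borel :: (real \<times> real) measure)"
  shows "(\<lambda>p. wave_step q W (fst p) (snd p)) \<in> borel_measurable (borel :: (real \<times> real) measure)"
proof -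
  have "(\<lambda>z. q (snd z) * (W (snd z) (snd (fst z) - \<bar>fst (fst z) - snd z\<bar>) - W (snd z) (snd (fst z) - fst (fst z) - snd z)))
     \<in> borel_measurable ((borel :: (real \<times> real) measure) \<Otimes>\<^sub>M lborel)"
    by (intro borel_measurable_times borel_measurable_diff borel_measurable_compose_pair[OF W]) 
       (auto simp: borel_prod[symmetric])
  then have "(\<lambda>p. LINT y|lborel. q y * (W y (snd p - \<bar>fst p - y\<bar>) - W y (snd p - fst p - y))) 
     \<in> borel_measurable (borel :: (real \<times> real) measure)"
    by (intro lborel.borel_measurable_lebesgue_integral) (simp add: split_beta')
  then show ?thesis unfolding wave_step_def by (intro borel_measurable_divide) auto
qed

text \<open>Joint measurability, as Fubini's theorem will need it; it passes from each kernel to the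
  next because the latter is a parameter integral.\<close>

lemma measurable_V: "(\<lambda>p. V n (fst p) (snd p)) \<in> borel_measurable (borel :: (real \<times> real) measure)"
proof (induction n)
  case 0
  have "{p :: real \<times> real. fst p \<le> snd p} \<in> sets borel" by (intro borel_closed closed_Collect_le continuous_intros)
  then have "indicat_real {p :: real \<times> real. fst p \<le> snd p} \<in> borel_measurable borel"
    by (rule borel_measurable_indicator)
  moreover have "indicat_real {p :: real \<times> real. fst p \<le> snd p} = (\<lambda>p. V 0 (fst p) (snd p))"
    by (auto simp: fun_eq_iff)
  ultimately show ?case by metis
next
  case (Suc n)
  note K = measurable_wave_step[OF Suc]
  have "(\<lambda>z. indicator {0..snd (fst z)} (snd z) * k n (fst (fst z)) (snd z))
     \<in> borel_measurable ((borel :: (real \<times> real) measure) \<Otimes>\<^sub>M lborel)"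
  proof (intro borel_measurable_times borel_measurable_compose_pair[OF K])
    have "(\<lambda>z. if 0 \<le> snd z \<and> snd z \<le> snd (fst z) then 1 else 0 :: real) \<in> borel_measurable ((borel :: (real \<times> real) measure) \<Otimes>\<^sub>M (lborel :: real measure))"
      by (auto simp: borel_prod[symmetric])
    then show "(\<lambda>z. indicat_real {0..snd (fst z)} (snd z)) \<in> borel_measurable ((borel :: (real \<times> real) measure) \<Otimes>\<^sub>M lborel)"
      by (simp add: indicator_def of_bool_def)
  qed (auto simp: borel_prod[symmetric])
  then have "(\<lambda>p. LINT t|lborel. indicator {0..snd p} t * k n (fst p) t) 
     \<in> borel_measurable (borel :: (real \<times> real) measure)"
    by (intro lborel.borel_measurable_lebesgue_integral) (simp add: split_beta')
  then show ?case by simp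
qed

lemma borel_V [measurable (raw)]:
  assumes "f \<in> borel_measurable M" "g \<in> borel_measurable M"
  shows "(\<lambda>z. V n (f z) (g z)) \<in> borel_measurable M"
  by (rule borel_measurable_compose_pair[OF measurable_V assms])

lemma borel_k [measurable (raw)]:
  assumes "f \<in> borel_measurable M" "g \<in> borel_measurable M"
  shows "(\<lambda>z. k n (f z) (g z)) \<in> borel_measurable M"
  by (rule borel_measurable_compose_pair[OF measurable_wave_step[OF measurable_V] assms])

lemma mass_integrable: "integrable lborel (\<lambda>y. indicator {..r} y * \<bar>q y\<bar>)"
  using integrable_mult_indicator[OF _ integrable_abs[OF q_int], of "{..r}"] by (simp add: mult.commute)

lemma mass_nonneg: "mass q r \<ge> 0"
  unfolding mass_def by (rule Bochner_Integration.integral_nonneg) simp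

definition "tot = (LINT y|lborel. \<bar>q y\<bar>)"

lemma mass_le_tot: "mass q r \<le> tot"
  unfolding mass_def tot_def
  by (rule integral_mono[OF mass_integrable integrable_abs[OF q_int]]) (auto simp: indicator_def)

lemma tot_nonneg: "tot \<ge> 0"
  using mass_nonneg mass_le_tot order_trans by blast

text \<open>Finite propagation speed. If t < x and y >= 0, then t - |x - y| <= t - x + y < y, so the
  vanishing of V_n before its arrival time is inherited by \<open>k n\<close> and by
  V_(n+1).\<close>

lemma V_support: "0 \<le> y \<Longrightarrow> s < y \<Longrightarrow> V n y s = 0"
  and k_support: "0 \<le> x \<Longrightarrow> t < x \<Longrightarrow> k n x t = 0"
proof -
  have *: "k n x t = 0" if V: "\<And>y s. 0 \<le> y \<Longrightarrow> s < y \<Longrightarrow> V n y s = 0" and x: "0 \<le> x" "t < x" for n x t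
  proof -
    have "q y * (V n y (t - \<bar>x - y\<bar>) - V n y (t - x - y)) = 0" for y
    proof (cases "y \<le> 0")
      case False
      then show ?thesis using x V[of y "t - \<bar>x - y\<bar>"] V[of y "t - x - y"] by simp
    qed (simp add: q_zero)
    note z = this
    show ?thesis unfolding wave_step_def by (simp only: z) simp
  qed
  have V: "0 \<le> y \<Longrightarrow> s < y \<Longrightarrow> V n y s = 0" for n y s
  proof (induction n arbitrary: y s)
    case (Suc n)
    have "indicator {0..s} t * k n y t = 0" for t
      using *[OF Suc.IH, of y t] Suc.prems by (auto simp: indicator_def)
    then have z: "(\<lambda>t. indicator {0..s} t * k n y t) = (\<lambda>_. 0)" by blast
    show ?case by (simp only: wave_kernel.simps z) simp
  qed simp
  show "0 \<le> y \<Longrightarrow> s < y \<Longrightarrow> V n y s = 0" by (rule V)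
  show "0 \<le> x \<Longrightarrow> t < x \<Longrightarrow> k n x t = 0" by (rule *[OF V])
qed

text \<open>The backward light cone of (x, t) reaches the line s = y no further out than y = r;
  beyond r both shifted kernels vanish, and only the mass of q up to r enters. The assumption
  concerns differences of V_n over time because exactly such a difference occurs in the
  integrand.\<close>

lemma k_bound_step:
  assumes V: "\<And>y s' s''. \<lbrakk>0 \<le> y; s'' \<le> s'; s' \<le> t; y + s' \<le> 2 * r\<rbrakk> \<Longrightarrow> \<bar>V n y s' - V n y s''\<bar> \<le> B"
    and B: "B \<ge> 0" and x: "0 \<le> x" "x + t \<le> 2 * r"
  shows "\<bar>k n x t\<bar> \<le> mass q r / 2 * B"
    and "integrable lborel (\<lambda>y. q y * (V n y (t - \<bar>x - y\<bar>) - V n y (t - x - y)))"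
    and "\<And>y. \<bar>q y * (V n y (t - \<bar>x - y\<bar>) - V n y (t - x - y))\<bar> \<le> B * (indicator {..r} y * \<bar>q y\<bar>)"
proof -
  show b: "\<bar>q y * (V n y (t - \<bar>x - y\<bar>) - V n y (t - x - y))\<bar> \<le> B * (indicator {..r} y * \<bar>q y\<bar>)" for y
  proof (cases "y \<le> 0")
    case False
    show ?thesis
    proof (cases "y \<le> r")
      case True
      have "\<bar>V n y (t - \<bar>x - y\<bar>) - V n y (t - x - y)\<bar> \<le> B"
        by (rule V) (use False x in auto)
      then have "\<bar>q y\<bar> * \<bar>V n y (t - \<bar>x - y\<bar>) - V n y (t - x - y)\<bar> \<le> \<bar>q y\<bar> * B" by (intro mult_left_mono) auto
      then show ?thesis using True by (simp add: abs_mult mult_ac)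
    next
      case False
      then show ?thesis using \<open>\<not> y \<le> 0\<close> x V_support[of y "t - \<bar>x - y\<bar>" n] V_support[of y "t - x - y" n] 
        by (simp add: abs_if)
    qed
  qed (simp add: q_zero)
  have i: "integrable lborel (\<lambda>y. B * (indicator {..r} y * \<bar>q y\<bar>))" by (intro integrable_mult_right mass_integrable)
  show i2: "integrable lborel (\<lambda>y. q y * (V n y (t - \<bar>x - y\<bar>) - V n y (t - x - y)))"
    by (rule integrable_abs_bound[OF i _ b]) measurable
  have "\<bar>LINT y|lborel. q y * (V n y (t - \<bar>x - y\<bar>) - V n y (t - x - y))\<bar> \<le> (LINT y|lborel. B * (indicator {..r} y * \<bar>q y\<bar>))"
    using lebesgue_integral_abs_bound[OF i b] .
  also have "\<dots> = B * mass q r" by (simp add: mass_def)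
  finally show "\<bar>k n x t\<bar> \<le> mass q r / 2 * B" by (simp add: wave_step_def mult.commute)
qed

text \<open>Differences of V_0 are at most 1, since its values are 0 and 1. Induction on differences
  gains half the mass at each step, where a bound on values would lose a factor 2; this is how the
  exponent in the bound for E becomes \<alpha> times the mass.\<close>

lemma V_diff_bound:
  "\<lbrakk>0 \<le> y; s'' \<le> s'; s' \<le> s; 0 \<le> s; y + s' \<le> 2 * r\<rbrakk> \<Longrightarrow> \<bar>V n y s' - V n y s''\<bar> \<le> (s * mass q r / 2) ^ n / fact n"
proof (induction n arbitrary: y s' s'' s)
  case (Suc n)
  define m where "m = mass q r"
  have m: "m \<ge> 0" by (simp add: m_def mass_nonneg)
  have kb: "\<bar>k n y t\<bar> \<le> m / 2 * ((t * m / 2) ^ n / fact n)" if "0 \<le> t" "y + t \<le> 2 * r" for t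
    unfolding m_def
    by (rule k_bound_step(1)) (use that Suc.prems mass_nonneg in \<open>auto intro!: Suc.IH\<close>)
  have ip: "((\<lambda>t. m / 2 * ((t * m / 2) ^ n / fact n)) has_integral ((s * m / 2) ^ Suc n / fact (Suc n) - (0 * m / 2) ^ Suc n / fact (Suc n))) {0..s}"
  proof (rule fundamental_theorem_of_calculus)
    fix t
    have "((\<lambda>t. (t * m / 2) ^ Suc n / fact (Suc n)) has_real_derivative (m / 2 * ((t * m / 2) ^ n / fact n))) (at t within {0..s})"
      by (rule derivative_eq_intros refl | simp)+
    then show "((\<lambda>t. (t * m / 2) ^ Suc n / fact (Suc n)) has_vector_derivative (m / 2 * ((t * m / 2) ^ n / fact n))) (at t within {0..s})"
      by (simp add: has_real_derivative_iff_has_vector_derivative)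
  qed (use Suc.prems in auto)
  have si: "set_integrable lborel {0..s} (\<lambda>t. m / 2 * ((t * m / 2) ^ n / fact n))"
    by (rule borel_integrable_atLeastAtMost') (auto intro!: continuous_intros)
  have iv: "(LINT t|lborel. indicator {0..s} t * (m / 2 * ((t * m / 2) ^ n / fact n))) = (s * m / 2) ^ Suc n / fact (Suc n)"
  proof -
    have z: "(0 * m / 2) ^ Suc n / fact (Suc n) = 0" by simp
    show ?thesis
      using set_borel_integral_eq_integral(2)[OF si] integral_unique[OF ip]
      unfolding set_lebesgue_integral_def real_scaleR_def z diff_zero by (rule trans)
  qed
  have ii: "integrable lborel (\<lambda>t. indicator {0..s} t * (m / 2 * ((t * m / 2) ^ n / fact n)))"
    using si by (simp add: set_integrable_def)
  have int: "integrable lborel (\<lambda>t. indicator {0..s'} t * k n y t)" if "s' \<le> s" "y + s' \<le> 2 * r" for s'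
  proof (rule integrable_abs_bound[OF ii])
    show "\<bar>indicator {0..s'} t * k n y t\<bar> \<le> indicator {0..s} t * (m / 2 * ((t * m / 2) ^ n / fact n))" for t
      using kb that m by (auto simp: indicator_def abs_mult)
  qed measurable
  have "V (Suc n) y s' - V (Suc n) y s'' = (LINT t|lborel. indicator {0..s'} t * k n y t - indicator {0..s''} t * k n y t)"
    using int[of s'] int[of s''] Suc.prems by simp
  then have "\<bar>V (Suc n) y s' - V (Suc n) y s''\<bar> = \<bar>LINT t|lborel. indicator {0..s'} t * k n y t - indicator {0..s''} t * k n y t\<bar>"
    by (rule arg_cong)
  also have "\<dots> \<le> (LINT t|lborel. indicator {0..s} t * (m / 2 * ((t * m / 2) ^ n / fact n)))"
  proof (rule lebesgue_integral_abs_bound[OF ii])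
    fix t
    show "\<bar>indicator {0..s'} t * k n y t - indicator {0..s''} t * k n y t\<bar> \<le> indicator {0..s} t * (m / 2 * ((t * m / 2) ^ n / fact n))"
      using kb[of t] Suc.prems m by (auto simp: indicator_def)
  qed
  finally show ?case using iv by (simp add: m_def)
qed auto

lemma k_bound: "0 \<le> x \<Longrightarrow> 0 \<le> t \<Longrightarrow> x + t \<le> 2 * r \<Longrightarrow> \<bar>k n x t\<bar> \<le> mass q r / 2 * ((t * mass q r / 2) ^ n / fact n)"
  by (rule k_bound_step(1)) (use mass_nonneg in \<open>auto intro!: V_diff_bound\<close>)

text \<open>From index 1 on a kernel is a time integral of \<open>k n\<close>, which is bounded on
  bounded times; this gives continuity in time later.\<close>

lemma V_lipschitz:
  assumes "0 \<le> y" "s'' \<le> s'" "s' \<le> s" "0 \<le> s"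
  shows "\<bar>V (Suc n) y s' - V (Suc n) y s''\<bar> \<le> (s' - s'') * (tot / 2 * ((s * tot / 2) ^ n / fact n))"
proof -
  define B where "B = tot / 2 * ((s * tot / 2) ^ n / fact n)"
  have kb: "\<bar>k n y t\<bar> \<le> B" if "t \<le> s" for t
  proof (cases "t < 0")
    case True
    then show ?thesis using k_support[of y t n] assms tot_nonneg by (simp add: B_def)
  next
    case False
    have "\<bar>k n y t\<bar> \<le> mass q ((y+t)/2) / 2 * ((t * mass q ((y+t)/2) / 2) ^ n / fact n)"
      by (rule k_bound) (use False assms in auto)
    also have "\<dots> \<le> B" unfolding B_def using False that mass_nonneg mass_le_tot tot_nonneg
      by (intro mult_mono divide_right_mono power_mono) auto
    finally show ?thesis .
  qed
  have B: "B \<ge> 0" using kb[OF order_refl] by (meson abs_ge_zero order_trans)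
  have iB: "integrable lborel (\<lambda>t. indicat_real {c..d} t * B)" for c d :: real
    by (intro integrable_mult_left integrable_real_indicator) (auto simp: emeasure_lborel_Icc_eq)
  have int: "integrable lborel (\<lambda>t. indicator {0..s'} t * k n y t)" if "s' \<le> s" for s'
  proof (rule integrable_abs_bound[OF iB[of 0 s]])
    show "\<bar>indicator {0..s'} t * k n y t\<bar> \<le> indicator {0..s} t * B" for t
      using kb that B by (auto simp: indicator_def)
  qed measurable
  have "V (Suc n) y s' - V (Suc n) y s'' = (LINT t|lborel. indicator {0..s'} t * k n y t - indicator {0..s''} t * k n y t)"
    using int[of s'] int[of s''] assms by simp
  then have "\<bar>V (Suc n) y s' - V (Suc n) y s''\<bar> = \<bar>LINT t|lborel. indicator {0..s'} t * k n y t - indicator {0..s''} t * k n y t\<bar>"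
    by (rule arg_cong)
  also have "\<dots> \<le> (LINT t|lborel. indicator {s''..s'} t * B)"
  proof (rule lebesgue_integral_abs_bound[OF iB])
    fix t
    show "\<bar>indicator {0..s'} t * k n y t - indicator {0..s''} t * k n y t\<bar> \<le> indicator {s''..s'} t * B"
      using kb[of t] assms B by (auto simp: indicator_def)
  qed
  also have "\<dots> = (s' - s'') * B" using assms by simp
  finally show ?thesis by (simp add: B_def)
qed

end

section \<open>Laplace transform of the wave kernel\<close>

lemma exp_half_line:
  fixes a c :: real
  assumes c: "c > 0"
  shows "integrable lborel (\<lambda>t. indicator {a..} t * exp (- c * t))"
    and "(LINT t|lborel. indicator {a..} t * exp (- c * t)) = exp (- c * a) / c"
proof -
  have h: "((\<lambda>x. exp (- c * x)) has_integral exp (- c * a) / c) {a..}"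
    by (rule has_integral_exp_minus_to_infinity[OF c])
  have "(\<lambda>x. exp (- c * x)) absolutely_integrable_on {a..}"
    by (rule nonnegative_absolutely_integrable_1) (use h in auto)
  then have i: "integrable lebesgue (\<lambda>t. indicator {a..} t * exp (- c * t))"
    by (simp add: set_integrable_def)
  have m: "(\<lambda>t. indicator {a..} t * exp (- c * t)) \<in> borel_measurable lborel" by measurable
  show "integrable lborel (\<lambda>t. indicator {a..} t * exp (- c * t))"
    using i integrable_completion[OF m] by simp
  have "(LINT t|lborel. indicator {a..} t * exp (- c * t)) = (LINT t|lebesgue. indicator {a..} t * exp (- c * t))"
    using integral_completion[OF m] by simp
  also have "\<dots> = integral {a..} (\<lambda>x. exp (- c * x))"
    using set_lebesgue_integral_eq_integral(2)[of "{a..}" "\<lambda>x. exp (- c * x)"] i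
    by (simp add: set_lebesgue_integral_def set_integrable_def)
  also have "\<dots> = exp (- c * a) / c" using h by (rule integral_unique)
  finally show "(LINT t|lborel. indicator {a..} t * exp (- c * t)) = exp (- c * a) / c" .
qed

lemma power_div_fact_le_exp: "x ^ n / fact n \<le> exp x" if "x \<ge> 0" for x :: real
proof -
  have "(\<Sum>i\<in>{n}. inverse (fact i) * x ^ i) \<le> (\<Sum>i. inverse (fact i) * x ^ i)"
    by (rule sum_le_suminf) (use that summable_exp[of x] in auto)
  also have "\<dots> = exp x" by (simp add: exp_def)
  finally show ?thesis by (simp add: field_simps)
qed

lemma fubini_lborel:
  fixes f :: "real \<Rightarrow> real \<Rightarrow> real"
  assumes m: "(\<lambda>p. f (fst p) (snd p)) \<in> borel_measurable borel"
    and i: "\<And>x. integrable lborel (f x)"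
    and g: "integrable lborel g" "\<And>x. (LINT y|lborel. \<bar>f x y\<bar>) \<le> g x"
  shows "(LINT y|lborel. LINT x|lborel. f x y) = (LINT x|lborel. LINT y|lborel. f x y)"
proof (rule lborel_pair.Fubini_integral, rule lborel_pair.Fubini_integrable)
  show meas: "case_prod f \<in> borel_measurable (lborel \<Otimes>\<^sub>M lborel)"
    using m by (simp add: split_beta' lborel_prod)
  have "(\<lambda>x. LINT y|lborel. \<bar>f x y\<bar>) \<in> borel_measurable lborel"
    using meas by (intro lborel.borel_measurable_lebesgue_integral) (simp add: split_beta')
  then show "integrable lborel (\<lambda>x. LINT y|lborel. norm (case (x, y) of (x, y) \<Rightarrow> f x y))"
    by (intro Bochner_Integration.integrable_bound[OF g(1)])
       (auto intro!: order_trans[OF _ abs_ge_self] g(2) simp: Bochner_Integration.integral_nonneg)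
  show "AE x in lborel. integrable lborel (\<lambda>y. case (x, y) of (x, y) \<Rightarrow> f x y)" using i by simp
qed

context half_line
begin

text \<open>A coarse bound, uniform in n and in y, under which the Laplace integrals
  converge.\<close>

lemma V_diff_tot:
  assumes "0 \<le> y" "s'' \<le> s'" "s' \<le> s" "0 \<le> s"
  shows "\<bar>V n y s' - V n y s''\<bar> \<le> exp (s * tot / 2)"
proof -
  have "\<bar>V n y s' - V n y s''\<bar> \<le> (s * mass q ((y + s') / 2) / 2) ^ n / fact n"
    by (rule V_diff_bound) (use assms in auto)
  also have "\<dots> \<le> (s * tot / 2) ^ n / fact n"
    using assms mass_nonneg mass_le_tot by (intro divide_right_mono power_mono mult_left_mono) auto
  also have "\<dots> \<le> exp (s * tot / 2)" using assms tot_nonneg by (intro power_div_fact_le_exp) auto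
  finally show ?thesis .
qed

lemma V_tot: "0 \<le> y \<Longrightarrow> 0 \<le> s \<Longrightarrow> \<bar>V n y s\<bar> \<le> exp (s * tot / 2)"
  using V_diff_tot[of y "-1" s s n] V_support[of y "-1" n] by simp

lemma k_tot: assumes "0 \<le> x" "0 \<le> t" shows "\<bar>k n x t\<bar> \<le> tot / 2 * exp (t * tot / 2)"
proof -
  have "\<bar>k n x t\<bar> \<le> mass q ((x+t)/2) / 2 * ((t * mass q ((x+t)/2) / 2) ^ n / fact n)"
    by (rule k_bound) (use assms in auto)
  also have "\<dots> \<le> tot / 2 * ((t * tot / 2) ^ n / fact n)"
    using assms mass_nonneg mass_le_tot tot_nonneg
    by (intro mult_mono divide_right_mono power_mono mult_left_mono) auto
  also have "\<dots> \<le> tot / 2 * exp (t * tot / 2)" 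
    using assms tot_nonneg by (intro mult_left_mono power_div_fact_le_exp) auto
  finally show ?thesis .
qed

end

text \<open>The kernels grow at most like exp(t tot / 2), so \<kappa> >= tot with \<kappa> > 0
  leaves a positive decay rate \<kappa> - tot / 2. It also makes the ratio tot / (2 \<kappa>) of the
  Neumann series at most 1/2.\<close>

locale half_line_laplace = half_line +
  fixes \<kappa> :: real
  assumes \<kappa>_pos: "\<kappa> > 0" and \<kappa>_tot: "\<kappa> \<ge> tot"
begin

definition "decay = \<kappa> - tot / 2"

lemma decay_pos: "decay > 0" using \<kappa>_pos \<kappa>_tot unfolding decay_def by linarith

lemma decay_exp: "exp (- \<kappa> * t) * exp (t * tot / 2) = exp (- decay * t)"
  by (simp add: decay_def algebra_simps flip: exp_add)

text \<open>The factor \<kappa> normalizes the transform so that V_0 yields exp(- \<kappa> x). It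
  amounts to transforming the time derivative.\<close>

definition Vhat :: "nat \<Rightarrow> real \<Rightarrow> real" where
  "Vhat n x = \<kappa> * (LINT s|lborel. indicator {0..} s * exp (- \<kappa> * s) * V n x s)"

definition G :: "real \<Rightarrow> real \<Rightarrow> real" where
  "G x y = (exp (- \<kappa> * \<bar>x - y\<bar>) - exp (- \<kappa> * (x + y))) / (2 * \<kappa>)"

lemma borel_Vhat [measurable]: "Vhat n \<in> borel_measurable borel"
proof -
  have "(\<lambda>z. indicator {0..} (snd z) * exp (- \<kappa> * snd z) * V n (fst z) (snd z)) \<in> borel_measurable (borel \<Otimes>\<^sub>M lborel)"
    by measurable
  then have "(\<lambda>x. LINT s|lborel. indicator {0..} s * exp (- \<kappa> * s) * V n x s) \<in> borel_measurable borel"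
    by (intro lborel.borel_measurable_lebesgue_integral) (simp add: split_beta')
  then show ?thesis unfolding Vhat_def[abs_def] by measurable
qed

lemma borel_G [measurable]: "G x \<in> borel_measurable borel"
  unfolding G_def[abs_def] by measurable

lemma Vhat_0: assumes "0 \<le> x" shows "Vhat 0 x = exp (- \<kappa> * x)"
proof -
  have "indicator {0..} s * exp (- \<kappa> * s) * V 0 x s = indicator {x..} s * exp (- \<kappa> * s)" for s
    using assms by (auto simp: indicator_def)
  then have e: "(\<lambda>s. indicator {0..} s * exp (- \<kappa> * s) * V 0 x s) = (\<lambda>s. indicator {x..} s * exp (- \<kappa> * s))" by blast
  show ?thesis unfolding Vhat_def e using exp_half_line(2)[OF \<kappa>_pos, of x] \<kappa>_pos by simp
qed

text \<open>Swapping the integrals over 0 <= t <= s leaves the integral of exp(- \<kappa> s) over s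
  >= t, which is exp(- \<kappa> t) / \<kappa>; the normalizing factor cancels.\<close>

lemma Vhat_Suc: 
  assumes x: "0 \<le> x" shows "Vhat (Suc n) x = (LINT t|lborel. indicator {0..} t * exp (- \<kappa> * t) * k n x t)"
proof -
  define f where "f t s = indicator {0..} t * (indicator {t..} s * exp (- \<kappa> * s)) * k n x t" for t s :: real
  note E = exp_half_line[OF \<kappa>_pos]
  have 1: "(LINT s|lborel. f t s) = (1 / \<kappa>) * (indicator {0..} t * exp (- \<kappa> * t) * k n x t)" for t
    unfolding f_def using E(2)[of t] by simp
  have abs: "\<bar>f t s\<bar> = indicator {0..} t * (indicator {t..} s * exp (- \<kappa> * s)) * \<bar>k n x t\<bar>" for t s
    by (simp add: f_def abs_mult)
  have 2: "(LINT s|lborel. \<bar>f t s\<bar>) = indicator {0..} t * (exp (- \<kappa> * t) / \<kappa>) * \<bar>k n x t\<bar>" for t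
    unfolding abs using E(2)[of t] by simp
  have 3: "(LINT t|lborel. f t s) = indicator {0..} s * exp (- \<kappa> * s) * V (Suc n) x s" for s
  proof (cases "s \<ge> 0")
    case True
    have "f t s = exp (- \<kappa> * s) * (indicator {0..s} t * k n x t)" for t
      by (auto simp: f_def indicator_def)
    then show ?thesis using True by simp
  next
    case False
    then have "(\<lambda>t. f t s) = (\<lambda>_. 0)" by (auto simp: f_def indicator_def)
    then show ?thesis using False by simp
  qed
  have "(LINT s|lborel. LINT t|lborel. f t s) = (LINT t|lborel. LINT s|lborel. f t s)"
  proof (rule fubini_lborel)
    have "(\<lambda>p. if fst p \<le> snd p then 1 else 0 :: real) \<in> borel_measurable (borel :: (real \<times> real) measure)"
      by (auto simp: borel_prod[symmetric])
    moreover have "f (fst p) (snd p) = indicator {0..} (fst p) * ((if fst p \<le> snd p then 1 else 0) * exp (- \<kappa> * snd p)) * k n x (fst p)" for p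
      by (auto simp: f_def indicator_def)
    ultimately show "(\<lambda>p. f (fst p) (snd p)) \<in> borel_measurable borel"
      by (auto simp: borel_prod[symmetric])
    show "integrable lborel (f t)" for t
      unfolding f_def[abs_def] by (intro integrable_mult_left integrable_mult_right E(1))
    show "integrable lborel (\<lambda>t. (tot / 2 / \<kappa>) * (indicator {0..} t * exp (- decay * t)))"
      by (intro integrable_mult_right exp_half_line(1) decay_pos)
    fix t
    show "(LINT s|lborel. \<bar>f t s\<bar>) \<le> (tot / 2 / \<kappa>) * (indicator {0..} t * exp (- decay * t))"
    proof (cases "t \<ge> 0")
      case True
      have "exp (- \<kappa> * t) / \<kappa> * \<bar>k n x t\<bar> \<le> exp (- \<kappa> * t) / \<kappa> * (tot / 2 * exp (t * tot / 2))"
        using k_tot[OF x True] \<kappa>_pos by (intro mult_left_mono) auto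
      also have "\<dots> = (tot / 2 / \<kappa>) * (exp (- \<kappa> * t) * exp (t * tot / 2))" by (simp add: mult_ac)
      finally show ?thesis using True unfolding 2 decay_exp by simp
    qed (simp add: 2)
  qed
  then show ?thesis unfolding 1 3 Vhat_def using \<kappa>_pos by (simp add: field_simps)
qed

lemma V_shift_integrable:
  assumes "0 \<le> y" "0 \<le> c"
  shows "integrable lborel (\<lambda>t. indicator {0..} t * exp (- \<kappa> * t) * V n y (t - c))"
proof (rule integrable_abs_bound[OF exp_half_line(1)[OF decay_pos, of 0]])
  fix t
  show "\<bar>indicator {0..} t * exp (- \<kappa> * t) * V n y (t - c)\<bar> \<le> indicator {0..} t * exp (- decay * t)"
  proof (cases "t \<ge> 0")
    case t: True
    have "\<bar>V n y (t - c)\<bar> \<le> exp (t * tot / 2)"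
    proof (cases "t - c \<ge> 0")
      case True
      have "exp ((t - c) * tot / 2) \<le> exp (t * tot / 2)" using assms tot_nonneg by (simp add: mult_right_mono)
      then show ?thesis using V_tot[OF assms(1) True, of n] by linarith
    next
      case False
      then show ?thesis using V_support[of y "t - c" n] assms by simp
    qed
    then show ?thesis unfolding decay_exp[symmetric] using t by (simp add: abs_mult)
  qed simp
qed measurable

lemma V_shift_integral:
  assumes y: "0 \<le> y" and c: "0 \<le> c"
  shows "(LINT t|lborel. indicator {0..} t * exp (- \<kappa> * t) * V n y (t - c)) = exp (- \<kappa> * c) * Vhat n y / \<kappa>"
proof -
  have "(LINT t|lborel. indicator {0..} t * exp (- \<kappa> * t) * V n y (t - c)) 
      = (LINT s|lborel. indicator {0..} (c + 1 * s) * exp (- \<kappa> * (c + 1 * s)) * V n y ((c + 1 * s) - c))"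
    using lborel_integral_real_affine[of 1 "\<lambda>t. indicator {0..} t * exp (- \<kappa> * t) * V n y (t - c)" c] by simp
  also have "\<dots> = (LINT s|lborel. exp (- \<kappa> * c) * (indicator {0..} s * exp (- \<kappa> * s) * V n y s))"
  proof (rule Bochner_Integration.integral_cong[OF refl])
    fix s
    show "indicator {0..} (c + 1 * s) * exp (- \<kappa> * (c + 1 * s)) * V n y ((c + 1 * s) - c) = exp (- \<kappa> * c) * (indicator {0..} s * exp (- \<kappa> * s) * V n y s)"
    proof (cases "s \<ge> 0")
      case True
      have "exp (- \<kappa> * (c + s)) = exp (- \<kappa> * c) * exp (- \<kappa> * s)" by (simp add: algebra_simps flip: exp_add)
      then show ?thesis using True c by simp
    next
      case False
      then show ?thesis using V_support[of y s n] y by simp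
    qed
  qed
  finally show ?thesis using \<kappa>_pos by (simp add: Vhat_def)
qed

text \<open>A delay by c multiplies the transform by exp(- \<kappa> c), so the delays |x - y| and x
  + y in \<open>wave_step\<close> become the two exponentials of \<open>G\<close>.\<close>

lemma Vhat_Suc_G:
  assumes x: "0 \<le> x" shows "Vhat (Suc n) x = (LINT y|lborel. q y * G x y * Vhat n y)"
proof -
  define f where "f y t = indicator {0..} t * exp (- \<kappa> * t) * (q y * (V n y (t - \<bar>x - y\<bar>) - V n y (t - x - y)) / 2)" for y t :: real
  have dist: "f y t = (q y / 2) * (indicator {0..} t * exp (- \<kappa> * t) * V n y (t - \<bar>x - y\<bar>) - indicator {0..} t * exp (- \<kappa> * t) * V n y (t - (x + y)))" for y t
  proof -
    have "t - x - y = t - (x + y)" by simp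
    then show ?thesis unfolding f_def by (simp add: field_simps)
  qed
  have int: "integrable lborel (f y)" for y
  proof (cases "y \<le> 0")
    case False
    then show ?thesis unfolding dist[abs_def] using x by (intro integrable_mult_right Bochner_Integration.integrable_diff V_shift_integrable) auto
  qed (simp add: f_def[abs_def] q_zero)
  have 1: "(LINT t|lborel. f y t) = q y * G x y * Vhat n y" for y
  proof (cases "y \<le> 0")
    case False
    then have y: "0 \<le> y" and c: "0 \<le> \<bar>x - y\<bar>" "0 \<le> x + y" using x by auto
    have "(LINT t|lborel. f y t) = (q y / 2) * (exp (- \<kappa> * \<bar>x - y\<bar>) * Vhat n y / \<kappa> - exp (- \<kappa> * (x + y)) * Vhat n y / \<kappa>)"
      unfolding dist integral_mult_right_zero 
        Bochner_Integration.integral_diff[OF V_shift_integrable[OF y c(1)] V_shift_integrable[OF y c(2)]]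
        V_shift_integral[OF y c(1)] V_shift_integral[OF y c(2)] ..
    also have "\<dots> = q y * G x y * Vhat n y"
      unfolding G_def using \<kappa>_pos by (simp add: diff_divide_distrib left_diff_distrib right_diff_distrib)
    finally show ?thesis .
  qed (simp add: f_def q_zero)
  have "(LINT t|lborel. LINT y|lborel. f y t) = (LINT y|lborel. LINT t|lborel. f y t)"
  proof (rule fubini_lborel[OF _ int])
    show "(\<lambda>p. f (fst p) (snd p)) \<in> borel_measurable borel"
      unfolding f_def borel_prod[symmetric] by measurable
    show "integrable lborel (\<lambda>y. \<bar>q y\<bar> * (1 / decay))" by (rule q_abs_mult_integrable)
    fix y
    have "\<bar>f y t\<bar> \<le> \<bar>q y\<bar> * (indicator {0..} t * exp (- decay * t))" for t
    proof (cases "y \<le> 0 \<or> t < 0")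
      case True
      then show ?thesis by (auto simp: f_def q_zero)
    next
      case False
      have "\<bar>V n y (t - \<bar>x - y\<bar>) - V n y (t - x - y)\<bar> \<le> exp (t * tot / 2)"
        by (rule V_diff_tot) (use False x in auto)
      then have "exp (- \<kappa> * t) * \<bar>q y\<bar> * \<bar>V n y (t - \<bar>x - y\<bar>) - V n y (t - x - y)\<bar> \<le> exp (- \<kappa> * t) * \<bar>q y\<bar> * exp (t * tot / 2)"
        by (intro mult_left_mono) auto
      also have "\<dots> = \<bar>q y\<bar> * (exp (- \<kappa> * t) * exp (t * tot / 2))" by simp
      also have "\<dots> = \<bar>q y\<bar> * exp (- decay * t)" unfolding decay_exp ..
      finally have *: "exp (- \<kappa> * t) * \<bar>q y\<bar> * \<bar>V n y (t - \<bar>x - y\<bar>) - V n y (t - x - y)\<bar> \<le> \<bar>q y\<bar> * exp (- decay * t)" .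
      have "\<bar>f y t\<bar> = exp (- \<kappa> * t) * \<bar>q y\<bar> * \<bar>V n y (t - \<bar>x - y\<bar>) - V n y (t - x - y)\<bar> / 2"
        using False by (simp add: f_def abs_mult)
      also have "\<dots> \<le> exp (- \<kappa> * t) * \<bar>q y\<bar> * \<bar>V n y (t - \<bar>x - y\<bar>) - V n y (t - x - y)\<bar>" by simp
      finally show ?thesis using * False by simp
    qed
    then have "(LINT t|lborel. \<bar>f y t\<bar>) \<le> (LINT t|lborel. \<bar>q y\<bar> * (indicator {0..} t * exp (- decay * t)))"
      by (intro integral_mono integrable_abs int integrable_mult_right exp_half_line(1) decay_pos)
    also have "\<dots> = \<bar>q y\<bar> * (1 / decay)" using exp_half_line(2)[OF decay_pos, of 0] by simp
    finally show "(LINT t|lborel. \<bar>f y t\<bar>) \<le> \<bar>q y\<bar> * (1 / decay)" .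
  qed
  moreover have "(LINT y|lborel. f y t) = indicator {0..} t * exp (- \<kappa> * t) * k n x t" for t
    by (simp add: f_def wave_step_def)
  ultimately show ?thesis by (simp add: Vhat_Suc[OF x] 1)
qed

section \<open>The Neumann series of the decaying solution\<close>

definition "\<rho> = tot / (2 * \<kappa>)"

lemma \<rho>: "0 \<le> \<rho>" "\<rho> \<le> 1/2"
  using tot_nonneg \<kappa>_pos \<kappa>_tot by (auto simp: \<rho>_def field_simps)

lemma G_bounds: "0 \<le> x \<Longrightarrow> 0 \<le> y \<Longrightarrow> 0 \<le> G x y" "G x y \<le> exp (- \<kappa> * \<bar>x - y\<bar>) / (2 * \<kappa>)"
  using \<kappa>_pos by (auto simp: G_def intro!: divide_right_mono)

text \<open>Because |x - y| + y >= x, decay like exp(- \<kappa> y) is handed on as decay like exp(-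
  \<kappa> x) without loss in the rate.\<close>

lemma qGA_bound:
  assumes x: "0 \<le> x" and Vhat: "\<And>y. 0 \<le> y \<Longrightarrow> \<bar>a y\<bar> \<le> B * exp (- \<kappa> * y)" and B: "B \<ge> 0"
  shows "\<bar>q y * G x y * a y\<bar> \<le> \<bar>q y\<bar> * (B * exp (- \<kappa> * x) / (2 * \<kappa>))"
proof (cases "y \<le> 0")
  case False
  have "\<bar>G x y * a y\<bar> \<le> (exp (- \<kappa> * \<bar>x - y\<bar>) / (2 * \<kappa>)) * (B * exp (- \<kappa> * y))"
    unfolding abs_mult using False x G_bounds[of x y] Vhat[of y] \<kappa>_pos by (intro mult_mono) auto
  also have "\<dots> = B * (exp (- \<kappa> * \<bar>x - y\<bar>) * exp (- \<kappa> * y)) / (2 * \<kappa>)" by simp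
  also have "exp (- \<kappa> * \<bar>x - y\<bar>) * exp (- \<kappa> * y) = exp (- \<kappa> * (\<bar>x - y\<bar> + y))"
    by (simp add: algebra_simps flip: exp_add)
  also have "B * exp (- \<kappa> * (\<bar>x - y\<bar> + y)) / (2 * \<kappa>) \<le> B * exp (- \<kappa> * x) / (2 * \<kappa>)"
    using B \<kappa>_pos by (intro divide_right_mono mult_left_mono) auto
  finally have "\<bar>q y\<bar> * \<bar>G x y * a y\<bar> \<le> \<bar>q y\<bar> * (B * exp (- \<kappa> * x) / (2 * \<kappa>))" by (intro mult_left_mono) auto
  then show ?thesis by (simp add: abs_mult mult.assoc)
qed (simp add: q_zero)

text \<open>Each application of the Green's operator to q times a function of this decay costs the
  factor tot / (2 \<kappa>).\<close>

lemma Vhat_bound: "0 \<le> x \<Longrightarrow> \<bar>Vhat n x\<bar> \<le> \<rho> ^ n * exp (- \<kappa> * x)"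
proof (induction n arbitrary: x)
  case (Suc n)
  have "\<bar>Vhat (Suc n) x\<bar> \<le> (LINT y|lborel. \<bar>q y\<bar> * (\<rho> ^ n * exp (- \<kappa> * x) / (2 * \<kappa>)))"
    unfolding Vhat_Suc_G[OF Suc.prems]
    by (rule lebesgue_integral_abs_bound[OF q_abs_mult_integrable],
        rule qGA_bound[OF Suc.prems Suc.IH]) (use \<rho> in auto)
  also have "\<dots> = tot * (\<rho> ^ n * exp (- \<kappa> * x) / (2 * \<kappa>))" by (simp add: tot_def)
  also have "\<dots> = \<rho> ^ Suc n * exp (- \<kappa> * x)" using \<kappa>_pos by (simp add: \<rho>_def field_simps)
  finally show ?case .
qed (simp add: Vhat_0)

text \<open>The Neumann series solving \<psi> + G q \<psi> = exp(- \<kappa> x).\<close>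

definition \<psi> :: "real \<Rightarrow> real" where "\<psi> x = (\<Sum>n. (- 1) ^ n * Vhat n x)"

lemma summable_\<rho>: "summable (\<lambda>n. \<rho> ^ n * c)"
  using \<rho> by (intro summable_mult2 summable_geometric) auto

lemma Vhat_summable_norm: "0 \<le> x \<Longrightarrow> summable (\<lambda>n. \<bar>(- 1) ^ n * Vhat n x\<bar>)"
  by (rule summable_comparison_test_ev[OF _ summable_\<rho>[of "exp (- \<kappa> * x)"]])
     (use Vhat_bound in \<open>auto simp: abs_mult intro!: always_eventually\<close>)

lemma Vhat_summable: "0 \<le> x \<Longrightarrow> summable (\<lambda>n. (- 1) ^ n * Vhat n x)"
  using Vhat_summable_norm by (rule summable_rabs_cancel)

lemma \<psi>_bound: assumes x: "0 \<le> x" shows "\<bar>\<psi> x\<bar> \<le> 2 * exp (- \<kappa> * x)"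
proof -
  have "\<bar>\<psi> x\<bar> \<le> (\<Sum>n. \<bar>(- 1) ^ n * Vhat n x\<bar>)" unfolding \<psi>_def by (rule summable_rabs[OF Vhat_summable_norm[OF x]])
  also have "\<dots> \<le> (\<Sum>n. \<rho> ^ n * exp (- \<kappa> * x))"
    by (rule suminf_le[OF _ Vhat_summable_norm[OF x] summable_\<rho>]) (use Vhat_bound[OF x] in \<open>simp add: abs_mult\<close>)
  also have "\<dots> = (1 / (1 - \<rho>)) * exp (- \<kappa> * x)"
    using \<rho> by (subst suminf_mult2[symmetric]) (auto simp: suminf_geometric intro!: summable_geometric)
  also have "\<dots> \<le> 2 * exp (- \<kappa> * x)" using \<rho> by (intro mult_right_mono) (auto simp: field_simps)
  finally show ?thesis .
qed

lemma borel_\<psi> [measurable]: "\<psi> \<in> borel_measurable borel"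
  unfolding \<psi>_def[abs_def] by measurable

text \<open>Termwise integration raises the index by one, so the integral is minus the series
  without its first term.\<close>

lemma \<psi>_equation:
  assumes x: "0 \<le> x" shows "\<psi> x = exp (- \<kappa> * x) - (LINT y|lborel. q y * G x y * \<psi> y)"
proof -
  define f where "f n y = (- 1) ^ n * (q y * G x y * Vhat n y)" for n y
  have fb: "\<bar>f n y\<bar> \<le> \<bar>q y\<bar> * (\<rho> ^ n * exp (- \<kappa> * x) / (2 * \<kappa>))" for n y
    unfolding f_def abs_mult[of "(-1)^n"] using qGA_bound[OF x Vhat_bound[of _ n], of y] \<rho> by simp
  have fi: "integrable lborel (f n)" for n
    by (rule integrable_abs_bound[OF q_abs_mult_integrable _ fb]) (simp add: f_def[abs_def])
  have sf: "summable (\<lambda>n. norm (f n y))" for y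
    by (rule summable_comparison_test_ev[OF _ summable_\<rho>[of "\<bar>q y\<bar> * exp (- \<kappa> * x) / (2 * \<kappa>)"]])
       (use fb[of _ y] in \<open>auto intro!: always_eventually simp: mult_ac\<close>)
  have sI: "summable (\<lambda>n. LINT y|lborel. norm (f n y))"
  proof (rule summable_comparison_test_ev[OF _ summable_\<rho>[of "tot * exp (- \<kappa> * x) / (2 * \<kappa>)"]], rule always_eventually, rule allI)
    fix n
    have "(LINT y|lborel. norm (f n y)) \<le> (LINT y|lborel. \<bar>q y\<bar> * (\<rho> ^ n * exp (- \<kappa> * x) / (2 * \<kappa>)))"
      by (rule integral_mono) (use fb fi in \<open>auto intro!: integrable_mult_left integrable_abs q_int\<close>)
    also have "\<dots> = tot * (\<rho> ^ n * exp (- \<kappa> * x) / (2 * \<kappa>))" by (simp add: tot_def)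
    finally show "norm (LINT y|lborel. norm (f n y)) \<le> \<rho> ^ n * (tot * exp (- \<kappa> * x) / (2 * \<kappa>))"
      by (simp add: mult_ac)
  qed
  have "(LINT y|lborel. (\<Sum>n. f n y)) = (\<Sum>n. LINT y|lborel. f n y)"
    by (rule integral_suminf[OF fi _ sI]) (intro AE_I2 sf)
  moreover have "(\<Sum>n. f n y) = q y * G x y * \<psi> y" for y
  proof (cases "y \<le> 0")
    case False
    have "(\<Sum>n. (q y * G x y) * ((- 1) ^ n * Vhat n y)) = q y * G x y * \<psi> y"
      unfolding \<psi>_def by (rule suminf_mult) (rule Vhat_summable, use False in simp)
    then show ?thesis by (simp add: f_def mult_ac)
  qed (simp add: f_def q_zero)
  moreover have "(LINT y|lborel. f n y) = - ((- 1) ^ Suc n * Vhat (Suc n) x)" for n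
    unfolding Vhat_Suc_G[OF x] f_def by simp
  ultimately have "(LINT y|lborel. q y * G x y * \<psi> y) = (\<Sum>n. - ((- 1) ^ Suc n * Vhat (Suc n) x))" by simp
  also have "\<dots> = - (\<Sum>n. (- 1) ^ Suc n * Vhat (Suc n) x)"
    using summable_Suc_iff[THEN iffD2, OF Vhat_summable[OF x]] by (rule suminf_minus)
  also have "(\<Sum>n. (- 1) ^ Suc n * Vhat (Suc n) x) = \<psi> x - (- 1) ^ 0 * Vhat 0 x"
    unfolding \<psi>_def by (rule suminf_split_head[OF Vhat_summable[OF x]])
  finally show ?thesis by (simp add: Vhat_0[OF x])
qed

text \<open>As 2 \<rho> = tot / \<kappa>, for large \<kappa> this puts \<psi> within the ten percent
  of exp(- \<kappa> x) that the comparison of m-functions tolerates. The factor 2 is the sum of the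
  geometric series for \<rho> <= 1/2.\<close>

lemma \<psi>_shape: assumes x: "0 \<le> x" shows "\<bar>\<psi> x - exp (- \<kappa> * x)\<bar> \<le> 2 * \<rho> * exp (- \<kappa> * x)"
proof -
  have "\<psi> x - exp (- \<kappa> * x) = - (LINT y|lborel. q y * G x y * \<psi> y)" using \<psi>_equation[OF x] by simp
  then have "\<bar>\<psi> x - exp (- \<kappa> * x)\<bar> = \<bar>LINT y|lborel. q y * G x y * \<psi> y\<bar>" by simp
  also have "\<dots> \<le> (LINT y|lborel. \<bar>q y\<bar> * (2 * exp (- \<kappa> * x) / (2 * \<kappa>)))"
    by (rule lebesgue_integral_abs_bound[OF q_abs_mult_integrable],
        rule qGA_bound[OF x \<psi>_bound]) auto
  also have "\<dots> = tot * (2 * exp (- \<kappa> * x) / (2 * \<kappa>))" unfolding tot_def by simp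
  also have "\<dots> = 2 * \<rho> * exp (- \<kappa> * x)" using \<kappa>_pos by (simp add: \<rho>_def)
  finally show ?thesis .
qed

end

section \<open>The function E\<close>

lemma summable_exp_series: "summable (\<lambda>n. c * (x ^ n / fact n :: real))"
  using summable_mult[OF summable_exp[of x], of c] by (simp add: field_simps)

lemma suminf_exp_series: "(\<Sum>n. c * (x ^ n / fact n :: real)) = c * exp x"
proof -
  have e: "exp x = (\<Sum>n. x ^ n / fact n)" by (simp add: exp_def field_simps)
  have s: "summable (\<lambda>n. x ^ n / fact n)" using summable_exp_series[of 1 x] by simp
  show ?thesis unfolding suminf_mult[OF s] e ..
qed

context half_line
begin

text \<open>The term of -\<psi>'(0) - \<kappa> that comes from V_(n+1) is, up to sign, the double
  integral of q(x) \<open>k n x t\<close> exp(- \<kappa> (x + t)). Putting x + t = 2 \<alpha> makes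
  the exponent - 2 \<alpha> \<kappa>, and the leading 2 is dt / d\<alpha>. The kernel V_0
  contributes q itself, hence the sign with \<open>Suc n\<close> in \<open>E\<close>.\<close>

definition E_term :: "nat \<Rightarrow> real \<Rightarrow> real" where
  "E_term n \<alpha> = 2 * (LINT x|lborel. q x * k n x (2 * \<alpha> - x))"

definition E :: "real \<Rightarrow> real" where
  "E \<alpha> = (\<Sum>n. (- 1) ^ Suc n * E_term n \<alpha>)"

lemma borel_E_term [measurable]: "E_term n \<in> borel_measurable borel"
proof -
  have "(\<lambda>z. q (snd z) * k n (snd z) (2 * fst z - snd z)) \<in> borel_measurable (borel \<Otimes>\<^sub>M lborel)"
    by measurable
  then have "(\<lambda>\<alpha>. LINT x|lborel. q x * k n x (2 * \<alpha> - x)) \<in> borel_measurable borel"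
    by (intro lborel.borel_measurable_lebesgue_integral) (simp add: split_beta')
  then show ?thesis unfolding E_term_def[abs_def] by measurable
qed

lemma borel_E [measurable]: "E \<in> borel_measurable borel"
  unfolding E_def[abs_def] by measurable

text \<open>For x > \<alpha> the time 2 \<alpha> - x precedes the arrival of the wave, so only x <=
  \<alpha> counts. There x + t = 2 \<alpha> brings in the mass up to \<alpha>, and t <= 2 \<alpha>
  bounds t m / 2 by \<alpha> m. Summation over n then gives the exponential of the theorem.\<close>

lemma E_term_bound:
  assumes \<alpha>: "0 \<le> \<alpha>"
  shows "\<bar>E_term n \<alpha>\<bar> \<le> (mass q \<alpha>)\<^sup>2 * ((\<alpha> * mass q \<alpha>) ^ n / fact n)"
proof -
  define m where "m = mass q \<alpha>"
  have m: "m \<ge> 0" by (simp add: m_def mass_nonneg)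
  define B where "B = m / 2 * ((\<alpha> * m) ^ n / fact n)"
  have B: "B \<ge> 0" using m \<alpha> by (simp add: B_def)
  have b: "\<bar>q x * k n x (2 * \<alpha> - x)\<bar> \<le> B * (indicator {..\<alpha>} x * \<bar>q x\<bar>)" for x
  proof (cases "x \<le> 0 \<or> x > \<alpha>")
    case True
    then show ?thesis using k_support[of x "2 * \<alpha> - x" n] by (cases "x \<le> 0") (auto simp: q_zero)
  next
    case False
    have "\<bar>k n x (2 * \<alpha> - x)\<bar> \<le> m / 2 * (((2 * \<alpha> - x) * m / 2) ^ n / fact n)"
      unfolding m_def by (rule k_bound) (use False in auto)
    also have "\<dots> \<le> B"
    proof -
      have "(2 * \<alpha> - x) * m \<le> (2 * \<alpha>) * m" using False m by (intro mult_right_mono) auto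
      then have "(2 * \<alpha> - x) * m / 2 \<le> \<alpha> * m" by simp
      then show ?thesis unfolding B_def using False m 
        by (intro mult_left_mono divide_right_mono power_mono) auto
    qed
    finally have "\<bar>q x\<bar> * \<bar>k n x (2 * \<alpha> - x)\<bar> \<le> \<bar>q x\<bar> * B" by (rule mult_left_mono) simp
    then show ?thesis using False by (simp add: abs_mult mult.commute)
  qed
  have "\<bar>LINT x|lborel. q x * k n x (2 * \<alpha> - x)\<bar> \<le> (LINT x|lborel. B * (indicator {..\<alpha>} x * \<bar>q x\<bar>))"
    by (rule lebesgue_integral_abs_bound[OF integrable_mult_right[OF mass_integrable] b])
  also have "\<dots> = B * m" by (simp add: m_def mass_def)
  finally have "\<bar>E_term n \<alpha>\<bar> \<le> 2 * (B * m)" by (simp add: E_term_def abs_mult)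
  also have "2 * (B * m) = m\<^sup>2 * ((\<alpha> * m) ^ n / fact n)" by (simp add: B_def power2_eq_square)
  finally show ?thesis by (simp add: m_def)
qed

lemma E_term_summable_norm: "0 \<le> \<alpha> \<Longrightarrow> summable (\<lambda>n. \<bar>(- 1) ^ Suc n * E_term n \<alpha>\<bar>)"
  by (rule summable_comparison_test_ev[OF _ summable_exp_series[of "(mass q \<alpha>)\<^sup>2" "\<alpha> * mass q \<alpha>"]])
     (use E_term_bound[of \<alpha>] in \<open>auto simp: abs_mult intro!: always_eventually\<close>)

lemma E_term_sums: "0 \<le> \<alpha> \<Longrightarrow> (\<lambda>n. (- 1) ^ Suc n * E_term n \<alpha>) sums E \<alpha>"
  unfolding E_def by (rule summable_sums[OF summable_rabs_cancel[OF E_term_summable_norm]])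

lemma partial_E_bound:
  assumes \<alpha>: "0 \<le> \<alpha>"
  shows "\<bar>\<Sum>n<N. (- 1) ^ Suc n * E_term n \<alpha>\<bar> \<le> (mass q \<alpha>)\<^sup>2 * exp (\<alpha> * mass q \<alpha>)"
proof -
  have "\<bar>\<Sum>n<N. (- 1) ^ Suc n * E_term n \<alpha>\<bar> \<le> (\<Sum>n<N. (mass q \<alpha>)\<^sup>2 * ((\<alpha> * mass q \<alpha>) ^ n / fact n))"
    by (rule order_trans[OF sum_abs sum_mono]) (use E_term_bound[OF \<alpha>] in \<open>simp add: abs_mult\<close>)
  also have "\<dots> \<le> (\<Sum>n. (mass q \<alpha>)\<^sup>2 * ((\<alpha> * mass q \<alpha>) ^ n / fact n))"
    by (rule sum_le_suminf[OF summable_exp_series]) (use \<alpha> mass_nonneg in auto)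
  also have "\<dots> = (mass q \<alpha>)\<^sup>2 * exp (\<alpha> * mass q \<alpha>)" by (rule suminf_exp_series)
  finally show ?thesis .
qed

lemma E_bound:
  assumes \<alpha>: "0 \<le> \<alpha>"
  shows "\<bar>E \<alpha>\<bar> \<le> (mass q \<alpha>)\<^sup>2 * exp (\<alpha> * mass q \<alpha>)"
proof -
  have "(\<lambda>N. \<bar>\<Sum>n<N. (- 1) ^ Suc n * E_term n \<alpha>\<bar>) \<longlonglongrightarrow> \<bar>E \<alpha>\<bar>"
    using E_term_sums[OF \<alpha>] unfolding sums_def by (rule tendsto_rabs)
  then show ?thesis by (rule LIMSEQ_le_const2) (use partial_E_bound[OF \<alpha>] in auto)
qed

lemma mass_E_tot_bound: "0 \<le> \<alpha> \<Longrightarrow> (mass q \<alpha>)\<^sup>2 * exp (\<alpha> * mass q \<alpha>) \<le> tot\<^sup>2 * exp (\<alpha> * tot)"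
  using mass_nonneg mass_le_tot tot_nonneg by (intro mult_mono power_mono) (auto intro: mult_left_mono)

text \<open>Only V_0 jumps, at s = y; the later kernels are locally Lipschitz in time.\<close>

lemma isCont_V:
  assumes y: "0 \<le> y" and s: "n = 0 \<Longrightarrow> s \<noteq> y"
  shows "isCont (V n y) s"
proof (cases n)
  case 0
  then consider "s < y" | "y < s" using s by linarith
  then show ?thesis
  proof cases
    case 1
    have "\<forall>\<^sub>F t in nhds s. V n y t = 0"
      using eventually_nhds_in_open[of "{..<y}" s] 1 0 by (auto elim!: eventually_mono)
    then show ?thesis by (subst isCont_cong[where g="\<lambda>_. 0"]) auto
  next
    case 2
    have "\<forall>\<^sub>F t in nhds s. V n y t = 1"
      using eventually_nhds_in_open[of "{y<..}" s] 2 0 by (auto elim!: eventually_mono)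
    then show ?thesis by (subst isCont_cong[where g="\<lambda>_. 1"]) auto
  qed
next
  case (Suc j)
  define S where "S = \<bar>s\<bar> + 1"
  define L where "L = tot / 2 * ((S * tot / 2) ^ j / fact j)"
  have S: "S \<ge> 0" by (simp add: S_def)
  have L: "L \<ge> 0" using tot_nonneg S by (simp add: L_def)
  have "L-lipschitz_on {..S} (V n y)"
  proof (rule lipschitz_onI[OF _ L])
    fix a b assume "a \<in> {..S}" "b \<in> {..S}"
    then show "dist (V n y a) (V n y b) \<le> L * dist a b"
      using V_lipschitz[of y a b S j] V_lipschitz[of y b a S j] y S unfolding Suc L_def[symmetric]
      by (cases "a \<le> b") (auto simp: dist_real_def abs_minus_commute mult.commute)
  qed
  then have "continuous_on {..S} (V n y)" by (rule lipschitz_on_continuous_on)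
  then have "continuous_on {..<S} (V n y)" by (rule continuous_on_subset) auto
  then show ?thesis by (simp add: continuous_on_eq_continuous_at S_def)
qed

text \<open>Dominated convergence under the y-integral. At t = x it would fail for n = 0: the direct
  wave then meets the jump of V_0 for every y < x.\<close>

lemma isCont_k:
  assumes x: "0 \<le> x" and t: "t \<noteq> x"
  shows "isCont (k n x) t"
  unfolding continuous_at_sequentially
proof (intro allI impI)
  fix T :: "nat \<Rightarrow> real" assume T: "T \<longlonglongrightarrow> t"
  obtain M where M: "\<And>i. \<bar>T i\<bar> \<le> M" using convergent_imp_Bseq[OF convergentI[OF T]] by (auto simp: Bseq_def)
  then have M0: "M \<ge> 0" by (meson abs_ge_zero order_trans)
  have "(\<lambda>i. LINT y|lborel. q y * (V n y (T i - \<bar>x - y\<bar>) - V n y (T i - x - y))) \<longlonglongrightarrow>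
      (LINT y|lborel. q y * (V n y (t - \<bar>x - y\<bar>) - V n y (t - x - y)))"
  proof (rule integral_dominated_convergence[where w="\<lambda>y. \<bar>q y\<bar> * exp (M * tot / 2)"])
    show "integrable lborel (\<lambda>y. \<bar>q y\<bar> * exp (M * tot / 2))" by (rule q_abs_mult_integrable)
    show "AE y in lborel. norm (q y * (V n y (T i - \<bar>x - y\<bar>) - V n y (T i - x - y))) \<le> \<bar>q y\<bar> * exp (M * tot / 2)" for i
      unfolding real_norm_def by (intro AE_I2 q_mult_bound V_diff_tot) (use x M[of i] M0 in auto)
    \<comment> \<open>For t different from x these are the only points where a shifted time can
      equal y, the position of the jump.\<close>
    have "AE y in lborel. y \<noteq> (t + x) / 2" "AE y in lborel. y \<noteq> (t - x) / 2"
      by (rule AE_lborel_singleton)+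
    then show "AE y in lborel. (\<lambda>i. q y * (V n y (T i - \<bar>x - y\<bar>) - V n y (T i - x - y))) \<longlonglongrightarrow> q y * (V n y (t - \<bar>x - y\<bar>) - V n y (t - x - y))"
    proof eventually_elim
      fix y assume y: "y \<noteq> (t + x) / 2" "y \<noteq> (t - x) / 2"
      show "(\<lambda>i. q y * (V n y (T i - \<bar>x - y\<bar>) - V n y (T i - x - y))) \<longlonglongrightarrow> q y * (V n y (t - \<bar>x - y\<bar>) - V n y (t - x - y))"
      proof (cases "y \<le> 0")
        case False
        have "isCont (V n y) (t - \<bar>x - y\<bar>)" "isCont (V n y) (t - x - y)"
          by (rule isCont_V; use False y t in \<open>auto simp: abs_if field_simps\<close>)+
        then show ?thesis
          by (intro tendsto_mult tendsto_diff tendsto_const isCont_tendsto_compose[of _ "V n y"] T)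
      qed (simp add: q_zero)
    qed
  qed measurable
  then show "(k n x \<circ> T) \<longlonglongrightarrow> k n x t" unfolding o_def wave_step_def by (intro tendsto_divide) auto
qed

lemma k_diagonal_bound:
  assumes "0 \<le> x" "\<alpha> \<le> M"
  shows "\<bar>k n x (2 * \<alpha> - x)\<bar> \<le> tot / 2 * exp (M * tot)"
proof (cases "2 * \<alpha> - x < 0")
  case True
  then show ?thesis using k_support[of x "2 * \<alpha> - x" n] assms tot_nonneg by simp
next
  case False
  have "(2 * \<alpha> - x) * tot \<le> (2 * M) * tot" using assms tot_nonneg by (intro mult_right_mono) auto
  then have "tot / 2 * exp ((2 * \<alpha> - x) * tot / 2) \<le> tot / 2 * exp (M * tot)"
    using tot_nonneg by (intro mult_left_mono) auto
  then show ?thesis using k_tot[of x "2 * \<alpha> - x" n] False assms(1) by linarith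
qed

text \<open>Along t = 2 \<alpha> - x the discontinuity t = x of \<open>k n x\<close> is met only at
  x = \<alpha>, a null set in the x-integral.\<close>

lemma isCont_E_term: "isCont (E_term n) \<alpha>"
  unfolding continuous_at_sequentially
proof (intro allI impI)
  fix T :: "nat \<Rightarrow> real" assume T: "T \<longlonglongrightarrow> \<alpha>"
  obtain M where M: "\<And>i. \<bar>T i\<bar> \<le> M" using convergent_imp_Bseq[OF convergentI[OF T]] by (auto simp: Bseq_def)
  have "(\<lambda>i. LINT x|lborel. q x * k n x (2 * T i - x)) \<longlonglongrightarrow> (LINT x|lborel. q x * k n x (2 * \<alpha> - x))"
  proof (rule integral_dominated_convergence[where w="\<lambda>x. \<bar>q x\<bar> * (tot / 2 * exp (M * tot))"])
    show "integrable lborel (\<lambda>x. \<bar>q x\<bar> * (tot / 2 * exp (M * tot)))" by (rule q_abs_mult_integrable)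
    show "AE x in lborel. norm (q x * k n x (2 * T i - x)) \<le> \<bar>q x\<bar> * (tot / 2 * exp (M * tot))" for i
      unfolding real_norm_def by (intro AE_I2 q_mult_bound k_diagonal_bound) (use M[of i] in auto)
    have "AE x in lborel. x \<noteq> \<alpha>" by (rule AE_lborel_singleton)
    then show "AE x in lborel. (\<lambda>i. q x * k n x (2 * T i - x)) \<longlonglongrightarrow> q x * k n x (2 * \<alpha> - x)"
    proof eventually_elim
      fix x assume x: "x \<noteq> \<alpha>"
      show "(\<lambda>i. q x * k n x (2 * T i - x)) \<longlonglongrightarrow> q x * k n x (2 * \<alpha> - x)"
      proof (cases "x \<le> 0")
        case False
        have "isCont (k n x) (2 * \<alpha> - x)" by (rule isCont_k) (use False x in auto)
        then show ?thesis
          by (intro tendsto_mult tendsto_diff tendsto_const isCont_tendsto_compose[of _ "k n x"] T)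
      qed (simp add: q_zero)
    qed
  qed measurable
  then show "(E_term n \<circ> T) \<longlonglongrightarrow> E_term n \<alpha>" unfolding o_def E_term_def by (intro tendsto_mult) auto
qed

lemma continuous_on_E: "continuous_on {0..R} E"
proof -
  have "uniform_limit {0..R} (\<lambda>N \<alpha>. \<Sum>n<N. (- 1) ^ Suc n * E_term n \<alpha>) (\<lambda>\<alpha>. \<Sum>n. (- 1) ^ Suc n * E_term n \<alpha>) sequentially"
  proof (rule Weierstrass_m_test[OF _ summable_exp_series[of "tot\<^sup>2" "\<bar>R\<bar> * tot"]])
    fix n \<alpha> assume \<alpha>: "\<alpha> \<in> {0..R}"
    have "\<bar>E_term n \<alpha>\<bar> \<le> (mass q \<alpha>)\<^sup>2 * ((\<alpha> * mass q \<alpha>) ^ n / fact n)" by (rule E_term_bound) (use \<alpha> in auto)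
    also have "\<dots> \<le> tot\<^sup>2 * ((\<bar>R\<bar> * tot) ^ n / fact n)"
      using \<alpha> mass_nonneg[of \<alpha>] mass_le_tot[of \<alpha>] tot_nonneg
      by (intro mult_mono power_mono divide_right_mono) auto
    finally show "norm ((- 1) ^ Suc n * E_term n \<alpha>) \<le> tot\<^sup>2 * ((\<bar>R\<bar> * tot) ^ n / fact n)"
      by (simp add: abs_mult)
  qed
  moreover have "continuous_on {0..R} (E_term n)" for n
    by (simp add: continuous_at_imp_continuous_on isCont_E_term)
  then have "continuous_on {0..R} (\<lambda>\<alpha>. \<Sum>n<N. (- 1) ^ Suc n * E_term n \<alpha>)" for N
    by (intro continuous_on_sum continuous_on_mult continuous_on_const)
  ultimately show ?thesis unfolding E_def[abs_def]
    by (intro uniform_limit_theorem[where F=sequentially]) (auto intro: always_eventually)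
qed

end

context half_line_laplace
begin

text \<open>Fubini and the substitution \<alpha> = (x + t) / 2. The part with \<alpha> < x / 2
  corresponds to t < 0, where \<open>k n x\<close> vanishes.\<close>

lemma laplace_E_term:
  "(LINT \<alpha>|lborel. indicator {0..} \<alpha> * exp (- 2 * \<alpha> * \<kappa>) * E_term n \<alpha>) = (LINT x|lborel. q x * exp (- \<kappa> * x) * Vhat (Suc n) x)"
proof -
  define f where "f x \<alpha> = indicator {0..} \<alpha> * exp (- 2 * \<alpha> * \<kappa>) * (2 * (q x * k n x (2 * \<alpha> - x)))" for x \<alpha> :: real
  have dp: "2 * decay > 0" using decay_pos by simp
  have fb: "\<bar>f x \<alpha>\<bar> \<le> (\<bar>q x\<bar> * tot) * (indicator {0..} \<alpha> * exp (- (2 * decay) * \<alpha>))" for x \<alpha>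
  proof (cases "x \<le> 0 \<or> \<alpha> < 0")
    case True
    then show ?thesis by (auto simp: f_def q_zero)
  next
    case False
    have kb: "\<bar>k n x (2 * \<alpha> - x)\<bar> \<le> tot / 2 * exp (\<alpha> * tot)"
      by (rule k_diagonal_bound) (use False in auto)
    have "\<bar>f x \<alpha>\<bar> = (2 * \<bar>q x\<bar> * exp (- 2 * \<alpha> * \<kappa>)) * \<bar>k n x (2 * \<alpha> - x)\<bar>"
      using False by (simp add: f_def abs_mult)
    also have "\<dots> \<le> (2 * \<bar>q x\<bar> * exp (- 2 * \<alpha> * \<kappa>)) * (tot / 2 * exp (\<alpha> * tot))"
      by (intro mult_left_mono kb) auto
    also have "\<dots> = \<bar>q x\<bar> * tot * (exp (- 2 * \<alpha> * \<kappa>) * exp (\<alpha> * tot))" by simp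
    also have "exp (- 2 * \<alpha> * \<kappa>) * exp (\<alpha> * tot) = exp (- (2 * decay) * \<alpha>)"
      by (simp add: decay_def algebra_simps flip: exp_add)
    finally show ?thesis using False by simp
  qed
  have m1: "(\<lambda>\<alpha>. f x \<alpha>) \<in> borel_measurable borel" for x unfolding f_def by measurable
  have ib: "integrable lborel (\<lambda>\<alpha>. (\<bar>q x\<bar> * tot) * (indicator {0..} \<alpha> * exp (- (2 * decay) * \<alpha>)))" for x
    by (intro integrable_mult_right exp_half_line(1) dp)
  have int: "integrable lborel (f x)" for x
    by (rule integrable_abs_bound[OF ib _ fb]) (simp add: m1)
  have 1: "(LINT \<alpha>|lborel. f x \<alpha>) = q x * exp (- \<kappa> * x) * Vhat (Suc n) x" for x
  proof (cases "x \<le> 0")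
    case False
    have "(LINT \<alpha>|lborel. f x \<alpha>) = 1 / 2 * (LINT t|lborel. f x (x / 2 + 1 / 2 * t))"
      using lborel_integral_real_affine[of "1/2" "f x" "x / 2"] by simp
    also have "(\<lambda>t. f x (x / 2 + 1 / 2 * t)) = (\<lambda>t. (2 * q x * exp (- \<kappa> * x)) * (indicator {0..} t * exp (- \<kappa> * t) * k n x t))"
    proof
      fix t
      have e: "exp (- 2 * (x / 2 + 1 / 2 * t) * \<kappa>) = exp (- \<kappa> * x) * exp (- \<kappa> * t)"
        by (simp add: algebra_simps flip: exp_add)
      have tt: "2 * (x / 2 + 1 / 2 * t) - x = t" by simp
      show "f x (x / 2 + 1 / 2 * t) = (2 * q x * exp (- \<kappa> * x)) * (indicator {0..} t * exp (- \<kappa> * t) * k n x t)"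
      proof (cases "t \<ge> 0")
        case True
        then show ?thesis unfolding f_def e tt using False by simp
      next
        case 2: False
        then show ?thesis unfolding f_def e tt using False k_support[of x t n] by simp
      qed
    qed
    also have "1 / 2 * (LINT t|lborel. (2 * q x * exp (- \<kappa> * x)) * (indicator {0..} t * exp (- \<kappa> * t) * k n x t)) = 
        q x * exp (- \<kappa> * x) * (LINT t|lborel. indicator {0..} t * exp (- \<kappa> * t) * k n x t)"
      unfolding integral_mult_right_zero by simp
    finally show ?thesis using Vhat_Suc[of x n] False by simp
  qed (simp add: f_def q_zero)
  have "(LINT \<alpha>|lborel. LINT x|lborel. f x \<alpha>) = (LINT x|lborel. LINT \<alpha>|lborel. f x \<alpha>)"
  proof (rule fubini_lborel[OF _ int])
    show "(\<lambda>p. f (fst p) (snd p)) \<in> borel_measurable borel"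
      unfolding f_def borel_prod[symmetric] by measurable
    show "integrable lborel (\<lambda>x. (\<bar>q x\<bar> * tot) * (1 / (2 * decay)))"
      unfolding mult.assoc by (rule q_abs_mult_integrable)
    fix x
    have "(LINT \<alpha>|lborel. \<bar>f x \<alpha>\<bar>) \<le> (LINT \<alpha>|lborel. (\<bar>q x\<bar> * tot) * (indicator {0..} \<alpha> * exp (- (2 * decay) * \<alpha>)))"
      by (rule integral_mono[OF integrable_abs[OF int] ib fb])
    also have "\<dots> = (\<bar>q x\<bar> * tot) * (exp (- (2 * decay) * 0) / (2 * decay))"
      unfolding integral_mult_right_zero exp_half_line(2)[OF dp] ..
    finally show "(LINT \<alpha>|lborel. \<bar>f x \<alpha>\<bar>) \<le> (\<bar>q x\<bar> * tot) * (1 / (2 * decay))" by simp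
  qed
  moreover have "(LINT x|lborel. f x \<alpha>) = indicator {0..} \<alpha> * exp (- 2 * \<alpha> * \<kappa>) * E_term n \<alpha>" for \<alpha>
    unfolding f_def integral_mult_right_zero E_term_def ..
  ultimately show ?thesis unfolding 1 by simp
qed

lemma laplace_dominant: "integrable lborel (\<lambda>\<alpha>. tot\<^sup>2 * (indicator {0..} \<alpha> * exp (- (2 * decay) * \<alpha>)))"
  by (intro integrable_mult_right exp_half_line(1)) (use decay_pos in simp)

lemma laplace_abs_le:
  assumes "\<And>\<alpha>. 0 \<le> \<alpha> \<Longrightarrow> \<bar>g \<alpha>\<bar> \<le> tot\<^sup>2 * exp (\<alpha> * tot)"
  shows "\<bar>indicator {0..} \<alpha> * exp (- 2 * \<alpha> * \<kappa>) * g \<alpha>\<bar> \<le> tot\<^sup>2 * (indicator {0..} \<alpha> * exp (- (2 * decay) * \<alpha>))"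
proof (cases "\<alpha> \<ge> 0")
  case True
  have "exp (- 2 * \<alpha> * \<kappa>) * \<bar>g \<alpha>\<bar> \<le> exp (- 2 * \<alpha> * \<kappa>) * (tot\<^sup>2 * exp (\<alpha> * tot))"
    using assms[OF True] by (intro mult_left_mono) auto
  also have "\<dots> = tot\<^sup>2 * (exp (- 2 * \<alpha> * \<kappa>) * exp (\<alpha> * tot))" by simp
  also have "exp (- 2 * \<alpha> * \<kappa>) * exp (\<alpha> * tot) = exp (- (2 * decay) * \<alpha>)"
    by (simp add: decay_def algebra_simps flip: exp_add)
  finally show ?thesis using True by (simp add: abs_mult)
qed simp

lemma E_tot_bound: "0 \<le> \<alpha> \<Longrightarrow> \<bar>E \<alpha>\<bar> \<le> tot\<^sup>2 * exp (\<alpha> * tot)"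
  using E_bound mass_E_tot_bound order_trans by blast

lemma laplace_E_integrable: "integrable lborel (\<lambda>\<alpha>. indicator {0..} \<alpha> * exp (- 2 * \<alpha> * \<kappa>) * E \<alpha>)"
  by (rule integrable_abs_bound[OF laplace_dominant _ laplace_abs_le[OF E_tot_bound]]) measurable

text \<open>Both sides are limits of partial sums that agree by \<open>laplace_E_term\<close>. The
  dominating functions come from the exponential series on the left and from the geometric series on
  the right; subtracting exp(- \<kappa> x) removes the term of V_0.\<close>

lemma laplace_E:
  "(LINT \<alpha>|lborel. indicator {0..} \<alpha> * exp (- 2 * \<alpha> * \<kappa>) * E \<alpha>) = (LINT x|lborel. q x * exp (- \<kappa> * x) * (\<psi> x - exp (- \<kappa> * x)))"
proof -
  have 1: "(\<lambda>N. LINT \<alpha>|lborel. indicator {0..} \<alpha> * exp (- 2 * \<alpha> * \<kappa>) * (\<Sum>n<N. (- 1) ^ Suc n * E_term n \<alpha>)) \<longlonglongrightarrow>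
     (LINT \<alpha>|lborel. indicator {0..} \<alpha> * exp (- 2 * \<alpha> * \<kappa>) * E \<alpha>)"
  proof (rule integral_dominated_convergence[OF _ _ laplace_dominant])
    show "AE \<alpha> in lborel. norm (indicator {0..} \<alpha> * exp (- 2 * \<alpha> * \<kappa>) * (\<Sum>n<N. (- 1) ^ Suc n * E_term n \<alpha>)) \<le> tot\<^sup>2 * (indicator {0..} \<alpha> * exp (- (2 * decay) * \<alpha>))" for N
      unfolding real_norm_def
      by (intro AE_I2 laplace_abs_le order_trans[OF partial_E_bound mass_E_tot_bound])
    show "AE \<alpha> in lborel. (\<lambda>N. indicator {0..} \<alpha> * exp (- 2 * \<alpha> * \<kappa>) * (\<Sum>n<N. (- 1) ^ Suc n * E_term n \<alpha>)) \<longlonglongrightarrow> indicator {0..} \<alpha> * exp (- 2 * \<alpha> * \<kappa>) * E \<alpha>"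
    proof (rule AE_I2)
      fix \<alpha> :: real
      show "(\<lambda>N. indicator {0..} \<alpha> * exp (- 2 * \<alpha> * \<kappa>) * (\<Sum>n<N. (- 1) ^ Suc n * E_term n \<alpha>)) \<longlonglongrightarrow> indicator {0..} \<alpha> * exp (- 2 * \<alpha> * \<kappa>) * E \<alpha>"
      proof (cases "\<alpha> \<ge> 0")
        case True
        then show ?thesis using E_term_sums[OF True] unfolding sums_def by (intro tendsto_mult tendsto_const)
      qed simp
    qed
  qed measurable
  have 2: "(\<lambda>N. LINT x|lborel. q x * exp (- \<kappa> * x) * (\<Sum>n<N. (- 1) ^ Suc n * Vhat (Suc n) x)) \<longlonglongrightarrow>
     (LINT x|lborel. q x * exp (- \<kappa> * x) * (\<psi> x - exp (- \<kappa> * x)))"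
  proof (rule integral_dominated_convergence[where w="\<lambda>x. \<bar>q x\<bar> * 2"])
    show "integrable lborel (\<lambda>x. \<bar>q x\<bar> * 2)" by (rule q_abs_mult_integrable)
    have "\<bar>exp (- \<kappa> * x) * (\<Sum>n<N. (- 1) ^ Suc n * Vhat (Suc n) x)\<bar> \<le> 2" if x: "0 < x" for x N
    proof -
      have e1: "exp (- \<kappa> * x) \<le> 1" using x \<kappa>_pos by simp
      have "\<bar>(- 1) ^ Suc n * Vhat (Suc n) x\<bar> \<le> \<rho> ^ n * 1" for n
      proof -
        have "\<bar>(- 1) ^ Suc n * Vhat (Suc n) x\<bar> = \<bar>Vhat (Suc n) x\<bar>" by (simp add: abs_mult)
        also have "\<dots> \<le> \<rho> ^ Suc n * exp (- \<kappa> * x)" using Vhat_bound[of x "Suc n"] x by simp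
        also have "\<dots> \<le> \<rho> ^ n * 1" using \<rho> e1 by (intro mult_mono power_decreasing) auto
        finally show ?thesis .
      qed
      then have "\<bar>\<Sum>n<N. (- 1) ^ Suc n * Vhat (Suc n) x\<bar> \<le> (\<Sum>n<N. \<rho> ^ n * 1)"
        by (intro order_trans[OF sum_abs sum_mono])
      also have "\<dots> \<le> (\<Sum>n. \<rho> ^ n * 1)" by (rule sum_le_suminf[OF summable_\<rho>]) (use \<rho> in auto)
      also have "\<dots> \<le> 2" using \<rho> by (simp add: suminf_geometric) (simp add: field_simps)
      finally have b: "\<bar>\<Sum>n<N. (- 1) ^ Suc n * Vhat (Suc n) x\<bar> \<le> 2" .
      have "exp (- \<kappa> * x) * \<bar>\<Sum>n<N. (- 1) ^ Suc n * Vhat (Suc n) x\<bar> \<le> 1 * 2"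
        using b e1 by (intro mult_mono) auto
      then show ?thesis by (simp add: abs_mult)
    qed
    then show "AE x in lborel. norm (q x * exp (- \<kappa> * x) * (\<Sum>n<N. (- 1) ^ Suc n * Vhat (Suc n) x)) \<le> \<bar>q x\<bar> * 2" for N
      unfolding real_norm_def mult.assoc[of "q _"] by (intro AE_I2 q_mult_bound)
    show "AE x in lborel. (\<lambda>N. q x * exp (- \<kappa> * x) * (\<Sum>n<N. (- 1) ^ Suc n * Vhat (Suc n) x)) \<longlonglongrightarrow> q x * exp (- \<kappa> * x) * (\<psi> x - exp (- \<kappa> * x))"
    proof (rule AE_I2)
      fix x
      show "(\<lambda>N. q x * exp (- \<kappa> * x) * (\<Sum>n<N. (- 1) ^ Suc n * Vhat (Suc n) x)) \<longlonglongrightarrow> q x * exp (- \<kappa> * x) * (\<psi> x - exp (- \<kappa> * x))"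
      proof (cases "x \<le> 0")
        case False
        then have x: "0 \<le> x" by simp
        have "(\<lambda>n. (- 1) ^ Suc n * Vhat (Suc n) x) sums (\<psi> x - (- 1) ^ 0 * Vhat 0 x)"
          unfolding sums_Suc_iff[of "\<lambda>n. (- 1) ^ n * Vhat n x"] \<psi>_def
          using summable_sums[OF Vhat_summable[OF x]] by simp
        then have "(\<lambda>N. \<Sum>n<N. (- 1) ^ Suc n * Vhat (Suc n) x) \<longlonglongrightarrow> \<psi> x - exp (- \<kappa> * x)"
          unfolding sums_def Vhat_0[OF x] by simp
        then show ?thesis by (intro tendsto_mult tendsto_const)
      qed (simp add: q_zero)
    qed
  qed measurable
  have iE: "integrable lborel (\<lambda>\<alpha>. indicator {0..} \<alpha> * exp (- 2 * \<alpha> * \<kappa>) * E_term n \<alpha>)" for n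
  proof (rule integrable_abs_bound[OF laplace_dominant _ laplace_abs_le])
    fix \<alpha> :: real assume \<alpha>: "0 \<le> \<alpha>"
    have "(mass q \<alpha>)\<^sup>2 * ((\<alpha> * mass q \<alpha>) ^ n / fact n) \<le> (mass q \<alpha>)\<^sup>2 * exp (\<alpha> * mass q \<alpha>)"
      using \<alpha> mass_nonneg by (intro mult_left_mono power_div_fact_le_exp) auto
    then show "\<bar>E_term n \<alpha>\<bar> \<le> tot\<^sup>2 * exp (\<alpha> * tot)" using E_term_bound[OF \<alpha>, of n] mass_E_tot_bound[OF \<alpha>] by linarith
  qed measurable
  have iA: "integrable lborel (\<lambda>x. q x * exp (- \<kappa> * x) * Vhat (Suc n) x)" for n
    unfolding mult.assoc
  proof (rule q_mult_integrable)
    fix x :: real assume x: "0 < x"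
    have e1: "exp (- \<kappa> * x) \<le> 1" using x \<kappa>_pos by simp
    have "\<bar>Vhat (Suc n) x\<bar> \<le> \<rho> ^ Suc n * exp (- \<kappa> * x)" using Vhat_bound[of x "Suc n"] x by simp
    also have "\<dots> \<le> 1 * 1" using \<rho> e1 by (intro mult_mono power_le_one) auto
    finally have "exp (- \<kappa> * x) * \<bar>Vhat (Suc n) x\<bar> \<le> 1 * 1" using e1 by (intro mult_mono) auto
    then show "\<bar>exp (- \<kappa> * x) * Vhat (Suc n) x\<bar> \<le> 1" by (simp add: abs_mult)
  qed measurable
  have "(LINT \<alpha>|lborel. indicator {0..} \<alpha> * exp (- 2 * \<alpha> * \<kappa>) * (\<Sum>n<N. (- 1) ^ Suc n * E_term n \<alpha>)) =
     (LINT x|lborel. q x * exp (- \<kappa> * x) * (\<Sum>n<N. (- 1) ^ Suc n * Vhat (Suc n) x))" for N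
  proof -
    have "(LINT \<alpha>|lborel. indicator {0..} \<alpha> * exp (- 2 * \<alpha> * \<kappa>) * (\<Sum>n<N. (- 1) ^ Suc n * E_term n \<alpha>)) =
       (LINT \<alpha>|lborel. (\<Sum>n<N. (- 1) ^ Suc n * (indicator {0..} \<alpha> * exp (- 2 * \<alpha> * \<kappa>) * E_term n \<alpha>)))"
      by (simp add: sum_distrib_left mult_ac)
    also have "\<dots> = (\<Sum>n<N. (- 1) ^ Suc n * (LINT \<alpha>|lborel. indicator {0..} \<alpha> * exp (- 2 * \<alpha> * \<kappa>) * E_term n \<alpha>))"
      using iE by (subst Bochner_Integration.integral_sum) (auto intro!: integrable_mult_right)
    also have "\<dots> = (\<Sum>n<N. (- 1) ^ Suc n * (LINT x|lborel. q x * exp (- \<kappa> * x) * Vhat (Suc n) x))"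
      by (simp only: laplace_E_term)
    also have "\<dots> = (LINT x|lborel. (\<Sum>n<N. (- 1) ^ Suc n * (q x * exp (- \<kappa> * x) * Vhat (Suc n) x)))"
      using iA by (subst Bochner_Integration.integral_sum) (auto intro!: integrable_mult_right)
    also have "\<dots> = (LINT x|lborel. q x * exp (- \<kappa> * x) * (\<Sum>n<N. (- 1) ^ Suc n * Vhat (Suc n) x))"
      by (simp add: sum_distrib_left mult_ac)
    finally show ?thesis .
  qed
  with 1 2 show ?thesis using LIMSEQ_unique by simp
qed

end

section \<open>Dependence on the potential and the exact solution\<close>

text \<open>Domain of dependence: for y < r the shifted times stay in the region y + s <= 2 r, where
  induction applies, and for y > r all shifted kernels vanish by finite speed.\<close>

lemma kernel_cong:
  assumes H1: "half_line q1" and H2: "half_line q2"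
    and eq: "AE y in lborel. y < r \<longrightarrow> q1 y = q2 y"
  shows "\<And>y s. \<lbrakk>0 \<le> y; y + s \<le> 2 * r\<rbrakk> \<Longrightarrow> wave_kernel q1 n y s = wave_kernel q2 n y s"
    and "\<And>x t. \<lbrakk>0 \<le> x; x + t \<le> 2 * r\<rbrakk> \<Longrightarrow> wave_step q1 (wave_kernel q1 n) x t = wave_step q2 (wave_kernel q2 n) x t"
proof -
  interpret h1: half_line q1 by fact
  interpret h2: half_line q2 by fact
  have step: "wave_step q1 (wave_kernel q1 n) x t = wave_step q2 (wave_kernel q2 n) x t"
    if V: "\<And>y s. \<lbrakk>0 \<le> y; y + s \<le> 2 * r\<rbrakk> \<Longrightarrow> wave_kernel q1 n y s = wave_kernel q2 n y s" and x: "0 \<le> x" "x + t \<le> 2 * r" for n x t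
  proof -
    have "(LINT y|lborel. q1 y * (wave_kernel q1 n y (t - \<bar>x - y\<bar>) - wave_kernel q1 n y (t - x - y))) = 
          (LINT y|lborel. q2 y * (wave_kernel q2 n y (t - \<bar>x - y\<bar>) - wave_kernel q2 n y (t - x - y)))"
    proof (rule integral_cong_AE)
      have "AE y in lborel. y \<noteq> r" by (rule AE_lborel_singleton)
      with eq show "AE y in lborel. q1 y * (wave_kernel q1 n y (t - \<bar>x - y\<bar>) - wave_kernel q1 n y (t - x - y)) = 
          q2 y * (wave_kernel q2 n y (t - \<bar>x - y\<bar>) - wave_kernel q2 n y (t - x - y))"
      proof eventually_elim
        fix y assume y: "y < r \<longrightarrow> q1 y = q2 y" "y \<noteq> r"
        consider "y \<le> 0" | "0 < y" "y < r" | "0 < y" "r < y" using y(2) by linarith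
        then show "q1 y * (wave_kernel q1 n y (t - \<bar>x - y\<bar>) - wave_kernel q1 n y (t - x - y)) = 
          q2 y * (wave_kernel q2 n y (t - \<bar>x - y\<bar>) - wave_kernel q2 n y (t - x - y))"
        proof cases
          case 1
          then show ?thesis by (simp add: h1.q_zero h2.q_zero)
        next
          case 2
          then show ?thesis using y V[of y "t - \<bar>x - y\<bar>"] V[of y "t - x - y"] x by simp
        next
          case 3
          then have "t - \<bar>x - y\<bar> < y" "t - x - y < y" using x by (auto simp: abs_if)
          then show ?thesis using h1.V_support h2.V_support 3 by simp
        qed
      qed
    qed (measurable, measurable)
    then show ?thesis by (simp add: wave_step_def)
  qed
  have V: "0 \<le> y \<Longrightarrow> y + s \<le> 2 * r \<Longrightarrow> wave_kernel q1 n y s = wave_kernel q2 n y s" for n y s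
  proof (induction n arbitrary: y s)
    case (Suc n)
    have "indicator {0..s} t * wave_step q1 (wave_kernel q1 n) y t = indicator {0..s} t * wave_step q2 (wave_kernel q2 n) y t" for t
      using step[OF Suc.IH, of y t] Suc.prems by (auto simp: indicator_def)
    then show ?case by (simp only: wave_kernel.simps)
  qed simp
  show "\<And>y s. \<lbrakk>0 \<le> y; y + s \<le> 2 * r\<rbrakk> \<Longrightarrow> wave_kernel q1 n y s = wave_kernel q2 n y s" by (rule V)
  show "\<And>x t. \<lbrakk>0 \<le> x; x + t \<le> 2 * r\<rbrakk> \<Longrightarrow> wave_step q1 (wave_kernel q1 n) x t = wave_step q2 (wave_kernel q2 n) x t" by (rule step[OF V])
qed

text \<open>The points (x, t) that enter E(\<alpha>) satisfy x + t = 2 \<alpha> <= 2 r, so they lie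
  in the domain of dependence.\<close>

lemma E_cong:
  assumes H1: "half_line q1" and H2: "half_line q2"
    and eq: "AE y in lborel. y < r \<longrightarrow> q1 y = q2 y" and \<alpha>: "\<alpha> \<le> r"
  shows "half_line.E q1 \<alpha> = half_line.E q2 \<alpha>"
proof -
  interpret h1: half_line q1 by fact
  interpret h2: half_line q2 by fact
  have "(LINT x|lborel. q1 x * wave_step q1 (wave_kernel q1 n) x (2 * \<alpha> - x)) = (LINT x|lborel. q2 x * wave_step q2 (wave_kernel q2 n) x (2 * \<alpha> - x))" for n
  proof (rule integral_cong_AE)
    have "AE y in lborel. y \<noteq> r" by (rule AE_lborel_singleton)
    with eq show "AE x in lborel. q1 x * wave_step q1 (wave_kernel q1 n) x (2 * \<alpha> - x) = q2 x * wave_step q2 (wave_kernel q2 n) x (2 * \<alpha> - x)"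
    proof eventually_elim
      fix x assume x: "x < r \<longrightarrow> q1 x = q2 x" "x \<noteq> r"
      consider "x \<le> 0" | "0 < x" "x < r" | "0 < x" "r < x" using x(2) by linarith
      then show "q1 x * wave_step q1 (wave_kernel q1 n) x (2 * \<alpha> - x) = q2 x * wave_step q2 (wave_kernel q2 n) x (2 * \<alpha> - x)"
      proof cases
        case 1
        then show ?thesis by (simp add: h1.q_zero h2.q_zero)
      next
        case 2
        then show ?thesis using x kernel_cong(2)[OF H1 H2 eq, of x "2 * \<alpha> - x" n] \<alpha> by simp
      next
        case 3
        then show ?thesis using h1.k_support[of x "2 * \<alpha> - x" n] h2.k_support[of x "2 * \<alpha> - x" n] \<alpha> by simp
      qed
    qed
  qed (measurable, measurable)
  then have "h1.E_term n \<alpha> = h2.E_term n \<alpha>" for n by (simp add: h1.E_term_def h2.E_term_def)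
  then show ?thesis by (simp add: h1.E_def h2.E_def)
qed

lemma integrable_lborel_imp:
  fixes f :: "real \<Rightarrow> real"
  assumes f: "integrable lborel f"
  shows "f absolutely_integrable_on {a..b}" 
    and "(\<And>y. y \<notin> {a..b} \<Longrightarrow> f y = 0) \<Longrightarrow> (LINT y|lborel. f y) = integral {a..b} f"
proof -
  have "integrable lebesgue f" using f by (simp add: integrable_completion)
  then have ai: "f absolutely_integrable_on UNIV" by (simp add: set_integrable_def)
  then show "f absolutely_integrable_on {a..b}" by (rule set_integrable_subset) auto
  assume z: "\<And>y. y \<notin> {a..b} \<Longrightarrow> f y = 0"
  have "(LINT y|lborel. f y) = integral UNIV f" by (rule integral_lborel[OF f, symmetric])
  also have "\<dots> = integral {a..b} f"
  proof -
    have "(\<lambda>y. if y \<in> {a..b} then f y else 0) = f" using z by auto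
    then show ?thesis using integral_restrict_UNIV[of "{a..b}" f] by simp
  qed
  finally show "(LINT y|lborel. f y) = integral {a..b} f" .
qed

context half_line_laplace
begin

lemma q_exp_integrable: "integrable lborel (\<lambda>y. q y * exp (- 2 * y * \<kappa>))"
  by (rule q_mult_integrable[of _ 1]) (use \<kappa>_pos in auto)

text \<open>Splitting the Green's function at y = x gives a variation-of-constants formula, which
  can be differentiated twice by the product rule for primitives. At a only multiples of exp(-
  \<kappa> x) remain, and at 0 the formula reads \<psi>'(0) = - \<kappa> - R, with R the integral of
  q \<psi> exp(- \<kappa> y).\<close>

lemma \<psi>_sol:
  assumes a: "a > 0" and q_a: "\<And>y. y \<ge> a \<Longrightarrow> q y = 0"
  obtains \<psi>' where "is_real_sol a (\<lambda>x. q x + \<kappa>\<^sup>2) \<psi> \<psi>'" "\<psi> 0 = 1" "\<psi>' a = - \<kappa> * \<psi> a"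
    "\<psi>' 0 = - \<kappa> - (LINT \<alpha>|lborel. q \<alpha> * exp (- 2 * \<alpha> * \<kappa>)) - (LINT \<alpha>|lborel. indicator {0..} \<alpha> * exp (- 2 * \<alpha> * \<kappa>) * E \<alpha>)"
proof -
  define f where "f y = q y * \<psi> y" for y
  have f0: "f y = 0" if "y \<notin> {0..a}" for y using that q_zero[of y] q_a[of y] by (auto simp: f_def)
  have fi: "integrable lborel f"
    unfolding f_def[abs_def]
  proof (rule q_mult_integrable)
    fix y :: real assume y: "0 < y"
    have "\<bar>\<psi> y\<bar> \<le> 2 * exp (- \<kappa> * y)" using \<psi>_bound y by simp
    also have "\<dots> \<le> 2" using y \<kappa>_pos by simp
    finally show "\<bar>\<psi> y\<bar> \<le> 2" .
  qed measurable
  note fai = integrable_lborel_imp(1)[OF fi, of 0 a]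
  define p1 where "p1 y = f y * (exp (\<kappa> * y) - exp (- \<kappa> * y))" for y
  define p2 where "p2 y = f y * exp (- \<kappa> * y)" for y
  have p1ai: "p1 absolutely_integrable_on {0..a}" and p2ai: "p2 absolutely_integrable_on {0..a}"
    unfolding p1_def[abs_def] p2_def[abs_def]
    by (intro absolutely_integrable_mult_continuous[OF fai] continuous_intros)+
  define P1 where "P1 x = integral {0..x} p1" for x
  define P2 where "P2 x = integral {0..x} p2" for x
  have pP1: "is_primitive a P1 p1" and pP2: "is_primitive a P2 p2"
    unfolding P1_def[abs_def] P2_def[abs_def] by (rule primitiveI[OF p1ai], simp) (rule primitiveI[OF p2ai], simp)
  define R where "R = P2 a"
  have formula: "\<psi> x = exp (- \<kappa> * x) - 1 / (2 * \<kappa>) * (exp (- \<kappa> * x) * P1 x + (exp (\<kappa> * x) - exp (- \<kappa> * x)) * (R - P2 x))"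
    if x: "x \<in> {0..a}" for x
  proof -
    define g where "g y = q y * G x y * \<psi> y" for y
    have gf: "g y = G x y * f y" for y by (simp add: g_def f_def)
    have "\<bar>g y\<bar> \<le> \<bar>q y\<bar> * (2 * exp (- \<kappa> * x) / (2 * \<kappa>))" for y
      unfolding g_def by (rule qGA_bound[OF _ \<psi>_bound]) (use x in auto)
    then have gi: "integrable lborel g"
      by (rule integrable_abs_bound[OF q_abs_mult_integrable, rotated]) (simp add: g_def[abs_def])
    have "(LINT y|lborel. g y) = integral {0..a} g"
      by (rule integrable_lborel_imp(2)[OF gi]) (simp add: gf f0)
    also have "\<dots> = integral {0..x} g + integral {x..a} g"
      using x set_lebesgue_integral_eq_integral(1)[OF integrable_lborel_imp(1)[OF gi]]
      by (intro Henstock_Kurzweil_Integration.integral_combine[symmetric]) auto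
    also have "integral {0..x} g = integral {0..x} (\<lambda>y. (exp (- \<kappa> * x) / (2 * \<kappa>)) * p1 y)"
    proof (rule integral_cong)
      fix y assume y: "y \<in> {0..x}"
      have "exp (- \<kappa> * \<bar>x - y\<bar>) = exp (- \<kappa> * x) * exp (\<kappa> * y)" "exp (- \<kappa> * (x + y)) = exp (- \<kappa> * x) * exp (- \<kappa> * y)"
        using y by (simp_all add: algebra_simps flip: exp_add)
      then show "g y = (exp (- \<kappa> * x) / (2 * \<kappa>)) * p1 y" unfolding gf G_def p1_def by (simp add: field_simps)
    qed
    also have "\<dots> = (exp (- \<kappa> * x) / (2 * \<kappa>)) * P1 x" by (simp only: integral_mult_right P1_def)
    also have "integral {x..a} g = integral {x..a} (\<lambda>y. ((exp (\<kappa> * x) - exp (- \<kappa> * x)) / (2 * \<kappa>)) * p2 y)"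
    proof (rule integral_cong)
      fix y assume y: "y \<in> {x..a}"
      have "exp (- \<kappa> * \<bar>x - y\<bar>) = exp (\<kappa> * x) * exp (- \<kappa> * y)" "exp (- \<kappa> * (x + y)) = exp (- \<kappa> * x) * exp (- \<kappa> * y)"
        using y by (simp_all add: algebra_simps flip: exp_add)
      then show "g y = ((exp (\<kappa> * x) - exp (- \<kappa> * x)) / (2 * \<kappa>)) * p2 y" unfolding gf G_def p2_def by (simp add: field_simps)
    qed
    also have "\<dots> = ((exp (\<kappa> * x) - exp (- \<kappa> * x)) / (2 * \<kappa>)) * (R - P2 x)"
      using integral_unique[OF primitive_has_integral[OF pP2, of x a]] x unfolding R_def by (simp only: integral_mult_right) auto
    finally have L: "(LINT y|lborel. g y) = exp (- \<kappa> * x) / (2 * \<kappa>) * P1 x + (exp (\<kappa> * x) - exp (- \<kappa> * x)) / (2 * \<kappa>) * (R - P2 x)" .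
    have e: "1 / (2 * \<kappa>) * (v * p + w * r) = v / (2 * \<kappa>) * p + w / (2 * \<kappa>) * r" for v p w r
      by (simp add: add_divide_distrib)
    have "\<psi> x = exp (- \<kappa> * x) - (LINT y|lborel. g y)"
      unfolding g_def by (rule \<psi>_equation) (use x in simp)
    then show ?thesis unfolding L e .
  qed
  \<comment> \<open>The terms with \<open>p1\<close> and \<open>p2\<close> drop out of the first
    derivative, because exp(- \<kappa> x) p1 = (exp(\<kappa> x) - exp(- \<kappa> x)) p2 by
    definition.\<close>
  define \<psi>' where "\<psi>' x = - \<kappa> * exp (- \<kappa> * x) - 1 / 2 * (- (exp (- \<kappa> * x) * P1 x) + (exp (\<kappa> * x) + exp (- \<kappa> * x)) * (R - P2 x))" for x
  have pe: "is_primitive a (\<lambda>x. exp (c * x)) (\<lambda>x. c * exp (c * x))" for c :: real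
    by (rule primitive_deriv) (auto intro!: continuous_intros derivative_eq_intros simp flip: has_real_derivative_iff_has_vector_derivative)
  have ee: "exp (\<kappa> * x) * exp (- \<kappa> * x) = 1" for x by (simp flip: exp_add)
  have pRP: "is_primitive a (\<lambda>x. R - P2 x) (\<lambda>x. 0 - p2 x)" by (intro primitive_diff primitive_const pP2)
  have "is_primitive a (\<lambda>x. exp (- \<kappa> * x) - 1 / (2 * \<kappa>) * (exp (- \<kappa> * x) * P1 x + (exp (\<kappa> * x) - exp (- \<kappa> * x)) * (R - P2 x)))
    (\<lambda>x. - \<kappa> * exp (- \<kappa> * x) - 1 / (2 * \<kappa>) * ((- \<kappa> * exp (- \<kappa> * x) * P1 x + exp (- \<kappa> * x) * p1 x) + 
       ((\<kappa> * exp (\<kappa> * x) - - \<kappa> * exp (- \<kappa> * x)) * (R - P2 x) + (exp (\<kappa> * x) - exp (- \<kappa> * x)) * (0 - p2 x))))"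
    by (intro primitive_diff primitive_cmult primitive_add primitive_mult pe pP1 pRP)
  then have pr1: "is_primitive a \<psi> \<psi>'"
  proof (rule primitive_cong)
    fix x assume "x \<in> {0..a}"
    then show "exp (- \<kappa> * x) - 1 / (2 * \<kappa>) * (exp (- \<kappa> * x) * P1 x + (exp (\<kappa> * x) - exp (- \<kappa> * x)) * (R - P2 x)) = \<psi> x"
      using formula by simp
    show "- \<kappa> * exp (- \<kappa> * x) - 1 / (2 * \<kappa>) * ((- \<kappa> * exp (- \<kappa> * x) * P1 x + exp (- \<kappa> * x) * p1 x) + 
       ((\<kappa> * exp (\<kappa> * x) - - \<kappa> * exp (- \<kappa> * x)) * (R - P2 x) + (exp (\<kappa> * x) - exp (- \<kappa> * x)) * (0 - p2 x))) = \<psi>' x"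
      unfolding \<psi>'_def p1_def p2_def using \<kappa>_pos by (simp add: field_simps)
  qed
  have "is_primitive a (\<lambda>x. - \<kappa> * exp (- \<kappa> * x) - 1 / 2 * (- (exp (- \<kappa> * x) * P1 x) + (exp (\<kappa> * x) + exp (- \<kappa> * x)) * (R - P2 x)))
    (\<lambda>x. - \<kappa> * (- \<kappa> * exp (- \<kappa> * x)) - 1 / 2 * (- (- \<kappa> * exp (- \<kappa> * x) * P1 x + exp (- \<kappa> * x) * p1 x) + 
       ((\<kappa> * exp (\<kappa> * x) + - \<kappa> * exp (- \<kappa> * x)) * (R - P2 x) + (exp (\<kappa> * x) + exp (- \<kappa> * x)) * (0 - p2 x))))"
    by (intro primitive_diff primitive_cmult primitive_add primitive_minus primitive_mult pe pP1 pRP)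
  then have pr2: "is_primitive a \<psi>' (\<lambda>x. (q x + \<kappa>\<^sup>2) * \<psi> x)"
  proof (rule primitive_cong)
    fix x assume x: "x \<in> {0..a}"
    define u v where "u = exp (\<kappa> * x)" and "v = exp (- \<kappa> * x)"
    have uv: "u * v = 1" unfolding u_def v_def by (rule ee)
    have fx: "f x = q x * \<psi> x" by (simp add: f_def)
    have F: "\<psi> x = v - 1 / (2 * \<kappa>) * (v * P1 x + (u - v) * (R - P2 x))"
      using formula[OF x] by (simp only: u_def v_def)
    \<comment> \<open>In the second derivative these terms add up instead of cancelling and leave f
      u v = q \<psi>.\<close>
    have "- \<kappa> * (- \<kappa> * v) - 1 / 2 * (- (- \<kappa> * v * P1 x + v * (f x * (u - v))) + 
       ((\<kappa> * u + - \<kappa> * v) * (R - P2 x) + (u + v) * (0 - f x * v))) = 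
       \<kappa>\<^sup>2 * (v - 1 / (2 * \<kappa>) * (v * P1 x + (u - v) * (R - P2 x))) + f x * (u * v)"
      using \<kappa>_pos by (simp add: field_simps power2_eq_square)
    also have "\<dots> = (q x + \<kappa>\<^sup>2) * \<psi> x" unfolding F[symmetric] uv fx by (simp add: algebra_simps)
    finally show "- \<kappa> * (- \<kappa> * exp (- \<kappa> * x)) - 1 / 2 * (- (- \<kappa> * exp (- \<kappa> * x) * P1 x + exp (- \<kappa> * x) * p1 x) + 
       ((\<kappa> * exp (\<kappa> * x) + - \<kappa> * exp (- \<kappa> * x)) * (R - P2 x) + (exp (\<kappa> * x) + exp (- \<kappa> * x)) * (0 - p2 x))) = (q x + \<kappa>\<^sup>2) * \<psi> x"
      unfolding u_def v_def p1_def p2_def .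
  qed (simp add: \<psi>'_def)
  show ?thesis
  proof (rule that[of \<psi>'])
    show "is_real_sol a (\<lambda>x. q x + \<kappa>\<^sup>2) \<psi> \<psi>'" using pr1 pr2 by (simp add: is_real_sol_def)
    have P0: "P1 0 = 0" "P2 0 = 0" by (simp_all add: P1_def P2_def)
    show "\<psi> 0 = 1" using formula[of 0] a P0 by simp
    show "\<psi>' a = - \<kappa> * \<psi> a" using formula[of a] a \<kappa>_pos unfolding \<psi>'_def R_def by (simp add: field_simps)
    have "R = integral {0..a} p2" by (simp add: R_def P2_def)
    also have "\<dots> = (LINT y|lborel. p2 y)"
    proof (rule integrable_lborel_imp(2)[symmetric])
      show "integrable lborel p2"
        unfolding p2_def[abs_def] f_def mult.assoc
      proof (rule q_mult_integrable)
        fix y :: real assume y: "0 < y"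
        have "\<bar>\<psi> y\<bar> * exp (- \<kappa> * y) \<le> (2 * exp (- \<kappa> * y)) * exp (- \<kappa> * y)"
          using \<psi>_bound[of y] y by (intro mult_right_mono) auto
        also have "\<dots> \<le> (2 * 1) * 1" using y \<kappa>_pos by (intro mult_mono) auto
        finally show "\<bar>\<psi> y * exp (- \<kappa> * y)\<bar> \<le> 2" by (simp add: abs_mult)
      qed measurable
    qed (simp add: p2_def f0)
    \<comment> \<open>The leading part exp(- \<kappa> y) of \<psi> doubles the exponent and yields
      the transform of q; the remainder will be the transform of E.\<close>
    also have "\<dots> = (LINT y|lborel. q y * exp (- 2 * y * \<kappa>) + q y * exp (- \<kappa> * y) * (\<psi> y - exp (- \<kappa> * y)))"
    proof (rule Bochner_Integration.integral_cong[OF refl])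
      fix y
      have "exp (- 2 * y * \<kappa>) = exp (- \<kappa> * y) * exp (- \<kappa> * y)" by (simp add: algebra_simps flip: exp_add)
      then show "p2 y = q y * exp (- 2 * y * \<kappa>) + q y * exp (- \<kappa> * y) * (\<psi> y - exp (- \<kappa> * y))"
        unfolding p2_def f_def by (simp add: algebra_simps)
    qed
    also have "\<dots> = (LINT y|lborel. q y * exp (- 2 * y * \<kappa>)) + (LINT y|lborel. q y * exp (- \<kappa> * y) * (\<psi> y - exp (- \<kappa> * y)))"
    proof (rule Bochner_Integration.integral_add)
      show "integrable lborel (\<lambda>y. q y * exp (- 2 * y * \<kappa>))" by (rule q_exp_integrable)
      show "integrable lborel (\<lambda>y. q y * exp (- \<kappa> * y) * (\<psi> y - exp (- \<kappa> * y)))"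
        unfolding mult.assoc
      proof (rule q_mult_integrable)
        fix y :: real assume y: "0 < y"
        then have e1: "exp (- \<kappa> * y) \<le> 1" using \<kappa>_pos by simp
        have "\<bar>\<psi> y - exp (- \<kappa> * y)\<bar> \<le> 2 * \<rho> * exp (- \<kappa> * y)" using \<psi>_shape[of y] y by simp
        also have "\<dots> \<le> 1 * 1" using \<rho> e1 by (intro mult_mono) auto
        finally have "exp (- \<kappa> * y) * \<bar>\<psi> y - exp (- \<kappa> * y)\<bar> \<le> 1 * 1"
          using e1 by (intro mult_mono) auto
        then show "\<bar>exp (- \<kappa> * y) * (\<psi> y - exp (- \<kappa> * y))\<bar> \<le> 1" by (simp add: abs_mult)
      qed measurable
    qed
    also have "(LINT y|lborel. q y * exp (- \<kappa> * y) * (\<psi> y - exp (- \<kappa> * y))) = (LINT \<alpha>|lborel. indicator {0..} \<alpha> * exp (- 2 * \<alpha> * \<kappa>) * E \<alpha>)"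
      by (rule laplace_E[symmetric])
    finally have R: "R = (LINT y|lborel. q y * exp (- 2 * y * \<kappa>)) + (LINT \<alpha>|lborel. indicator {0..} \<alpha> * exp (- 2 * \<alpha> * \<kappa>) * E \<alpha>)" .
    have "\<psi>' 0 = - \<kappa> - R" using P0 by (simp add: \<psi>'_def)
    then show "\<psi>' 0 = - \<kappa> - (LINT \<alpha>|lborel. q \<alpha> * exp (- 2 * \<alpha> * \<kappa>)) - (LINT \<alpha>|lborel. indicator {0..} \<alpha> * exp (- 2 * \<alpha> * \<kappa>) * E \<alpha>)"
      by (simp only: R diff_diff_eq)
  qed
qed

end

section \<open>The asymptotic expansion\<close>

text \<open>A potential is only Lebesgue measurable, whereas Fubini's theorem needs a Borel representative.\<close>
definition borel_trunc :: "(real \<Rightarrow> real) \<Rightarrow> real \<Rightarrow> real \<Rightarrow> real" where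
  "borel_trunc q a = (\<lambda>y. indicator {0<..<a} y *
     (SOME g. g \<in> borel_measurable borel \<and> (AE y in lborel. y \<in> {0<..<a} \<longrightarrow> g y = q y)) y)"

lemma borel_trunc:
  assumes q: "q absolutely_integrable_on {0..a}"
  shows "half_line (borel_trunc q a)" "AE y in lborel. y \<in> {0<..<a} \<longrightarrow> borel_trunc q a y = q y"
    "\<And>y. y \<ge> a \<Longrightarrow> borel_trunc q a y = 0"
proof -
  have "(\<lambda>y. indicator {0..a} y *\<^sub>R q y) \<in> borel_measurable lebesgue"
    using q unfolding set_integrable_def by (rule borel_measurable_integrable)
  then obtain g' where g': "g' \<in> borel_measurable lborel" "AE y in lborel. indicator {0..a} y *\<^sub>R q y = g' y"
    using completion_ex_borel_measurable_real by blast
  define g where "g = (SOME g. g \<in> borel_measurable borel \<and> (AE y in lborel. y \<in> {0<..<a} \<longrightarrow> g y = q y))"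
  have "g' \<in> borel_measurable borel \<and> (AE y in lborel. y \<in> {0<..<a} \<longrightarrow> g' y = q y)"
    using g' by (auto elim!: eventually_mono)
  then have g: "g \<in> borel_measurable borel" "AE y in lborel. y \<in> {0<..<a} \<longrightarrow> g y = q y"
    using someI[of "\<lambda>g. g \<in> borel_measurable borel \<and> (AE y in lborel. y \<in> {0<..<a} \<longrightarrow> g y = q y)" g']
    unfolding g_def by blast+
  have bt: "borel_trunc q a y = indicator {0<..<a} y * g y" for y by (simp add: borel_trunc_def g_def)
  show ae: "AE y in lborel. y \<in> {0<..<a} \<longrightarrow> borel_trunc q a y = q y"
    using g(2) by eventually_elim (simp add: bt)
  show "\<And>y. y \<ge> a \<Longrightarrow> borel_trunc q a y = 0" by (simp add: bt)
  have m: "borel_trunc q a \<in> borel_measurable borel" using g(1) unfolding borel_trunc_def g_def[symmetric] by measurable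
  show "half_line (borel_trunc q a)"
  proof
    show "borel_trunc q a \<in> borel_measurable borel" by (rule m)
    show "borel_trunc q a y = 0" if "y \<le> 0" for y using that by (simp add: bt)
    have "q absolutely_integrable_on {0<..<a}" using q by (simp add: absolutely_integrable_on_Icc_iff_Ioo)
    then have "integrable lebesgue (\<lambda>y. indicator {0<..<a} y *\<^sub>R q y)" by (simp add: set_integrable_def)
    moreover have "AE y in lebesgue. indicator {0<..<a} y *\<^sub>R q y = borel_trunc q a y"
      using AE_completion[OF g(2)] by eventually_elim (simp add: bt indicator_def)
    moreover have "borel_trunc q a \<in> borel_measurable lebesgue" using m by (simp add: measurable_completion)
    ultimately have "integrable lebesgue (borel_trunc q a)"
      using integrable_cong_AE_imp by blast
    then show "integrable lborel (borel_trunc q a)" using m by (simp add: integrable_completion)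
  qed
qed

lemma mass_borel_trunc:
  assumes q: "q absolutely_integrable_on {0..a}"
  shows "mass (borel_trunc q a) a = (LINT y:{0<..<a}|lebesgue. \<bar>q y\<bar>)"
proof -
  interpret half_line "borel_trunc q a" by (rule borel_trunc[OF q])
  have m: "(\<lambda>y. indicator {..a} y * \<bar>borel_trunc q a y\<bar>) \<in> borel_measurable borel" by measurable
  have q': "q absolutely_integrable_on {0<..<a}" using q by (simp add: absolutely_integrable_on_Icc_iff_Ioo)
  have "mass (borel_trunc q a) a = (LINT y|lebesgue. indicator {..a} y * \<bar>borel_trunc q a y\<bar>)"
    unfolding mass_def using m by (simp add: integral_completion)
  also have "\<dots> = (LINT y|lebesgue. indicator {0<..<a} y *\<^sub>R \<bar>q y\<bar>)"
  proof (rule integral_cong_AE)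
    show "(\<lambda>y. indicator {..a} y * \<bar>borel_trunc q a y\<bar>) \<in> borel_measurable lebesgue"
      using m by (simp add: measurable_completion)
    show "(\<lambda>y. indicator {0<..<a} y *\<^sub>R \<bar>q y\<bar>) \<in> borel_measurable lebesgue"
    proof -
      have "(\<lambda>y. \<bar>q y\<bar>) absolutely_integrable_on {0<..<a}" using absolutely_integrable_abs[OF q'] by simp
      then show ?thesis unfolding set_integrable_def by (rule borel_measurable_integrable)
    qed
    show "AE y in lebesgue. indicator {..a} y * \<bar>borel_trunc q a y\<bar> = indicator {0<..<a} y *\<^sub>R \<bar>q y\<bar>"
      using AE_completion[OF borel_trunc(2)[OF q]]
    proof eventually_elim
      fix y assume "y \<in> {0<..<a} \<longrightarrow> borel_trunc q a y = q y"
      moreover have "y \<notin> {0<..<a} \<Longrightarrow> borel_trunc q a y = 0" using borel_trunc(3)[OF q, of y] q_zero[of y] by force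
      ultimately show "indicator {..a} y * \<bar>borel_trunc q a y\<bar> = indicator {0<..<a} y *\<^sub>R \<bar>q y\<bar>"
        by (cases "y \<in> {0<..<a}") (auto simp: indicator_def)
    qed
  qed
  finally show ?thesis by (simp add: set_lebesgue_integral_def)
qed

text \<open>Truncating at \<alpha> itself makes the value depend on q below \<alpha> alone and on no
  choice of a. Any longer truncation gives the same value.\<close>

definition correction :: "(real \<Rightarrow> real) \<Rightarrow> real \<Rightarrow> real" where
  "correction q \<alpha> = half_line.E (borel_trunc q \<alpha>) \<alpha>"

lemma correction_cong:
  assumes q1: "q1 absolutely_integrable_on {0..a}" and q2: "q2 absolutely_integrable_on {0..c}"
    and eq: "AE y in lborel. y \<in> {0<..<\<alpha>} \<longrightarrow> q1 y = q2 y" and \<alpha>: "\<alpha> \<le> a" "\<alpha> \<le> c"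
  shows "half_line.E (borel_trunc q1 a) \<alpha> = half_line.E (borel_trunc q2 c) \<alpha>"
proof (rule E_cong[OF borel_trunc(1)[OF q1] borel_trunc(1)[OF q2] _ order_refl])
  show "AE y in lborel. y < \<alpha> \<longrightarrow> borel_trunc q1 a y = borel_trunc q2 c y"
    using eq borel_trunc(2)[OF q1] borel_trunc(2)[OF q2]
  proof eventually_elim
    fix y assume y: "y \<in> {0<..<\<alpha>} \<longrightarrow> q1 y = q2 y" "y \<in> {0<..<a} \<longrightarrow> borel_trunc q1 a y = q1 y" 
      "y \<in> {0<..<c} \<longrightarrow> borel_trunc q2 c y = q2 y"
    show "y < \<alpha> \<longrightarrow> borel_trunc q1 a y = borel_trunc q2 c y"
    proof (cases "y \<le> 0")
      case True
      then show ?thesis using half_line.q_zero[OF borel_trunc(1)[OF q1]] half_line.q_zero[OF borel_trunc(1)[OF q2]] by simp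
    next
      case False
      then show ?thesis using y \<alpha> by auto
    qed
  qed
qed

lemma correction_eq:
  assumes q: "q absolutely_integrable_on {0..a}" and \<alpha>: "0 \<le> \<alpha>" "\<alpha> \<le> a"
  shows "correction q \<alpha> = half_line.E (borel_trunc q a) \<alpha>"
  unfolding correction_def
  by (rule correction_cong[OF absolutely_integrable_on_subinterval[OF q] q]) (use \<alpha> in auto)

lemma correction_bound:
  assumes q: "q absolutely_integrable_on {0..\<alpha>}" and \<alpha>: "0 \<le> \<alpha>"
  shows "\<bar>correction q \<alpha>\<bar> \<le> (LINT y:{0<..<\<alpha>}|lebesgue. \<bar>q y\<bar>)\<^sup>2 * exp (\<alpha> * (LINT y:{0<..<\<alpha>}|lebesgue. \<bar>q y\<bar>))"
  using half_line.E_bound[OF borel_trunc(1)[OF q] \<alpha>] unfolding correction_def mass_borel_trunc[OF q] .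

lemma correction_continuous:
  assumes q: "q absolutely_integrable_on {0..a}"
  shows "continuous_on {0..a} (correction q)"
proof -
  interpret half_line "borel_trunc q a" by (rule borel_trunc[OF q])
  show ?thesis by (rule continuous_on_eq[OF continuous_on_E[of a]]) (simp add: correction_eq[OF q])
qed

lemma real_sol_spike:
  assumes "is_real_sol c Q u v" "negligible N" "\<And>x. x \<in> {0..c} - N \<Longrightarrow> Q' x = Q x"
  shows "is_real_sol c Q' u v"
  using assms(1) primitive_spike[OF real_sol_primitive(2)[OF assms(1)] assms(2), of "\<lambda>x. Q' x * u x"] assms(3)
  by (simp add: is_real_sol_def)

text \<open>The truncated q has no mass beyond a, so the error is the tail of the transform of E.
  There |E| <= tot^2 exp(\<alpha> tot), and the decay rate 2 \<kappa> - tot turns this into exp(a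
  tot) exp(- 2 a \<kappa>). With \<kappa> >= 1 the rate is at least 1, which disposes of the
  denominator.\<close>

lemma laplace_truncation:
  assumes q: "q absolutely_integrable_on {0..a}" and a: "a > 0"
    and H: "half_line_laplace (borel_trunc q a) \<kappa>" and \<kappa>1: "\<kappa> \<ge> 1"
  shows "\<bar>(LINT \<alpha>:{0<..<a}|lebesgue. (q \<alpha> + correction q \<alpha>) * exp (- 2 * \<alpha> * \<kappa>)) -
      ((LINT \<alpha>|lborel. borel_trunc q a \<alpha> * exp (- 2 * \<alpha> * \<kappa>)) + 
       (LINT \<alpha>|lborel. indicator {0..} \<alpha> * exp (- 2 * \<alpha> * \<kappa>) * half_line.E (borel_trunc q a) \<alpha>))\<bar>
    \<le> ((half_line.tot (borel_trunc q a))\<^sup>2 * exp (a * half_line.tot (borel_trunc q a))) * exp (- 2 * a * \<kappa>)"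
proof -
  interpret half_line_laplace "borel_trunc q a" \<kappa> by fact
  let ?q = "borel_trunc q a"
  define F where "F \<alpha> = indicator {0..} \<alpha> * exp (- 2 * \<alpha> * \<kappa>) * E \<alpha>" for \<alpha>
  define F1 where "F1 \<alpha> = indicator {0..<a} \<alpha> * exp (- 2 * \<alpha> * \<kappa>) * E \<alpha>" for \<alpha>
  have iF: "integrable lborel F" unfolding F_def by (rule laplace_E_integrable)
  have iF1: "integrable lborel F1"
    by (rule integrable_abs_bound[OF integrable_abs[OF iF]]) (auto simp: F_def F1_def[abs_def] indicator_def)
  have m: "(\<lambda>\<alpha>. ?q \<alpha> * exp (- 2 * \<alpha> * \<kappa>) + F1 \<alpha>) \<in> borel_measurable borel"
    unfolding F1_def[abs_def] by measurable
  have ml: "(\<lambda>\<alpha>. ?q \<alpha> * exp (- 2 * \<alpha> * \<kappa>) + F1 \<alpha>) \<in> borel_measurable lebesgue"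
    using m by (simp add: measurable_completion)
  have ae: "AE \<alpha> in lebesgue. ?q \<alpha> * exp (- 2 * \<alpha> * \<kappa>) + F1 \<alpha> = indicator {0<..<a} \<alpha> *\<^sub>R ((q \<alpha> + correction q \<alpha>) * exp (- 2 * \<alpha> * \<kappa>))"
    using AE_completion[OF borel_trunc(2)[OF q]] AE_completion[OF AE_lborel_singleton[of 0]]
  proof eventually_elim
    fix \<alpha> assume y: "\<alpha> \<in> {0<..<a} \<longrightarrow> ?q \<alpha> = q \<alpha>" "\<alpha> \<noteq> 0"
    consider "\<alpha> < 0" | "\<alpha> \<in> {0<..<a}" | "\<alpha> \<ge> a" "\<alpha> > 0" using y(2) a by fastforce
    then show "?q \<alpha> * exp (- 2 * \<alpha> * \<kappa>) + F1 \<alpha> = indicator {0<..<a} \<alpha> *\<^sub>R ((q \<alpha> + correction q \<alpha>) * exp (- 2 * \<alpha> * \<kappa>))"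
    proof cases
      case 2
      then have "correction q \<alpha> = E \<alpha>" by (intro correction_eq[OF q]) auto
      then show ?thesis using 2 y by (simp add: F1_def algebra_simps)
    qed (use a in \<open>auto simp: F1_def q_zero borel_trunc(3)[OF q]\<close>)
  qed
  have "(LINT \<alpha>:{0<..<a}|lebesgue. (q \<alpha> + correction q \<alpha>) * exp (- 2 * \<alpha> * \<kappa>)) = (LINT \<alpha>|lebesgue. ?q \<alpha> * exp (- 2 * \<alpha> * \<kappa>) + F1 \<alpha>)"
    unfolding set_lebesgue_integral_def
    by (rule integral_cong_AE[symmetric, OF ml borel_measurable_AE[OF ml ae] ae])
  also have "\<dots> = (LINT \<alpha>|lborel. ?q \<alpha> * exp (- 2 * \<alpha> * \<kappa>) + F1 \<alpha>)"
    using m by (simp add: integral_completion)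
  also have "\<dots> = (LINT \<alpha>|lborel. ?q \<alpha> * exp (- 2 * \<alpha> * \<kappa>)) + (LINT \<alpha>|lborel. F1 \<alpha>)"
    by (rule Bochner_Integration.integral_add[OF q_exp_integrable iF1])
  finally have 1: "(LINT \<alpha>:{0<..<a}|lebesgue. (q \<alpha> + correction q \<alpha>) * exp (- 2 * \<alpha> * \<kappa>)) = 
     (LINT \<alpha>|lborel. ?q \<alpha> * exp (- 2 * \<alpha> * \<kappa>)) + (LINT \<alpha>|lborel. F1 \<alpha>)" .
  have dp: "2 * decay > 0" "2 * decay \<ge> 1" using decay_pos \<kappa>_tot \<kappa>1 by (auto simp: decay_def)
  have "\<bar>LINT \<alpha>|lborel. F \<alpha> - F1 \<alpha>\<bar> \<le> (LINT \<alpha>|lborel. tot\<^sup>2 * (indicator {a..} \<alpha> * exp (- (2 * decay) * \<alpha>)))"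
  proof (rule lebesgue_integral_abs_bound)
    show "integrable lborel (\<lambda>\<alpha>. tot\<^sup>2 * (indicator {a..} \<alpha> * exp (- (2 * decay) * \<alpha>)))"
      by (intro integrable_mult_right exp_half_line(1) dp)
    fix \<alpha>
    show "\<bar>F \<alpha> - F1 \<alpha>\<bar> \<le> tot\<^sup>2 * (indicator {a..} \<alpha> * exp (- (2 * decay) * \<alpha>))"
    proof (cases "\<alpha> \<ge> a")
      case True
      have "\<bar>F \<alpha>\<bar> \<le> tot\<^sup>2 * (indicator {0..} \<alpha> * exp (- (2 * decay) * \<alpha>))"
        unfolding F_def by (rule laplace_abs_le[OF E_tot_bound])
      then show ?thesis using True a by (simp add: F1_def)
    next
      case False
      then have "F \<alpha> = F1 \<alpha>" by (auto simp: F_def F1_def indicator_def)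
      then show ?thesis using False by simp
    qed
  qed
  also have "\<dots> = tot\<^sup>2 * (exp (- (2 * decay) * a) / (2 * decay))"
    unfolding integral_mult_right_zero exp_half_line(2)[OF dp(1)] ..
  also have "\<dots> \<le> tot\<^sup>2 * (exp (- (2 * decay) * a) / 1)"
    using dp by (intro mult_left_mono divide_left_mono) auto
  also have "exp (- (2 * decay) * a) = exp (a * tot) * exp (- 2 * a * \<kappa>)"
    by (simp add: decay_def algebra_simps flip: exp_add)
  finally have 2: "\<bar>LINT \<alpha>|lborel. F \<alpha> - F1 \<alpha>\<bar> \<le> (tot\<^sup>2 * exp (a * tot)) * exp (- 2 * a * \<kappa>)" by simp
  have 3: "(LINT \<alpha>|lborel. F \<alpha> - F1 \<alpha>) = (LINT \<alpha>|lborel. F \<alpha>) - (LINT \<alpha>|lborel. F1 \<alpha>)"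
    by (rule Bochner_Integration.integral_diff[OF iF iF1])
  show ?thesis using 2 unfolding 1 3 F_def[symmetric] by simp
qed

text \<open>On [0, a] the potential and its truncation agree almost everywhere. Hence the Weyl
  solution u of the one and the solution \<psi> of the other satisfy the same equation there and can
  be compared, whatever happens beyond a.\<close>

lemma m_function_asymptotic:
  assumes pot: "is_potential q b h" and a: "0 < a" "ereal a \<le> b"
  obtains T \<kappa>0 where 
    "\<And>\<kappa>. \<kappa> \<ge> \<kappa>0 \<Longrightarrow> norm (m_function q b h (- (complex_of_real \<kappa>)\<^sup>2)
       - complex_of_real (- \<kappa> - (LINT \<alpha>:{0<..<a}|lebesgue. (q \<alpha> + correction q \<alpha>) * exp (- 2 * \<alpha> * \<kappa>)))) \<le> T * (\<kappa> * exp (- 2 * a * \<kappa>))"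
proof -
  have aD: "a \<in> closed_domain b" using a by (simp add: closed_domain_def)
  have q: "q absolutely_integrable_on {0..a}" by (rule potential_absolutely_integrable[OF pot aD])
  interpret half_line "borel_trunc q a" by (rule borel_trunc[OF q])
  let ?q = "borel_trunc q a"
  from m_function_real[OF pot] obtain C where C: "C \<ge> 0" 
    and M: "\<And>\<kappa>. \<kappa> \<ge> C + 1 \<Longrightarrow> \<exists>u v. u 0 = 1 \<and> (\<forall>c \<in> closed_domain b. is_real_sol c (\<lambda>x. q x + \<kappa>\<^sup>2) u v) \<and>
        (\<forall>x\<in>closed_domain b. 0 \<le> u x \<and> v x \<le> C * u x) \<and> 
        m_function q b h (- (complex_of_real \<kappa>)\<^sup>2) = complex_of_real (v 0)" by blast
  \<comment> \<open>10 C serves the comparison, 10 tot brings \<psi> within ten percent of the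
    exponential, 1 / a ensures exp(2 a \<kappa>) >= 2, and the final 1 gives \<kappa> >= C + 1 and
    \<kappa> >= 1.\<close>
  define \<kappa>0 where "\<kappa>0 = 10 * C + 10 * tot + 1 / a + 1"
  define T where "T = 10 + tot\<^sup>2 * exp (a * tot)"
  have "norm (m_function q b h (- (complex_of_real \<kappa>)\<^sup>2)
       - complex_of_real (- \<kappa> - (LINT \<alpha>:{0<..<a}|lebesgue. (q \<alpha> + correction q \<alpha>) * exp (- 2 * \<alpha> * \<kappa>)))) \<le> T * (\<kappa> * exp (- 2 * a * \<kappa>))"
    if \<kappa>: "\<kappa> \<ge> \<kappa>0" for \<kappa>
  proof -
    have ia: "1 / a > 0" using a by simp
    have \<kappa>s: "\<kappa> \<ge> C + 1" "\<kappa> \<ge> 10 * C" "\<kappa> \<ge> 10 * tot" "\<kappa> \<ge> 1 / a" "\<kappa> \<ge> 1" "\<kappa> > 0" "\<kappa> \<ge> tot"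
      using \<kappa> C tot_nonneg ia unfolding \<kappa>0_def by linarith+
    interpret half_line_laplace ?q \<kappa> by unfold_locales (use \<kappa>s in auto)
    obtain \<psi>' where \<psi>: "is_real_sol a (\<lambda>x. ?q x + \<kappa>\<^sup>2) \<psi> \<psi>'" "\<psi> 0 = 1" "\<psi>' a = - \<kappa> * \<psi> a"
      "\<psi>' 0 = - \<kappa> - (LINT \<alpha>|lborel. ?q \<alpha> * exp (- 2 * \<alpha> * \<kappa>)) - (LINT \<alpha>|lborel. indicator {0..} \<alpha> * exp (- 2 * \<alpha> * \<kappa>) * E \<alpha>)"
      using \<psi>_sol[OF a(1) borel_trunc(3)[OF q]] by blast
    obtain u v where u: "u 0 = 1" "\<And>c. c \<in> closed_domain b \<Longrightarrow> is_real_sol c (\<lambda>x. q x + \<kappa>\<^sup>2) u v"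
      "\<And>x. x \<in> closed_domain b \<Longrightarrow> 0 \<le> u x \<and> v x \<le> C * u x"
      "m_function q b h (- (complex_of_real \<kappa>)\<^sup>2) = complex_of_real (v 0)"
      using M[OF \<kappa>s(1)] by blast
    from AE_completion[OF borel_trunc(2)[OF q]]
    obtain N where N: "negligible N" "{y. \<not> (y \<in> {0<..<a} \<longrightarrow> ?q y = q y)} \<subseteq> N"
      unfolding eventually_ae_filter_negligible by blast
    have su: "is_real_sol a (\<lambda>x. ?q x + \<kappa>\<^sup>2) u v"
    proof (rule real_sol_spike[OF u(2)[OF aD]])
      show "negligible (N \<union> {0, a})" using N(1) by (intro negligible_Un) auto
      show "?q x + \<kappa>\<^sup>2 = q x + \<kappa>\<^sup>2" if "x \<in> {0..a} - (N \<union> {0, a})" for x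
        using that N(2) by (auto simp: subset_iff less_le)
    qed
    have "2 * \<rho> \<le> 1/10" using \<kappa>s by (simp add: \<rho>_def field_simps)
    have shape: "9/10 * exp (- \<kappa> * x) \<le> \<psi> x \<and> \<psi> x \<le> 11/10 * exp (- \<kappa> * x)" if "x \<in> {0..a}" for x
    proof -
      have "\<bar>\<psi> x - exp (- \<kappa> * x)\<bar> \<le> 2 * \<rho> * exp (- \<kappa> * x)" by (rule \<psi>_shape) (use that in simp)
      also have "\<dots> \<le> 1/10 * exp (- \<kappa> * x)" using \<open>2 * \<rho> \<le> 1/10\<close> by (intro mult_right_mono) auto
      finally show ?thesis by linarith
    qed
    have "1 \<le> a * \<kappa>" using \<kappa>s(4) a(1) by (simp add: field_simps)
    then have e2: "exp (2 * a * \<kappa>) \<ge> 2" using exp_ge_add_one_self[of "2 * a * \<kappa>"] by linarith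
    have cmp: "\<bar>v 0 - \<psi>' 0\<bar> \<le> 10 * \<kappa> * exp (- 2 * a * \<kappa>)"
      by (rule exp_shape_comparison[OF \<psi>(1-3) shape su u(1) _ _ a(1) C \<kappa>s(2) \<kappa>s(6) e2]) (use u(3)[OF aD] in auto)
    note tr = laplace_truncation[OF q a(1) half_line_laplace_axioms \<kappa>s(5)]
    have "1 * exp (- 2 * a * \<kappa>) \<le> \<kappa> * exp (- 2 * a * \<kappa>)" using \<kappa>s(5) by (intro mult_right_mono) auto
    then have "(tot\<^sup>2 * exp (a * tot)) * exp (- 2 * a * \<kappa>) \<le> (tot\<^sup>2 * exp (a * tot)) * (\<kappa> * exp (- 2 * a * \<kappa>))"
      by (intro mult_left_mono) auto
    with tr cmp \<psi>(4) have "\<bar>v 0 - (- \<kappa> - (LINT \<alpha>:{0<..<a}|lebesgue. (q \<alpha> + correction q \<alpha>) * exp (- 2 * \<alpha> * \<kappa>)))\<bar> 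
        \<le> 10 * \<kappa> * exp (- 2 * a * \<kappa>) + (tot\<^sup>2 * exp (a * tot)) * (\<kappa> * exp (- 2 * a * \<kappa>))"
      by linarith
    also have "\<dots> = T * (\<kappa> * exp (- 2 * a * \<kappa>))" by (simp add: T_def algebra_simps)
    finally show ?thesis unfolding u(4) of_real_diff[symmetric] norm_of_real .
  qed
  then show ?thesis by (rule that)
qed

text \<open>The soft O absorbs the factor \<kappa>: dividing by the power 1 - \<epsilon> leaves at
  most T \<kappa> exp(- 2 a \<epsilon> \<kappa>), which tends to 0.\<close>

lemma soft_O_linear_times_exp:
  fixes f :: "real \<Rightarrow> complex"
  assumes a: "0 < a" and f: "\<And>\<kappa>. \<kappa> \<ge> \<kappa>0 \<Longrightarrow> norm (f \<kappa>) \<le> T * (\<kappa> * exp (- 2 * a * \<kappa>))"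
  shows "soft_O at_top f (\<lambda>\<kappa>. exp (- 2 * a * \<kappa>))"
  unfolding soft_O_def
proof (intro conjI allI impI)
  show "((\<lambda>\<kappa>. exp (- 2 * a * \<kappa>)) \<longlongrightarrow> 0) at_top" using a by real_asymp
  fix \<epsilon> :: real assume \<epsilon>: "\<epsilon> > 0"
  define c where "c = 2 * a * \<epsilon>"
  have c: "c > 0" using a \<epsilon> by (simp add: c_def)
  have lim: "((\<lambda>\<kappa>. T * (\<kappa> * exp (- c * \<kappa>))) \<longlongrightarrow> 0) at_top"
  proof -
    have "((\<lambda>\<kappa>. \<kappa> * exp (- c * \<kappa>)) \<longlongrightarrow> 0) at_top" using c by real_asymp
    then have "((\<lambda>\<kappa>. T * (\<kappa> * exp (- c * \<kappa>))) \<longlongrightarrow> T * 0) at_top" by (intro tendsto_mult tendsto_const)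
    then show ?thesis by simp
  qed
  show "((\<lambda>\<kappa>. norm (f \<kappa>) / \<bar>exp (- 2 * a * \<kappa>)\<bar> powr (1 - \<epsilon>)) \<longlongrightarrow> 0) at_top"
  proof (rule Lim_null_comparison[OF _ lim])
    show "\<forall>\<^sub>F \<kappa> in at_top. norm (norm (f \<kappa>) / \<bar>exp (- 2 * a * \<kappa>)\<bar> powr (1 - \<epsilon>)) \<le> T * (\<kappa> * exp (- c * \<kappa>))"
      using eventually_ge_at_top[of \<kappa>0]
    proof eventually_elim
      fix \<kappa> assume \<kappa>: "\<kappa>0 \<le> \<kappa>"
      have p: "\<bar>exp (- 2 * a * \<kappa>)\<bar> powr (1 - \<epsilon>) = exp (- 2 * a * \<kappa> + c * \<kappa>)"
        by (simp add: powr_def c_def algebra_simps)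
      have "norm (f \<kappa>) / exp (- 2 * a * \<kappa> + c * \<kappa>) \<le> T * (\<kappa> * exp (- 2 * a * \<kappa>)) / exp (- 2 * a * \<kappa> + c * \<kappa>)"
        by (intro divide_right_mono f[OF \<kappa>]) auto
      also have "\<dots> = T * (\<kappa> * (exp (- 2 * a * \<kappa>) / exp (- 2 * a * \<kappa> + c * \<kappa>)))" by simp
      also have "exp (- 2 * a * \<kappa>) / exp (- 2 * a * \<kappa> + c * \<kappa>) = exp (- c * \<kappa>)"
        by (simp flip: exp_diff)
      finally show "norm (norm (f \<kappa>) / \<bar>exp (- 2 * a * \<kappa>)\<bar> powr (1 - \<epsilon>)) \<le> T * (\<kappa> * exp (- c * \<kappa>))"
        unfolding p by simp
    qed
  qed
qed

theorem theorem1p4: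
  shows "\<exists>A :: (real \<Rightarrow> real) \<Rightarrow> ereal \<Rightarrow> ereal option \<Rightarrow> real \<Rightarrow> real.
    (\<forall>q b h. is_potential q b h \<longrightarrow>
       (b < \<infinity> \<longrightarrow> set_integrable lebesgue (einterval 0 b) (A q b h)) \<and>
       (b = \<infinity> \<longrightarrow> (\<forall>a>0. set_integrable lebesgue {0<..<a} (A q b h))) \<and>
       (\<forall>a::real. 0 < a \<and> ereal a \<le> b \<longrightarrow>
          soft_O at_top
            (\<lambda>\<kappa>::real. m_function q b h (- (complex_of_real \<kappa>)\<^sup>2)
               - complex_of_real (- \<kappa> - (LINT \<alpha>:{0<..<a}|lebesgue. A q b h \<alpha> * exp (- 2 * \<alpha> * \<kappa>))))
            (\<lambda>\<kappa>. exp (- 2 * a * \<kappa>))) \<and>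
       (\<exists>E :: real \<Rightarrow> real. continuous_on (einterval 0 b) E \<and>
          (\<forall>\<alpha>\<in>einterval 0 b.
             A q b h \<alpha> = q \<alpha> + E \<alpha> \<and>
             \<bar>E \<alpha>\<bar> \<le> (LINT y:{0<..<\<alpha>}|lebesgue. \<bar>q y\<bar>)\<^sup>2
                      * exp (\<alpha> * (LINT y:{0<..<\<alpha>}|lebesgue. \<bar>q y\<bar>))))) \<and>
    (\<forall>q\<^sub>1 b\<^sub>1 h\<^sub>1 q\<^sub>2 b\<^sub>2 h\<^sub>2 \<alpha>\<^sub>0.
       is_potential q\<^sub>1 b\<^sub>1 h\<^sub>1 \<longrightarrow> is_potential q\<^sub>2 b\<^sub>2 h\<^sub>2 \<longrightarrow>
       0 < \<alpha>\<^sub>0 \<longrightarrow> ereal \<alpha>\<^sub>0 \<le> b\<^sub>1 \<longrightarrow> ereal \<alpha>\<^sub>0 \<le> b\<^sub>2 \<longrightarrow>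
       (AE x in lebesgue. x \<in> {0<..<\<alpha>\<^sub>0} \<longrightarrow> q\<^sub>1 x = q\<^sub>2 x) \<longrightarrow>
       (AE x in lebesgue. x \<in> {0<..<\<alpha>\<^sub>0} \<longrightarrow> A q\<^sub>1 b\<^sub>1 h\<^sub>1 x = A q\<^sub>2 b\<^sub>2 h\<^sub>2 x))"
proof (rule exI[of _ "\<lambda>q b h \<alpha>. q \<alpha> + correction q \<alpha>"], intro conjI allI impI)
  \<comment> \<open>The witness for A is built from q alone; b and h influence only the error
    term.\<close>
  fix q b h assume pot: "is_potential q b h"
  note ai = potential_absolutely_integrable[OF pot]
  have int: "set_integrable lebesgue {0<..<c} (\<lambda>\<alpha>. q \<alpha> + correction q \<alpha>)" if "c \<in> closed_domain b" for c
  proof -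
    have "correction q absolutely_integrable_on {0..c}"
      by (rule absolutely_integrable_continuous_real[OF correction_continuous[OF ai[OF that]]])
    then have "(\<lambda>\<alpha>. q \<alpha> + correction q \<alpha>) absolutely_integrable_on {0..c}"
      by (rule set_integral_add(1)[OF ai[OF that]])
    then show ?thesis by (rule set_integrable_subset) auto
  qed
  show "set_integrable lebesgue (einterval 0 b) (\<lambda>\<alpha>. q \<alpha> + correction q \<alpha>)" if "b < \<infinity>"
  proof (cases rule: potential_cases[OF pot])
    case (2 r h')
    then show ?thesis using int[of r] by (simp add: einterval_simps closed_domain_simps)
  qed (use that in simp)
  show "set_integrable lebesgue {0<..<a} (\<lambda>\<alpha>. q \<alpha> + correction q \<alpha>)" if "b = \<infinity>" "a > 0" for a
    using int[of a] that by (simp add: closed_domain_simps)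
  show "soft_O at_top
      (\<lambda>\<kappa>. m_function q b h (- (complex_of_real \<kappa>)\<^sup>2)
         - complex_of_real (- \<kappa> - (LINT \<alpha>:{0<..<a}|lebesgue. (q \<alpha> + correction q \<alpha>) * exp (- 2 * \<alpha> * \<kappa>))))
      (\<lambda>\<kappa>. exp (- 2 * a * \<kappa>))" if "0 < a \<and> ereal a \<le> b" for a
  proof (rule m_function_asymptotic[OF pot conjunct1[OF that] conjunct2[OF that]])
  qed (rule soft_O_linear_times_exp[OF conjunct1[OF that]])
  show "\<exists>E. continuous_on (einterval 0 b) E \<and>
      (\<forall>\<alpha>\<in>einterval 0 b. q \<alpha> + correction q \<alpha> = q \<alpha> + E \<alpha> \<and>
         \<bar>E \<alpha>\<bar> \<le> (LINT y:{0<..<\<alpha>}|lebesgue. \<bar>q y\<bar>)\<^sup>2 * exp (\<alpha> * (LINT y:{0<..<\<alpha>}|lebesgue. \<bar>q y\<bar>)))"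
  proof (rule exI[of _ "correction q"], intro conjI ballI refl)
    show "continuous_on (einterval 0 b) (correction q)"
      unfolding continuous_on_eq_continuous_at[OF open_einterval]
    proof
      fix \<alpha> assume "\<alpha> \<in> einterval 0 b"
      then have \<alpha>: "0 < \<alpha>" "ereal \<alpha> < b" by (auto simp: einterval_def)
      \<comment> \<open>Continuity is available on [0, c] for c in the closed domain; a c strictly
        between \<alpha> and b makes \<alpha> an interior point, also for b = \<infinity>.\<close>
      obtain c where c: "\<alpha> < c" "ereal c < b"
        using ereal_dense2[OF \<alpha>(2)] by auto
      then have "c \<in> closed_domain b" using \<alpha> by (auto simp: closed_domain_def)
      then have "continuous_on {0<..<c} (correction q)"
        by (rule continuous_on_subset[OF correction_continuous[OF ai]]) auto
      then show "isCont (correction q) \<alpha>" using \<alpha> c by (simp add: continuous_on_eq_continuous_at)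
    qed
    fix \<alpha> assume "\<alpha> \<in> einterval 0 b"
    then have "\<alpha> \<in> closed_domain b" "0 \<le> \<alpha>" by (auto simp: einterval_def closed_domain_def)
    then show "\<bar>correction q \<alpha>\<bar> \<le> (LINT y:{0<..<\<alpha>}|lebesgue. \<bar>q y\<bar>)\<^sup>2 * exp (\<alpha> * (LINT y:{0<..<\<alpha>}|lebesgue. \<bar>q y\<bar>))"
      by (intro correction_bound ai)
  qed
next
  fix q\<^sub>1 b\<^sub>1 h\<^sub>1 q\<^sub>2 b\<^sub>2 h\<^sub>2 \<alpha>\<^sub>0
  assume pot: "is_potential q\<^sub>1 b\<^sub>1 h\<^sub>1" "is_potential q\<^sub>2 b\<^sub>2 h\<^sub>2" and \<alpha>: "0 < \<alpha>\<^sub>0" "ereal \<alpha>\<^sub>0 \<le> b\<^sub>1" "ereal \<alpha>\<^sub>0 \<le> b\<^sub>2"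
    and eq: "AE x in lebesgue. x \<in> {0<..<\<alpha>\<^sub>0} \<longrightarrow> q\<^sub>1 x = q\<^sub>2 x"
  have ai: "q\<^sub>1 absolutely_integrable_on {0..\<alpha>\<^sub>0}" "q\<^sub>2 absolutely_integrable_on {0..\<alpha>\<^sub>0}"
    using potential_absolutely_integrable[OF pot(1)] potential_absolutely_integrable[OF pot(2)] \<alpha>
    by (simp_all add: closed_domain_def)
  have eq': "AE y in lborel. y \<in> {0<..<\<alpha>\<^sub>0} \<longrightarrow> q\<^sub>1 y = q\<^sub>2 y" using eq by (simp only: AE_completion_iff)
  \<comment> \<open>The corrections agree at every single point, since q changed on a null set gives
    the same kernels; the exceptional set stems from the summand q alone.\<close>
  have "correction q\<^sub>1 x = correction q\<^sub>2 x" if x: "x \<in> {0<..<\<alpha>\<^sub>0}" for x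
  proof -
    have "AE y in lborel. y \<in> {0<..<x} \<longrightarrow> q\<^sub>1 y = q\<^sub>2 y"
      using eq' by eventually_elim (use x in auto)
    then show ?thesis unfolding correction_def
      by (intro correction_cong absolutely_integrable_on_subinterval[OF ai(1)] absolutely_integrable_on_subinterval[OF ai(2)])
         (use x in auto)
  qed
  then show "AE x in lebesgue. x \<in> {0<..<\<alpha>\<^sub>0} \<longrightarrow> q\<^sub>1 x + correction q\<^sub>1 x = q\<^sub>2 x + correction q\<^sub>2 x"
    using eq by (auto elim!: eventually_mono)
qed

end
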